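(* Let $G$ be a finitely presented group and let $N$ be a normal subgroup of $G$ with $G'\leq N$. Assume that $G$ contains no non-abelian free subgroup. Then the untwisted $N$-fibre product in $G\times G$ is finitely presented.
   Context: $G'$ denotes the commutator subgroup of $G$. For $N\lhd G$, the untwisted $N$-fibre product in $G\times G$ is the subgroup $\{(g_1,g_2)\in G\times G\mid g_1N=g_2N\}$. *)

theory Defs
  imports "HOL-Algebra.Generated_Groups"
begin

section \<open>Free groups\<close>

text \<open>The letter \<open>(x, True)\<close> stands for the generator \<open>x\<close> and \<open>(x, False)\<close> for its inverse.
  Elements of the free group are the freely reduced words.\<close>

definition inv_letter :: "'x \<times> bool \<Rightarrow> 'x \<times> bool" where
  "inv_letter a = (fst a, \<not> snd a)"

definition reduced :: "('x \<times> bool) list \<Rightarrow> bool" where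
  "reduced w \<longleftrightarrow> successively (\<lambda>a b. b \<noteq> inv_letter a) w"

text \<open>For reduced \<open>w\<close>, this is the reduced form of \<open>a # w\<close>; so for reduced \<open>v\<close>,
  \<open>foldr reduced_cons u v\<close> is the reduced form of \<open>u @ v\<close>.\<close>

definition reduced_cons :: "'x \<times> bool \<Rightarrow> ('x \<times> bool) list \<Rightarrow> ('x \<times> bool) list" where
  "reduced_cons a w =
     (case w of [] \<Rightarrow> [a] | b # v \<Rightarrow> if b = inv_letter a then v else a # w)"

definition free_group :: "'x set \<Rightarrow> ('x \<times> bool) list monoid" where
  "free_group A =
     \<lparr>carrier = {w. reduced w \<and> fst ` set w \<subseteq> A}, mult = foldr reduced_cons, one = []\<rparr>"

lemma inv_letter_simps [simp]:
  "inv_letter (inv_letter a) = a" "fst (inv_letter a) = fst a" "inv_letter a \<noteq> a"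
  by (auto simp: inv_letter_def prod_eq_iff)

lemma reduced_Nil [simp]: "reduced []"
  by (simp add: reduced_def)

lemma reduced_Cons: "reduced (a # w) \<longleftrightarrow> reduced w \<and> (w = [] \<or> hd w \<noteq> inv_letter a)"
  by (cases w) (auto simp: reduced_def)

lemma reduced_reduced_cons: "reduced w \<Longrightarrow> reduced (reduced_cons a w)"
  by (cases w) (auto simp: reduced_cons_def reduced_Cons)

lemma reduced_cons_inv:
  assumes "reduced w" shows "reduced_cons a (reduced_cons (inv_letter a) w) = w"
  using assms by (cases w; cases "tl w") (auto simp: reduced_cons_def reduced_Cons)

lemma reduced_cons_Cons: "reduced (a # w) \<Longrightarrow> reduced_cons a w = a # w"
  by (cases w) (auto simp: reduced_cons_def reduced_Cons)

lemma set_reduced_cons: "fst ` set (reduced_cons a w) \<subseteq> insert (fst a) (fst ` set w)"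
  by (cases w) (auto simp: reduced_cons_def)

lemma reduced_foldr: "reduced w \<Longrightarrow> reduced (foldr reduced_cons u w)"
  by (induction u) (auto intro: reduced_reduced_cons)

lemma set_foldr: "fst ` set (foldr reduced_cons u w) \<subseteq> fst ` set u \<union> fst ` set w"
proof (induction u)
  case (Cons a u)
  have "fst ` set (foldr reduced_cons (a # u) w)
      \<subseteq> insert (fst a) (fst ` set (foldr reduced_cons u w))"
    using set_reduced_cons[of a "foldr reduced_cons u w"] by simp
  also have "\<dots> \<subseteq> insert (fst a) (fst ` set u \<union> fst ` set w)"
    using Cons by (rule insert_mono)
  finally show ?case by simp
qed simp

lemma foldr_reduced_cons:
  assumes "reduced w"
  shows "foldr reduced_cons (reduced_cons a v) w = reduced_cons a (foldr reduced_cons v w)"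
  using reduced_cons_inv[OF reduced_foldr[OF assms]]
  by (cases v) (auto simp: reduced_cons_def[of a "_ # _"] reduced_cons_def[of a "[]"])

lemma foldr_assoc:
  "reduced w \<Longrightarrow>
    foldr reduced_cons (foldr reduced_cons u v) w = foldr reduced_cons u (foldr reduced_cons v w)"
  by (induction u) (auto simp: foldr_reduced_cons)

lemma foldr_Nil: "reduced u \<Longrightarrow> foldr reduced_cons u [] = u"
  by (induction u) (auto simp: reduced_cons_Cons reduced_Cons)

lemma foldr_inverse: "foldr reduced_cons (rev (map inv_letter u)) u = []"
  by (induction u) (auto simp: reduced_cons_def)

lemma foldr_rev_inverse:
  assumes "reduced w"
  shows "foldr reduced_cons (rev (map inv_letter u)) (foldr reduced_cons u w) = w"
  using foldr_assoc[OF assms, of "rev (map inv_letter u)" u] by (simp add: foldr_inverse)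

lemma group_free_group: "group (free_group A)"
proof (rule groupI)
  fix u assume u: "u \<in> carrier (free_group A)"
  let ?v = "foldr reduced_cons (rev (map inv_letter u)) []"
  have "foldr reduced_cons ?v u = []"
    using u foldr_assoc[of u "rev (map inv_letter u)" "[]"]
    by (simp add: free_group_def foldr_inverse)
  moreover have "?v \<in> carrier (free_group A)"
    using u set_foldr[of "rev (map inv_letter u)" "[]"]
    by (fastforce simp: free_group_def intro: reduced_foldr)
  ultimately show "\<exists>v\<in>carrier (free_group A). v \<otimes>\<^bsub>free_group A\<^esub> u = \<one>\<^bsub>free_group A\<^esub>"
    by (auto simp: free_group_def)
next
  fix u v assume "u \<in> carrier (free_group A)" "v \<in> carrier (free_group A)"
  then show "u \<otimes>\<^bsub>free_group A\<^esub> v \<in> carrier (free_group A)"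
    using subset_trans[OF set_foldr[of u v], of A] by (simp add: free_group_def reduced_foldr)
qed (auto simp: free_group_def foldr_assoc)

lemma free_group_universal:
  fixes G (structure)
  assumes "group G" and f: "\<And>x. x \<in> A \<Longrightarrow> f x \<in> carrier G"
  shows "\<exists>h\<in>hom (free_group A) G. \<forall>x\<in>A. h [(x, True)] = f x"
proof -
  interpret group G by fact
  define val where "val a = (if snd a then f (fst a) else inv (f (fst a)))" for a
  define h where "h w = foldr (\<lambda>a g. val a \<otimes> g) w \<one>" for w
  have val: "val a \<in> carrier G" if "fst a \<in> A" for a
    using f that by (simp add: val_def)
  have h_closed: "h w \<in> carrier G" if "fst ` set w \<subseteq> A" for w
    using that by (induction w) (auto simp: h_def val)
  have val_inv: "val (inv_letter a) = inv (val a)" if "fst a \<in> A" for a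
    using f[OF that] by (simp add: val_def inv_letter_def)
  have h_cons: "h (reduced_cons a w) = val a \<otimes> h w" if "fst a \<in> A" "fst ` set w \<subseteq> A" for a w
  proof (cases w)
    case (Cons b v)
    have "h v = val a \<otimes> (inv (val a) \<otimes> h v)"
      using that Cons val[of a] h_closed[of v] by (simp add: m_assoc[symmetric])
    then show ?thesis using that Cons val_inv[of a] by (auto simp: h_def reduced_cons_def)
  qed (simp add: h_def reduced_cons_def)
  have "h (foldr reduced_cons u w) = h u \<otimes> h w" if "fst ` set u \<subseteq> A" "fst ` set w \<subseteq> A" for u w
    using that
  proof (induction u)
    case Nil
    then show ?case using h_closed[of w] by (simp add: h_def)
  next
    case (Cons a u)
    have "fst ` set (foldr reduced_cons u w) \<subseteq> A"
      using Cons.prems subset_trans[OF set_foldr[of u w], of A] by simp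
    then have "h (foldr reduced_cons (a # u) w) = val a \<otimes> (h u \<otimes> h w)"
      using Cons by (simp add: h_cons)
    also have "\<dots> = h (a # u) \<otimes> h w"
      using Cons.prems val[of a] h_closed[of u] h_closed[of w] by (simp add: h_def m_assoc)
    finally show ?case .
  qed
  then have "h \<in> hom (free_group A) G"
    by (auto simp: hom_def free_group_def h_closed)
  moreover have "\<forall>x\<in>A. h [(x, True)] = f x"
    using f by (simp add: h_def val_def)
  ultimately show ?thesis by blast
qed

text \<open>A basis of a free group \<open>G\<close> can be taken inside \<open>G\<close>, so quantifying over subsets of
  the element type loses nothing.\<close>

definition is_free_group :: "('a, 'b) monoid_scheme \<Rightarrow> bool" where
  "is_free_group G \<longleftrightarrow> group G \<and> (\<exists>A :: 'a set. free_group A \<cong> G)"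


section \<open>Finite presentations\<close>

definition normal_closure :: "('a, 'b) monoid_scheme \<Rightarrow> 'a set \<Rightarrow> 'a set" where
  "normal_closure G R = \<Inter> {N. N \<lhd> G \<and> R \<subseteq> N}"

lemma (in group) normal_closure_normal:
  assumes "R \<subseteq> carrier G" shows "normal_closure G R \<lhd> G"
proof -
  let ?S = "{N. N \<lhd> G \<and> R \<subseteq> N}"
  have ne: "?S \<noteq> {}"
    using assms normal_inv_iff[of "carrier G"] subgroup_self by auto
  have "subgroup (\<Inter> ?S) G"
    using ne by (intro subgroups_Inter) (auto dest: normal_imp_subgroup)
  then show ?thesis
    unfolding normal_closure_def by (auto simp: normal_inv_iff)
qed

text \<open>Any finite alphabet can be renamed to a set of natural numbers.\<close>

definition finitely_presented :: "('a, 'b) monoid_scheme \<Rightarrow> bool" where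
  "finitely_presented G \<longleftrightarrow> group G \<and>
     (\<exists>(A :: nat set) R. finite A \<and> finite R \<and> R \<subseteq> carrier (free_group A) \<and>
        free_group A Mod normal_closure (free_group A) R \<cong> G)"


section \<open>Fibre products\<close>

definition fibre_product :: "('a, 'b) monoid_scheme \<Rightarrow> 'a set \<Rightarrow> ('a \<times> 'a) set" where
  "fibre_product G N =
     {(g1, g2). g1 \<in> carrier G \<and> g2 \<in> carrier G \<and> g1 <#\<^bsub>G\<^esub> N = g2 <#\<^bsub>G\<^esub> N}"

end

(*
  Proof idea.  Write Q = G/N, a finitely generated abelian group.  Passing to subgroups of finite
  index, which affects neither finite presentability nor the hypothesis, Q becomes free abelian,
  Q = Z^d.  For a linear functional u on Z^d, cut the Cayley complex of G by the heights u.  If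
  neither the half space u >= c nor the half space -u >= c carried all of N for some c, then N would
  be a non-trivial amalgam and would contain a free group of rank two.  So for each u, one of u and
  -u provides a word z over the lifts of the basis of Z^d such that z^-1 a z, for each of the
  finitely many normal generators a of N, is a product of conjugates of normal generators along
  paths that stay in the half space.  The same z serves all q in Z^d whose direction is near u or
  near -u, respectively.  As the unit sphere is compact, finitely many such contractions suffice.

  Consider the group E generated by lifts of the basis of Z^d and two copies a1, a2 of the
  generators a, subject to finitely many relations: those of G for both copies with short relators,
  with each commutator of lifts equal to the product of its two copies, and [a1, h a2' h^-1] = 1
  for short words h.  As [a1, h a2' h^-1] = 1 can be conjugated into [a2', h^-1 a1 h] = 1, a
  direction q may be replaced by -q with the two copies exchanged.  So the contractions, applied
  to a monotone word h over q, reduce the relation for h to those for words over points closer to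
  0; rearranging letters of h costs only relations over points closer to 0 as well.  Hence the two
  copies of N commute.  Each copy maps injectively to N: by the Hall-Witt identity the commutators
  of the lifts, with the second factor dropped, form the cocycle of an extension of Z^d, in which
  the relators of G hold.  Therefore E is the fibre product.
*)
theory Submission
  imports Defs "HOL-Library.Product_Plus" "HOL-Library.Function_Algebras" "HOL-Library.Multiset" "HOL-Analysis.Elementary_Metric_Spaces"
begin

text \<open>\<open>N\<close> need not be finitely generated (take the Baumslag-Solitar group BS(1,2)
  and its derived subgroup), so there is no finite presentation of \<open>N\<close> from which one
  of the fibre product could be built. Only finitely many relations [a1, h a2' h^-1] = 1 can be
  imposed, whereas the copies commute only if they hold for all \<open>h\<close>; deducing the rest
  is the heart of the matter. The induction runs on the squared Euclidean norm of the point
  \<open>q\<close> reached by \<open>h\<close>. This norm suits both ends of the argument: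
  directions form a compact sphere, and a point \<open>y\<close> with large inner product with
  \<open>q\<close> makes q - y shorter than \<open>q\<close>. The absence of free subgroups enters
  only through the dichotomy for half spaces.

  The cocycle has a simple source. Once the copies commute, the second copy centralises the first
  one. So on the first copy a commutator of lifts acts as if it had its first factor only, and the
  lifts act there as they would in an extension by Z^d.\<close>

section \<open>Groups of permutations\<close>

text \<open>By Cayley's theorem every group embeds in one of these, so that groups can be treated as
  subsets of a type of class \<open>group_add\<close>, written additively although not commutative.\<close>

typedef 'a sym = "{f :: 'a \<Rightarrow> 'a. bij f}"
  morphisms apply_sym Sym
  by (rule exI[of _ id]) simp

lemma apply_Sym [simp]: "bij f \<Longrightarrow> apply_sym (Sym f) = f"
  by (simp add: Sym_inverse)

lemma bij_apply_sym [simp]: "bij (apply_sym s)"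
  using apply_sym[of s] by simp

lemma sym_eqI: "(\<And>x. apply_sym s x = apply_sym t x) \<Longrightarrow> s = t"
  by (simp add: apply_sym_inject[symmetric] fun_eq_iff)

instantiation sym :: (type) group_add
begin

definition zero_sym :: "'a sym" where "0 = Sym id"
definition plus_sym :: "'a sym \<Rightarrow> 'a sym \<Rightarrow> 'a sym" where
  "s + t = Sym (apply_sym s \<circ> apply_sym t)"
definition uminus_sym :: "'a sym \<Rightarrow> 'a sym" where
  "- s = Sym (inv_into UNIV (apply_sym s))"
definition minus_sym :: "'a sym \<Rightarrow> 'a sym \<Rightarrow> 'a sym" where
  "s - t = s + - (t :: 'a sym)"

instance
proof
  fix a b c :: "'a sym"
  show "a + b + c = a + (b + c)"
    by (simp add: plus_sym_def bij_comp o_assoc)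
  show "0 + a = a" "a + 0 = a"
    by (simp_all add: plus_sym_def zero_sym_def apply_sym_inverse)
  show "- a + a = 0"
    by (simp add: plus_sym_def zero_sym_def uminus_sym_def bij_imp_bij_inv bij_is_inj)
  show "a + - b = a - b" by (simp add: minus_sym_def)
qed

end

lemma apply_sym_0 [simp]: "apply_sym 0 x = x"
  by (simp add: zero_sym_def)

lemma apply_sym_plus [simp]: "apply_sym (s + t) x = apply_sym s (apply_sym t x)"
  by (simp add: plus_sym_def bij_comp)

lemma apply_sym_uminus_eq_iff: "apply_sym (- s) x = y \<longleftrightarrow> apply_sym s y = x"
  by (metis apply_sym_0 apply_sym_plus left_minus right_minus)

definition perm_on :: "'a set \<Rightarrow> ('a \<Rightarrow> 'a) \<Rightarrow> 'a sym" where
  "perm_on D f = Sym (\<lambda>x. if x \<in> D then f x else x)"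

lemma apply_perm_on:
  assumes "bij_betw f D D"
  shows "apply_sym (perm_on D f) x = (if x \<in> D then f x else x)"
proof -
  have "bij_betw (\<lambda>x. if x \<in> D then f x else x) (D \<union> - D) (D \<union> - D)"
  proof (rule bij_betw_combine)
    show "bij_betw (\<lambda>x. if x \<in> D then f x else x) D D"
      using assms by (simp cong: bij_betw_cong)
    show "bij_betw (\<lambda>x. if x \<in> D then f x else x) (- D) (- D)"
      by (rule bij_betw_byWitness[of _ "\<lambda>x. x"]) auto
  qed auto
  then show ?thesis by (simp add: perm_on_def)
qed

section \<open>Words and presentations\<close>

type_synonym 'x word = "('x \<times> bool) list"

definition lval :: "('x \<Rightarrow> 'g::group_add) \<Rightarrow> 'x \<times> bool \<Rightarrow> 'g" where
  "lval f l = (if snd l then f (fst l) else - f (fst l))"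

definition ev :: "('x \<Rightarrow> 'g::group_add) \<Rightarrow> 'x word \<Rightarrow> 'g" where
  "ev f w = sum_list (map (lval f) w)"

definition winv :: "'x word \<Rightarrow> 'x word" where
  "winv w = rev (map inv_letter w)"

lemma lval_inv_letter [simp]: "lval f (inv_letter l) = - lval f l"
  by (simp add: lval_def inv_letter_def)

lemma lval_Pair [simp]: "lval f (x, True) = f x" "lval f (x, False) = - f x"
  by (simp_all add: lval_def)

lemma ev_Nil [simp]: "ev f [] = 0"
  and ev_Cons [simp]: "ev f (l # w) = lval f l + ev f w"
  and ev_append [simp]: "ev f (v @ w) = ev f v + ev f w"
  by (simp_all add: ev_def)

lemma winv_simps [simp]:
  "winv [] = []" "winv (l # w) = winv w @ [inv_letter l]" "winv (v @ w) = winv w @ winv v"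
  "length (winv w) = length w" "winv (winv w) = w"
  by (simp_all add: winv_def rev_map comp_def)

lemma set_winv [simp]: "set (winv w) = inv_letter ` set w"
  by (simp add: winv_def)

lemma ev_winv [simp]: "ev f (winv w) = - ev f w"
  by (induction w) (simp_all add: minus_add)

lemma ev_cong: "(\<And>l. l \<in> set w \<Longrightarrow> f (fst l) = g (fst l)) \<Longrightarrow> ev f w = ev g w"
  by (induction w) (simp_all add: lval_def)

text \<open>Equality in the group with generators \<open>X\<close> and relators \<open>R\<close>; letters outside \<open>X\<close> are
  trivial, so that words need no side condition.\<close>

inductive eqv :: "'x set \<Rightarrow> 'x word set \<Rightarrow> 'x word \<Rightarrow> 'x word \<Rightarrow> bool" for X R where
  refl [simp, intro]: "eqv X R w w"
| sym: "eqv X R v w \<Longrightarrow> eqv X R w v"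
| trans [trans]: "eqv X R u v \<Longrightarrow> eqv X R v w \<Longrightarrow> eqv X R u w"
| cancel: "eqv X R (u @ l # inv_letter l # v) (u @ v)"
| relator: "r \<in> R \<Longrightarrow> eqv X R (u @ r @ v) (u @ v)"
| outside: "fst l \<notin> X \<Longrightarrow> eqv X R (u @ l # v) (u @ v)"

lemma eqv_context: "eqv X R w w' \<Longrightarrow> eqv X R (u @ w @ v) (u @ w' @ v)"
proof (induction arbitrary: u v rule: eqv.induct)
  case (trans a b c)
  then show ?case by (meson eqv.trans)
next
  case (cancel a l b)
  then show ?case using eqv.cancel[of X R "u @ a" l "b @ v"] by simp
next
  case (relator r a b)
  then show ?case using eqv.relator[of r R X "u @ a" "b @ v"] by simp
next
  case (outside l a b)
  then show ?case using eqv.outside[of l X R "u @ a" "b @ v"] by simp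
next
  case (sym v w)
  then show ?case by (meson eqv.sym)
qed simp

lemma eqv_append: "eqv X R v v' \<Longrightarrow> eqv X R w w' \<Longrightarrow> eqv X R (v @ w) (v' @ w')"
  using eqv.trans[of X R "v @ w" "v' @ w" "v' @ w'"]
    eqv_context[of X R v v' "[]" w] eqv_context[of X R w w' v' "[]"] by simp

lemma eqv_winv_right: "eqv X R (w @ winv w) []"
proof (induction w)
  case (Cons l w)
  then have "eqv X R ([l] @ (w @ winv w) @ [inv_letter l]) ([l] @ [] @ [inv_letter l])"
    by (rule eqv_context)
  also have "eqv X R ([l] @ [] @ [inv_letter l]) []"
    using eqv.cancel[of X R "[]" l "[]"] by simp
  finally show ?case by simp
qed simp

lemma eqv_winv_left: "eqv X R (winv w @ w) []"
  using eqv_winv_right[of X R "winv w"] by simp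

lemma eqv_iff_Nil: "eqv X R v w \<longleftrightarrow> eqv X R (v @ winv w) []"
proof
  assume "eqv X R v w"
  then have "eqv X R (v @ winv w) (w @ winv w)" by (rule eqv_append) simp
  then show "eqv X R (v @ winv w) []" by (rule eqv.trans) (rule eqv_winv_right)
next
  assume *: "eqv X R (v @ winv w) []"
  have "eqv X R v (v @ winv w @ w)"
    using eqv_append[OF eqv.refl eqv.sym[OF eqv_winv_left[of X R w]], of v] by simp
  also have "eqv X R (v @ winv w @ w) w"
    using eqv_append[OF * eqv.refl, of w] by simp
  finally show "eqv X R v w" .
qed

lemma eqv_winv: "eqv X R v w \<Longrightarrow> eqv X R (winv v) (winv w)"
proof -
  assume "eqv X R v w"
  then have "eqv X R (winv v @ w) (winv v @ v)"
    by (rule eqv_append[OF eqv.refl eqv.sym])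
  also have "eqv X R (winv v @ v) []" by (rule eqv_winv_left)
  finally show ?thesis by (subst eqv_iff_Nil) simp
qed

lemma eqv_sound:
  assumes "\<And>r. r \<in> R \<Longrightarrow> ev f r = 0" "\<And>x. x \<notin> X \<Longrightarrow> f x = 0"
  shows "eqv X R v w \<Longrightarrow> ev f v = ev f w"
proof (induction rule: eqv.induct)
  case (outside l u v)
  then show ?case by (simp add: assms lval_def)
qed (simp_all add: assms)

text \<open>The group \<open>\<langle>X | R\<rangle>\<close> is realised by permutations of representatives of its elements.\<close>

lemma universal_group:
  fixes X :: "'x set"
  obtains e :: "'x \<Rightarrow> 'x word sym" where "\<And>w. ev e w = 0 \<longleftrightarrow> eqv X R w []"
proof -
  \<comment> \<open>\<open>nf\<close> picks one word from each class. It is constant on classes, so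
    putting a letter in front and choosing again permutes the set \<open>D\<close> of chosen
    words.\<close>
  define nf where "nf w = (SOME v. eqv X R w v)" for w
  have nf: "eqv X R w (nf w)" for w
    unfolding nf_def by (rule someI) (rule eqv.refl)
  have nf_eq: "nf v = nf w" if "eqv X R v w" for v w
  proof -
    have "eqv X R v = eqv X R w" using that by (intro ext) (meson eqv.sym eqv.trans)
    then show ?thesis by (simp add: nf_def)
  qed
  have nf_nf: "nf (nf w) = nf w" for w using nf nf_eq by (metis eqv.sym)
  have nf_Cons: "nf (l # nf w) = nf (l # w)" for l w
    using nf_eq eqv_append[OF eqv.refl[of X R "[l]"] eqv.sym[OF nf]] by fastforce
  define D where "D = {w. nf w = w}"
  define m where "m l w = nf (l # w)" for l w
  have m_inv: "m (inv_letter l) (m l w) = w" if "w \<in> D" for l w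
  proof -
    have "m (inv_letter l) (m l w) = nf (inv_letter l # l # w)" by (simp add: m_def nf_Cons)
    also have "\<dots> = nf w" using eqv.cancel[of X R "[]" "inv_letter l" w] by (intro nf_eq) simp
    finally show ?thesis using that by (simp add: D_def)
  qed
  have m_bij: "bij_betw (m l) D D" for l
    using m_inv[of _ l] m_inv[of _ "inv_letter l"]
    by (intro bij_betw_byWitness[of _ "m (inv_letter l)"]) (auto simp: m_def D_def nf_nf)
  define e where "e x = perm_on D (m (x, True))" for x
  have e_True: "apply_sym (e x) w = m (x, True) w" if "w \<in> D" for x w
    using that by (simp add: e_def apply_perm_on m_bij)
  have lval_e: "apply_sym (lval e l) w = m l w" if "w \<in> D" for l w
  proof (cases "snd l")
    case True
    then show ?thesis using that e_True by (cases l) simp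
  next
    case False
    have "m l w \<in> D" by (simp add: m_def D_def nf_nf)
    then have "apply_sym (e (fst l)) (m l w) = w"
      using m_inv[OF that, of l] False by (simp add: e_True inv_letter_def)
    then show ?thesis using False by (simp add: lval_def apply_sym_uminus_eq_iff)
  qed
  have ev_D: "apply_sym (ev e w) v = nf (w @ v)" if "v \<in> D" for w v
  proof (induction w)
    case (Cons l w)
    then show ?case using lval_e[of "nf (w @ v)"] by (simp add: D_def nf_nf m_def nf_Cons)
  qed (use that in \<open>simp add: D_def\<close>)
  \<comment> \<open>Outside \<open>D\<close> the permutations are the identity, so that
    \<open>ev e w = 0\<close>, an equation on the whole type, can be checked on
    \<open>D\<close>.\<close>
  have lval_out: "apply_sym (lval e l) w = w" if "w \<notin> D" for l w
    using that by (auto simp: lval_def e_def apply_perm_on m_bij apply_sym_uminus_eq_iff)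
  have ev_out: "apply_sym (ev e w) v = v" if "v \<notin> D" for w v
    using that by (induction w) (simp_all add: lval_out)
  have "ev e w = 0 \<longleftrightarrow> eqv X R w []" for w
  proof
    assume "ev e w = 0"
    then have "nf (w @ nf []) = nf []"
      using ev_D[of "nf []" w] by (simp add: D_def nf_nf)
    then have "eqv X R (w @ nf []) (nf [])" by (metis nf nf_nf eqv.trans eqv.sym)
    moreover have "eqv X R w (w @ nf [])"
      using eqv_append[OF eqv.refl[of X R w] nf[of "[]"]] by simp
    ultimately show "eqv X R w []" by (meson nf eqv.trans eqv.sym)
  next
    assume *: "eqv X R w []"
    show "ev e w = 0"
    proof (rule sym_eqI)
      fix v show "apply_sym (ev e w) v = apply_sym 0 v"
      proof (cases "v \<in> D")
        case True
        have "nf (w @ v) = nf v" using eqv_append[OF * eqv.refl, of v] by (intro nf_eq) simp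
        then show ?thesis using True by (simp add: ev_D) (simp add: D_def)
      qed (simp add: ev_out)
    qed
  qed
  then show ?thesis by (rule that)
qed

section \<open>Presentations of subgroups and Tietze transformations\<close>

definition presents :: "'x set \<Rightarrow> 'x word set \<Rightarrow> ('x \<Rightarrow> 'g::group_add) \<Rightarrow> 'g set \<Rightarrow> bool" where
  "presents X R f S \<longleftrightarrow> finite X \<and> finite R \<and> S = range (ev f) \<and> (\<forall>w. ev f w = 0 \<longleftrightarrow> eqv X R w [])"

text \<open>That \<open>f\<close> vanishes outside \<open>X\<close> is not a clause of
  \<open>presents\<close>: a letter outside \<open>X\<close> is \<open>eqv\<close> to the empty
  word, which forces its value.\<close>

lemma presentsD:
  assumes "presents X R f S"
  shows "finite X" "finite R" "S = range (ev f)" "ev f w = 0 \<longleftrightarrow> eqv X R w []"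
    "r \<in> R \<Longrightarrow> ev f r = 0" "x \<notin> X \<Longrightarrow> f x = 0"
proof -
  show *: "finite X" "finite R" "S = range (ev f)" "ev f w = 0 \<longleftrightarrow> eqv X R w []" for w
    using assms by (auto simp: presents_def)
  show "r \<in> R \<Longrightarrow> ev f r = 0" using *(4)[of r] eqv.relator[of r R X "[]" "[]"] by simp
  show "x \<notin> X \<Longrightarrow> f x = 0"
    using *(4)[of "[(x, True)]"] eqv.outside[of "(x, True)" X R "[]" "[]"] by simp
qed

lemma presentsI:
  assumes "finite X" "finite R" "S = range (ev f)"
    and "\<And>r. r \<in> R \<Longrightarrow> ev f r = 0" "\<And>x. x \<notin> X \<Longrightarrow> f x = 0"
    and "\<And>w. ev f w = 0 \<Longrightarrow> eqv X R w []"
  shows "presents X R f S"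
proof -
  have "ev f w = 0" if "eqv X R w []" for w
    using eqv_sound[OF assms(4,5) that] by simp
  with assms show ?thesis unfolding presents_def by blast
qed

definition subgrp :: "'g::group_add set \<Rightarrow> bool" where
  "subgrp S \<longleftrightarrow> 0 \<in> S \<and> (\<forall>x\<in>S. \<forall>y\<in>S. x + y \<in> S) \<and> (\<forall>x\<in>S. - x \<in> S)"

lemma subgrpD:
  assumes "subgrp S"
  shows "0 \<in> S" "x \<in> S \<Longrightarrow> y \<in> S \<Longrightarrow> x + y \<in> S" "x \<in> S \<Longrightarrow> - x \<in> S"
    "x \<in> S \<Longrightarrow> y \<in> S \<Longrightarrow> x - y \<in> S"
    "x \<in> S \<Longrightarrow> x + y \<in> S \<longleftrightarrow> y \<in> S" "y \<in> S \<Longrightarrow> x + y \<in> S \<longleftrightarrow> x \<in> S" "- x \<in> S \<longleftrightarrow> x \<in> S"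
proof -
  show *: "0 \<in> S" "x \<in> S \<Longrightarrow> y \<in> S \<Longrightarrow> x + y \<in> S" "x \<in> S \<Longrightarrow> - x \<in> S" for x y
    using assms by (auto simp: subgrp_def)
  show "x \<in> S \<Longrightarrow> y \<in> S \<Longrightarrow> x - y \<in> S"
    using * by (simp only: diff_conv_add_uminus)
  show "x \<in> S \<Longrightarrow> x + y \<in> S \<longleftrightarrow> y \<in> S"
    using *(2)[of x y] *(2)[of "- x" "x + y"] *(3)[of x] by (auto simp flip: add.assoc)
  show "y \<in> S \<Longrightarrow> x + y \<in> S \<longleftrightarrow> x \<in> S"
    using *(2)[of x y] *(2)[of "x + y" "- y"] *(3)[of y] by (auto simp: add.assoc)
  show "- x \<in> S \<longleftrightarrow> x \<in> S" using *(3)[of x] *(3)[of "- x"] by auto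
qed

lemma subgrp_range_ev: "subgrp (range (ev f))"
  unfolding subgrp_def using rangeI[of "ev f" "[]"] rangeI[of "ev f" "winv _"] rangeI[of "ev f" "_ @ _"]
  by auto

lemma ev_in_subgrp:
  assumes "subgrp S" "\<And>l. l \<in> set w \<Longrightarrow> f (fst l) \<in> S"
  shows "ev f w \<in> S"
  using assms(2) by (induction w) (auto simp: lval_def subgrpD[OF assms(1)])

lemma lval_in_range: "lval f l \<in> range (ev f)"
  using rangeI[of "ev f" "[l]"] by simp

primrec subst_word :: "('x \<Rightarrow> 'y word) \<Rightarrow> 'x word \<Rightarrow> 'y word" where
  "subst_word \<phi> [] = []"
| "subst_word \<phi> (l # w) = (if snd l then \<phi> (fst l) else winv (\<phi> (fst l))) @ subst_word \<phi> w"

lemma subst_word_append [simp]: "subst_word \<phi> (v @ w) = subst_word \<phi> v @ subst_word \<phi> w"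
  by (induction v) auto

lemma ev_subst_word: "ev g (subst_word \<phi> w) = ev (\<lambda>x. ev g (\<phi> x)) w"
  by (induction w) (auto simp: lval_def)

lemma eqv_subst_word:
  assumes "\<And>r. r \<in> R \<Longrightarrow> eqv Y R' (subst_word \<phi> r) []"
    and "\<And>x. x \<notin> X \<Longrightarrow> eqv Y R' (\<phi> x) []"
  shows "eqv X R v w \<Longrightarrow> eqv Y R' (subst_word \<phi> v) (subst_word \<phi> w)"
proof (induction rule: eqv.induct)
  case (sym v w)
  show ?case by (rule eqv.sym) (rule sym.IH)
next
  case (trans u v w)
  show ?case by (rule eqv.trans) (rule trans.IH)+
next
  case (cancel u l v)
  show ?case
    using eqv_context[OF eqv_winv_right[of Y R' "subst_word \<phi> [l]"], of "subst_word \<phi> u" "subst_word \<phi> v"]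
    by (auto simp: inv_letter_def)
next
  case (relator r u v)
  show ?case
    using eqv_context[OF assms(1)[OF relator], of "subst_word \<phi> u" "subst_word \<phi> v"] by simp
next
  case (outside l u v)
  show ?case
    using eqv_context[OF assms(2)[OF outside], of "subst_word \<phi> u" "subst_word \<phi> v"]
      eqv_context[OF eqv_winv[OF assms(2)[OF outside]], of "subst_word \<phi> u" "subst_word \<phi> v"]
    by simp
qed simp

text \<open>Tietze transformations. Each generating family is written in the other by
  \<open>\<phi>\<close> and \<open>\<psi>\<close>; the new relators are the old ones rewritten and,
  for each new generator, the statement that rewriting it back and forth returns it.\<close>

lemma presents_change_generators:
  fixes g :: "'y \<Rightarrow> 'g::group_add"
  assumes P: "presents X R f S" and Y: "finite Y" "\<And>y. y \<notin> Y \<Longrightarrow> g y = 0"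
    and S: "S = range (ev g)"
  shows "\<exists>R'. presents Y R' g S"
proof -
  note [simp] = presentsD(5,6)[OF P]
  have "\<exists>u. ev g u = f x \<and> (x \<notin> X \<longrightarrow> u = [])" for x
  proof (cases "x \<in> X")
    case True
    have "f x \<in> S" using lval_in_range[of f "(x, True)"] presentsD(3)[OF P] by simp
    then show ?thesis using S True by auto
  qed (auto intro: exI[of _ "[]"])
  then obtain \<phi> where \<phi>: "ev g (\<phi> x) = f x" "x \<notin> X \<Longrightarrow> \<phi> x = []" for x by metis
  have "\<exists>u. ev f u = g y \<and> (y \<notin> Y \<longrightarrow> u = [])" for y
  proof (cases "y \<in> Y")
    case True
    have "g y \<in> S" using lval_in_range[of g "(y, True)"] S by simp
    then show ?thesis using presentsD(3)[OF P] True by auto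
  qed (auto intro: exI[of _ "[]"] simp: Y)
  then obtain \<psi> where \<psi>: "ev f (\<psi> y) = g y" "y \<notin> Y \<Longrightarrow> \<psi> y = []" for y by metis
  define R' where "R' = subst_word \<phi> ` R \<union> (\<lambda>y. (y, False) # subst_word \<phi> (\<psi> y)) ` Y"
  have R'1: "eqv Y R' (subst_word \<phi> r) []" if "r \<in> R" for r
    using eqv.relator[of "subst_word \<phi> r" R' Y "[]" "[]"] that by (simp add: R'_def)
  have \<psi>\<phi>: "eqv Y R' (subst_word \<phi> (\<psi> y)) [(y, True)]" for y
  proof (cases "y \<in> Y")
    case True
    have "eqv Y R' ([] @ (y, True) # inv_letter (y, True) # subst_word \<phi> (\<psi> y)) ([] @ subst_word \<phi> (\<psi> y))"
      by (rule eqv.cancel)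
    moreover have "eqv Y R' ([(y, True)] @ ((y, False) # subst_word \<phi> (\<psi> y)) @ []) ([(y, True)] @ [])"
      using True by (intro eqv.relator) (simp add: R'_def)
    ultimately show ?thesis
      by (simp add: inv_letter_def) (metis eqv.sym eqv.trans)
  next
    case False
    then show ?thesis
      using eqv.sym[OF eqv.outside[of "(y, True)" Y R' "[]" "[]"]] by (simp add: \<psi>)
  qed
  have *: "eqv Y R' (subst_word \<phi> (subst_word \<psi> w)) w" for w
  proof (induction w)
    case (Cons l w)
    have "eqv Y R' (subst_word \<phi> (subst_word \<psi> [l])) [l]"
    proof (cases l)
      case (Pair y b)
      have inv: "subst_word \<phi> (winv u) = winv (subst_word \<phi> u)" for u
        by (induction u) (auto simp: inv_letter_def)
      show ?thesis
        using \<psi>\<phi>[of y] eqv_winv[OF \<psi>\<phi>[of y]] Pair by (simp add: inv inv_letter_def)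
    qed
    from eqv_append[OF this Cons] show ?case by simp
  qed simp
  have "presents Y R' g S"
  proof (rule presentsI)
    show "finite R'" using presentsD(2)[OF P] Y(1) by (simp add: R'_def)
    show "ev g r = 0" if "r \<in> R'" for r
      using that by (auto simp: R'_def ev_subst_word \<phi> \<psi>)
    show "eqv Y R' w []" if "ev g w = 0" for w
    proof -
      have "ev f (subst_word \<psi> w) = 0" using that by (simp add: ev_subst_word \<psi>)
      then have "eqv X R (subst_word \<psi> w) []" using presentsD(4)[OF P] by blast
      then have "eqv Y R' (subst_word \<phi> (subst_word \<psi> w)) (subst_word \<phi> [])"
        by (rule eqv_subst_word[rotated 2]) (simp_all add: R'1 \<phi>)
      then show ?thesis using * by (metis eqv.sym eqv.trans subst_word.simps(1))
    qed
  qed (use Y S in auto)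
  then show ?thesis by blast
qed

definition fin_pres :: "'g::group_add set \<Rightarrow> bool" where
  "fin_pres S \<longleftrightarrow> (\<exists>(X :: nat set) R f. presents X R f S)"

text \<open>Later alphabets are sums and products of types; here they are renamed to an initial
  segment of the naturals, as \<open>fin_pres\<close> asks.\<close>

lemma fin_presI:
  fixes X :: "'x set"
  assumes P: "presents X R f S"
  shows "fin_pres S"
proof -
  obtain h where h: "bij_betw h {..<card X} X"
    using ex_bij_betw_nat_finite[OF presentsD(1)[OF P]] by (auto simp: atLeast0LessThan)
  define g where "g i = (if i < card X then f (h i) else 0)" for i
  have "ev f w \<in> range (ev g)" for w
  proof (rule ev_in_subgrp[OF subgrp_range_ev])
    fix l :: "'x \<times> bool" show "f (fst l) \<in> range (ev g)"
    proof (cases "fst l \<in> X")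
      case True
      then have "fst l \<in> h ` {..<card X}" using h by (simp add: bij_betw_def)
      then obtain i where "i < card X" "h i = fst l" by auto
      then show ?thesis using lval_in_range[of g "(i, True)"] by (simp add: g_def)
    next
      case False
      then show ?thesis using presentsD(6)[OF P] subgrpD(1)[OF subgrp_range_ev] by metis
    qed
  qed
  moreover have "ev g w \<in> range (ev f)" for w
    using lval_in_range[of f "(_, True)"] subgrpD(1)[OF subgrp_range_ev[of f]]
    by (intro ev_in_subgrp[OF subgrp_range_ev]) (auto simp: g_def)
  ultimately have "S = range (ev g)" using presentsD(3)[OF P] by auto
  then show ?thesis
    using presents_change_generators[OF P, of "{..<card X}" g] unfolding fin_pres_def
    by (auto simp: g_def)
qed

section \<open>Commensurable groups\<close>

text \<open>Reidemeister-Schreier. \<open>\<kappa>\<close> is an arbitrary labelling of the right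
  cosets of \<open>H\<close>.\<close>

lemma fin_pres_finite_index_subgroup:
  fixes S :: "'g::group_add set"
  assumes S: "fin_pres S" and H: "subgrp H" "H \<subseteq> S"
    and I: "finite (\<kappa> ` S)" "\<And>x y. x \<in> S \<Longrightarrow> y \<in> S \<Longrightarrow> \<kappa> x = \<kappa> y \<longleftrightarrow> x - y \<in> H"
  shows "fin_pres H"
proof -
  obtain X :: "nat set" and R f where P: "presents X R f S" using S by (auto simp: fin_pres_def)
  have SR: "S = range (ev f)" by (rule presentsD(3)[OF P])
  have subS: "subgrp S" using subgrp_range_ev SR by simp
  note sD = subgrpD[OF subS] and hD = subgrpD[OF H(1)]
  \<comment> \<open>A transversal in which the coset \<open>H\<close> is represented by 0; this
    makes \<open>tr b\<close> the identity on \<open>H\<close>.\<close>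
  have "\<exists>\<tau>. \<forall>i\<in>\<kappa> ` S. \<tau> i \<in> S \<and> \<kappa> (\<tau> i) = i \<and> (i = \<kappa> 0 \<longrightarrow> \<tau> i = 0)"
    using sD(1) by (intro bchoice) (metis imageE)
  then obtain \<tau> where \<tau>: "\<tau> i \<in> S" "\<kappa> (\<tau> i) = i" "\<tau> (\<kappa> 0) = 0" if "i \<in> \<kappa> ` S" for i
    using sD(1) by blast
  \<comment> \<open>\<open>S\<close> acts on the labels from the right, and \<open>tr i g\<close> is
    the element of \<open>H\<close> by which the step from \<open>i\<close> along \<open>g\<close>
    misses the chosen representative. It is a cocycle (\<open>tr_add\<close>), so it can be
    evaluated letter by letter.\<close>
  define act where "act i g = \<kappa> (\<tau> i + g)" for i g
  define tr where "tr i g = \<tau> i + g - \<tau> (act i g)" for i g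
  have act_in: "act i g \<in> \<kappa> ` S" if "i \<in> \<kappa> ` S" "g \<in> S" for i g
    using that \<tau> sD by (auto simp: act_def)
  have tr_H: "tr i g \<in> H" if "i \<in> \<kappa> ` S" "g \<in> S" for i g
    using I(2)[of "\<tau> i + g" "\<tau> (act i g)"] that \<tau> act_in[OF that] sD by (simp add: tr_def act_def)
  have act_act: "act (act i g) h = act i (g + h)" if "i \<in> \<kappa> ` S" "g \<in> S" "h \<in> S" for i g h
  proof -
    have "\<tau> (act i g) + h - (\<tau> i + (g + h)) = - tr i g"
      by (simp add: tr_def algebra_simps diff_conv_add_uminus minus_add del: add_uminus_conv_diff)
    then have "\<tau> (act i g) + h - (\<tau> i + (g + h)) \<in> H" using tr_H that hD(3) by simp
    then show ?thesis
      using that \<tau> act_in sD I(2) unfolding act_def[of _ h] act_def[of _ "g + h"] by simp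
  qed
  have act_0: "act i 0 = i" if "i \<in> \<kappa> ` S" for i using that \<tau> by (simp add: act_def)
  have tr_add: "tr i (g + h) = tr i g + tr (act i g) h" if "i \<in> \<kappa> ` S" "g \<in> S" "h \<in> S" for i g h
    using act_act[OF that]
    by (simp add: tr_def algebra_simps diff_conv_add_uminus minus_add del: add_uminus_conv_diff)
  have fS: "f x \<in> S" "lval f l \<in> S" "ev f w \<in> S" for x l w
    using SR lval_in_range[of f] lval_in_range[of f "(x, True)"] by auto
  \<comment> \<open>Generators of \<open>H\<close>: the edges of the Schreier graph.  A word is rewritten along its path.\<close>
  define edge where "edge i l = (if snd l then ((i, fst l), True) else ((act i (lval f l), fst l), False))"
    for i l
  define rw where "rw = rec_list (\<lambda>i. []) (\<lambda>l w r i. edge i l # r (act i (lval f l)))"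
  have rw_simps [simp]: "rw [] i = []" "rw (l # w) i = edge i l # rw w (act i (lval f l))" for i l w
    by (simp_all add: rw_def)
  have rw_append: "i \<in> \<kappa> ` S \<Longrightarrow> rw (v @ w) i = rw v i @ rw w (act i (ev f v))" for v w i
    by (induction v arbitrary: i) (simp_all add: act_0 act_in fS act_act)
  define Y where "Y = \<kappa> ` S \<times> X"
  define g where "g y = (if y \<in> Y then tr (fst y) (f (snd y)) else 0)" for y
  have tr_neg: "tr i (- h) = - tr (act i (- h)) h" if "i \<in> \<kappa> ` S" "h \<in> S" for i h
    using tr_add[of i "- h" h] that sD(3)[of h] act_0[OF that(1)] \<tau>
    by (simp add: eq_neg_iff_add_eq_0) (simp add: tr_def)
  have tr_0: "tr i 0 = 0" if "i \<in> \<kappa> ` S" for i using act_0[OF that] by (simp add: tr_def)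
  have g_eq: "g (i, x) = tr i (f x)" if "i \<in> \<kappa> ` S" for i x
    using that presentsD(6)[OF P, of x] by (auto simp: g_def Y_def tr_0)
  have lval_edge: "lval g (edge i l) = tr i (lval f l)" if "i \<in> \<kappa> ` S" for i l
    using that fS act_in[OF that, of "- f (fst l)"] sD(3)[OF fS(1)]
    by (auto simp: edge_def lval_def g_eq tr_neg)
  have ev_rw: "ev g (rw w i) = tr i (ev f w)" if "i \<in> \<kappa> ` S" for w i
    using that by (induction w arbitrary: i) (simp_all add: tr_0 lval_edge act_in fS tr_add)
  have "\<exists>u. ev f u = \<tau> i \<and> (i = \<kappa> 0 \<longrightarrow> u = [])" if "i \<in> \<kappa> ` S" for i
  proof (cases "i = \<kappa> 0")
    case True
    then show ?thesis using that by (intro exI[of _ "[]"]) (simp add: \<tau>)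
  next
    case False
    then show ?thesis using that \<tau>(1)[OF that] SR by auto
  qed
  then obtain \<omega> where \<omega>: "ev f (\<omega> i) = \<tau> i" "i = \<kappa> 0 \<Longrightarrow> \<omega> i = []" if "i \<in> \<kappa> ` S" for i by metis
  define b where "b = \<kappa> 0"
  have b: "b \<in> \<kappa> ` S" "\<tau> b = 0" using sD(1) \<tau>(3) by (auto simp: b_def)
  define dw where "dw y = (if y \<in> Y
    then \<omega> (fst y) @ [(snd y, True)] @ winv (\<omega> (act (fst y) (f (snd y)))) else [])" for y
  \<comment> \<open>Two kinds of relators: each old relator read from each coset, and for each
    Schreier generator \<open>y\<close> its equality with the rewriting of the word
    \<open>dw y\<close> that spells it in \<open>S\<close>.\<close>
  define R' where "R' = (\<lambda>(i, r). rw r i) ` (\<kappa> ` S \<times> R) \<union> (\<lambda>y. (y, False) # rw (dw y) b) ` Y"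
  have ev_dw: "ev f (dw y) = g y" for y
    using \<omega> act_in fS by (auto simp: dw_def Y_def tr_def g_def algebra_simps)
  have act_b: "act b h = b" if "h \<in> H" for h
    using I(2)[of h 0] that H b sD(1) by (auto simp: act_def b_def)
  have tr_b: "tr b h = h" if "h \<in> H" for h
    using act_b[OF that] b by (simp add: tr_def)
  have g_H: "g y \<in> H" for y
    using hD(1) tr_H fS by (auto simp: g_def Y_def)
  have act_inv: "act (act i h) (- h) = i" if "i \<in> \<kappa> ` S" "h \<in> S" for i h
    using that by (simp add: act_act sD act_0)
  have edge_inv: "edge (act i (lval f l)) (inv_letter l) = inv_letter (edge i l)" if "i \<in> \<kappa> ` S" for i l
    using act_inv[OF that fS(1)]
    by (cases l) (auto simp: edge_def inv_letter_def)
  have rw_winv: "i \<in> \<kappa> ` S \<Longrightarrow> rw (winv u) (act i (ev f u)) = winv (rw u i)" for i u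
  proof (induction u arbitrary: i)
    case (Cons l u)
    have "rw (winv u) (act i (ev f (l # u))) = winv (rw u (act i (lval f l)))"
      using Cons by (simp add: act_act[symmetric] fS act_in)
    moreover have "act (act i (ev f (l # u))) (ev f (winv u)) = act i (lval f l)"
      using Cons.prems by (simp add: act_act fS sD add.assoc)
    ultimately show ?case
      using Cons.prems edge_inv[OF Cons.prems, of l] act_in[OF Cons.prems fS(3), of "l # u"]
      by (simp add: rw_append)
  qed simp
  have rw_eqv: "i \<in> \<kappa> ` S \<longrightarrow> eqv Y R' (rw v i) (rw w i)" if "eqv X R v w" for v w i
    using that
  proof (induction arbitrary: i rule: eqv.induct)
    case (sym v w)
    then show ?case by (meson eqv.sym)
  next
    case (trans u v w)
    then show ?case by (meson eqv.trans)
  next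
    case (cancel u l v)
    show ?case
    proof
      assume i: "i \<in> \<kappa> ` S"
      define j where "j = act i (ev f u)"
      have j: "j \<in> \<kappa> ` S" using i by (simp add: j_def act_in fS)
      show "eqv Y R' (rw (u @ l # inv_letter l # v) i) (rw (u @ v) i)"
        using i act_inv[OF j fS(2)] edge_inv[OF j] eqv.cancel[of Y R' "rw u i" "edge j l" "rw v j"]
        by (simp add: rw_append flip: j_def)
    qed
  next
    case (relator r u v)
    show ?case
    proof
      assume i: "i \<in> \<kappa> ` S"
      define j where "j = act i (ev f u)"
      have j: "j \<in> \<kappa> ` S" using i by (simp add: j_def act_in fS)
      have "rw r j \<in> R'" using relator j by (auto simp: R'_def)
      then show "eqv Y R' (rw (u @ r @ v) i) (rw (u @ v) i)"
        using i j presentsD(5)[OF P relator] eqv.relator[of "rw r j" R' Y "rw u i" "rw v j"]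
        by (simp add: rw_append act_0 flip: j_def)
    qed
  next
    case (outside l u v)
    show ?case
    proof
      assume i: "i \<in> \<kappa> ` S"
      define j where "j = act i (ev f u)"
      have j: "j \<in> \<kappa> ` S" using i by (simp add: j_def act_in fS)
      have "lval f l = 0" using presentsD(6)[OF P outside] by (simp add: lval_def)
      moreover have "fst (edge j l) \<notin> Y" using outside by (auto simp: edge_def Y_def)
      ultimately show "eqv Y R' (rw (u @ l # v) i) (rw (u @ v) i)"
        using i j eqv.outside[of "edge j l" Y R' "rw u i" "rw v j"]
        by (simp add: rw_append act_0 flip: j_def)
    qed
  qed simp
  have back1: "eqv Y R' (rw (dw y) b) [(y, True)]" for y
  proof (cases "y \<in> Y")
    case True
    have "eqv Y R' ([] @ (y, True) # inv_letter (y, True) # rw (dw y) b) ([] @ rw (dw y) b)"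
      by (rule eqv.cancel)
    moreover have "eqv Y R' ([(y, True)] @ ((y, False) # rw (dw y) b) @ []) ([(y, True)] @ [])"
      using True by (intro eqv.relator) (simp add: R'_def)
    ultimately show ?thesis
      by (simp add: inv_letter_def) (metis eqv.sym eqv.trans)
  next
    case False
    then show ?thesis
      using eqv.sym[OF eqv.outside[of "(y, True)" Y R' "[]" "[]"]] by (simp add: dw_def)
  qed
  have backw: "eqv Y R' (rw (subst_word dw w) b) w" for w
  proof (induction w)
    case (Cons l w)
    obtain y c where l: "l = (y, c)" by (cases l)
    define u where "u = (if c then dw y else winv (dw y))"
    have b_fix: "act b (g y) = b" "act b (- g y) = b" using act_b g_H hD(3) by auto
    then have "rw (winv (dw y)) b = winv (rw (dw y) b)"
      using rw_winv[OF b(1), of "dw y"] by (simp add: ev_dw)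
    then have "eqv Y R' (rw u b) [l]"
      using back1[of y] eqv_winv[OF back1[of y]] by (simp add: u_def l inv_letter_def)
    moreover have "rw (subst_word dw (l # w)) b = rw u b @ rw (subst_word dw w) b"
      using b b_fix by (simp add: l u_def rw_append ev_dw)
    ultimately show ?case using eqv_append[OF _ Cons, of "rw u b" "[l]"] by simp
  qed simp
  have "presents Y R' g H"
  proof (rule presentsI)
    show "finite Y" "finite R'" using I(1) presentsD(1,2)[OF P] by (simp_all add: Y_def R'_def)
    show "H = range (ev g)"
    proof
      show "H \<subseteq> range (ev g)"
      proof
        fix h assume h: "h \<in> H"
        then obtain w where "h = ev f w" using H(2) SR by blast
        then have "h = ev g (rw w b)" using ev_rw[OF b(1)] tr_b[OF h] by simp
        then show "h \<in> range (ev g)" by simp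
      qed
      show "range (ev g) \<subseteq> H" using ev_in_subgrp[OF H(1)] g_H by blast
    qed
    show "ev g r = 0" if "r \<in> R'" for r
    proof -
      have "ev g (rw r' i) = 0" if "i \<in> \<kappa> ` S" "r' \<in> R" for i r'
        using that presentsD(5)[OF P] by (simp add: ev_rw tr_0)
      moreover have "ev g ((y, False) # rw (dw y) b) = 0" for y
        using b by (simp add: ev_rw ev_dw tr_b g_H)
      ultimately show ?thesis using that by (auto simp: R'_def)
    qed
    show "g y = 0" if "y \<notin> Y" for y using that by (simp add: g_def)
    show "eqv Y R' w []" if "ev g w = 0" for w
    proof -
      have "ev f (subst_word dw w) = 0" using that by (simp add: ev_subst_word ev_dw)
      then have "eqv X R (subst_word dw w) []" using presentsD(4)[OF P] by blast
      from rw_eqv[OF this, of b] b have "eqv Y R' (rw (subst_word dw w) b) []" by simp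
      then show ?thesis using backw by (meson eqv.sym eqv.trans)
    qed
  qed
  then show ?thesis by (rule fin_presI)
qed

text \<open>Coset representatives join the generators of \<open>H\<close>. The new relators let a
  representative pass a letter at the price of a word over \<open>H\<close>, so every word becomes a
  word over \<open>H\<close> followed by one representative. If the value is 0, that representative
  is the trivial one and the relators of \<open>H\<close> finish.\<close>

lemma fin_pres_finite_index_overgroup:
  fixes S :: "'g::group_add set" and \<kappa> :: "'g \<Rightarrow> 'i"
  assumes H: "fin_pres H" and S: "subgrp S" "H \<subseteq> S"
    and I: "finite (\<kappa> ` S)" "\<And>x y. x \<in> S \<Longrightarrow> y \<in> S \<Longrightarrow> \<kappa> x = \<kappa> y \<longleftrightarrow> x - y \<in> H"
  shows "fin_pres S"
proof -
  obtain X :: "nat set" and R f where P: "presents X R f H" using H by (auto simp: fin_pres_def)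
  have HR: "H = range (ev f)" by (rule presentsD(3)[OF P])
  have subH: "subgrp H" using subgrp_range_ev HR by simp
  note sD = subgrpD[OF S(1)] and hD = subgrpD[OF subH]
  have "\<exists>\<tau>. \<forall>i\<in>\<kappa> ` S. \<tau> i \<in> S \<and> \<kappa> (\<tau> i) = i \<and> (i = \<kappa> 0 \<longrightarrow> \<tau> i = 0)"
    using sD(1) by (intro bchoice) (metis imageE)
  then obtain \<tau> where \<tau>: "\<tau> i \<in> S" "\<kappa> (\<tau> i) = i" "\<tau> (\<kappa> 0) = 0" if "i \<in> \<kappa> ` S" for i
    using sD(1) by blast
  define Y where "Y = Inl ` X \<union> Inr ` \<kappa> ` S"
  define g where "g y = (case y of Inl x \<Rightarrow> f x | Inr i \<Rightarrow> if i \<in> \<kappa> ` S then \<tau> i else 0)" for y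
  define emb where "emb = map (\<lambda>(x, c). (Inl x :: nat + 'i, c :: bool))"
  have emb_append: "emb (u @ v) = emb u @ emb v" for u v by (simp add: emb_def)
  have emb_Cons: "emb ((x, c) # u) = (Inl x, c) # emb u" for x c u by (simp add: emb_def)
  have ev_emb: "ev g (emb u) = ev f u" for u
    by (induction u) (auto simp: emb_def g_def lval_def)
  have f_S: "f x \<in> S" for x using lval_in_range[of f "(x, True)"] HR S(2) by auto
  have g_S: "g y \<in> S" for y using f_S \<tau>(1) sD(1) by (auto simp: g_def split: sum.splits)
  have lval_S: "lval g l \<in> S" for l using g_S sD(3) by (auto simp: lval_def)
  define act where "act i l = \<kappa> (\<tau> i + lval g l)" for i l
  have act_in: "act i l \<in> \<kappa> ` S" if "i \<in> \<kappa> ` S" for i l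
    using that \<tau> sD lval_S by (auto simp: act_def)
  have "\<exists>u. ev f u = \<tau> i + lval g l - \<tau> (act i l)" if "i \<in> \<kappa> ` S" for i l
  proof -
    have "\<tau> i + lval g l - \<tau> (act i l) \<in> H"
      using I(2)[of "\<tau> i + lval g l" "\<tau> (act i l)"] that \<tau> act_in[OF that, of l] sD lval_S
      by (simp add: act_def)
    then show ?thesis using HR by auto
  qed
  then obtain tr where tr: "ev f (tr i l) = \<tau> i + lval g l - \<tau> (act i l)" if "i \<in> \<kappa> ` S" for i l
    by metis
  define rel where "rel i l = [(Inr i, True), l] @ winv (emb (tr i l) @ [(Inr (act i l), True)])" for i l
  \<comment> \<open>The last relator kills the representative of the trivial coset, which is put in
    front of an arbitrary word before \<open>push\<close> applies.\<close>
  define R' where "R' = emb ` R \<union> (\<lambda>(i, l). rel i l) ` (\<kappa> ` S \<times> (Y \<times> UNIV)) \<union> {[(Inr (\<kappa> 0), True)]}"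
  have step: "eqv Y R' [(Inr i, True), l] (emb (tr i l) @ [(Inr (act i l), True)])"
    if "i \<in> \<kappa> ` S" "fst l \<in> Y" for i l
  proof -
    have "rel i l \<in> R'" using that by (cases l) (auto simp: R'_def)
    from eqv.relator[OF this, of Y "[]" "[]"] show ?thesis by (subst eqv_iff_Nil) (simp add: rel_def)
  qed
  have emb_eqv: "eqv X R u v \<Longrightarrow> eqv Y R' (emb u) (emb v)" for u v
  proof (induction rule: eqv.induct)
    case (sym v w)
    show ?case by (rule eqv.sym) (rule sym.IH)
  next
    case (trans u v w)
    show ?case by (rule eqv.trans) (rule trans.IH)+
  next
    case (cancel u l v)
    show ?case using eqv.cancel[of Y R' "emb u" "(Inl (fst l), snd l)" "emb v"]
      by (cases l) (simp add: emb_append emb_Cons inv_letter_def)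
  next
    case (relator r u v)
    then have "emb r \<in> R'" by (simp add: R'_def)
    from eqv.relator[OF this, of Y "emb u" "emb v"] show ?case by (simp add: emb_append)
  next
    case (outside l u v)
    then show ?case using eqv.outside[of "(Inl (fst l), snd l)" Y R' "emb u" "emb v"]
      by (cases l) (auto simp: emb_append emb_Cons Y_def)
  qed simp
  have push: "\<exists>u j. j \<in> \<kappa> ` S \<and> eqv Y R' ((Inr i, True) # w) (emb u @ [(Inr j, True)])" if "i \<in> \<kappa> ` S" for i w
    using that
  proof (induction w arbitrary: i)
    case Nil
    then show ?case by (intro exI[of _ "[]"] exI[of _ i]) (simp add: emb_def)
  next
    case (Cons l w)
    show ?case
    proof (cases "fst l \<in> Y")
      case True
      obtain u j where uj: "j \<in> \<kappa> ` S" "eqv Y R' ((Inr (act i l), True) # w) (emb u @ [(Inr j, True)])"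
        using Cons.IH[OF act_in[OF Cons.prems]] by blast
      have "eqv Y R' ([(Inr i, True), l] @ w) ((emb (tr i l) @ [(Inr (act i l), True)]) @ w)"
        by (rule eqv_append[OF step[OF Cons.prems True] eqv.refl])
      also have "eqv Y R' ((emb (tr i l) @ [(Inr (act i l), True)]) @ w) (emb (tr i l) @ emb u @ [(Inr j, True)])"
        using eqv_append[OF eqv.refl uj(2)] by simp
      finally show ?thesis using uj(1) by (intro exI[of _ "tr i l @ u"] exI[of _ j]) (simp add: emb_append)
    next
      case False
      obtain u j where uj: "j \<in> \<kappa> ` S" "eqv Y R' ((Inr i, True) # w) (emb u @ [(Inr j, True)])"
        using Cons.IH[OF Cons.prems] by blast
      have "eqv Y R' ((Inr i, True) # l # w) ((Inr i, True) # w)"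
        using eqv.outside[OF False, of R' "[(Inr i, True)]" w] by simp
      from eqv.trans[OF this uj(2)] uj(1) show ?thesis by blast
    qed
  qed
  have base: "eqv Y R' [(Inr (\<kappa> 0), True)] []"
    using eqv.relator[of "[(Inr (\<kappa> 0), True)]" R' Y "[]" "[]"] by (simp add: R'_def)
  have g_out: "g y = 0" if "y \<notin> Y" for y
    using that presentsD(6)[OF P] by (auto simp: g_def Y_def split: sum.splits)
  have R'_0: "ev g r = 0" if "r \<in> R'" for r
  proof -
    have "ev g (rel i l) = 0" if "i \<in> \<kappa> ` S" for i l
      using that act_in[OF that, of l]
      by (simp add: rel_def ev_emb tr g_def algebra_simps minus_add diff_conv_add_uminus del: add_uminus_conv_diff)
    moreover have "g (Inr (\<kappa> 0)) = 0" using sD(1) \<tau>(3) by (auto simp: g_def)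
    ultimately show ?thesis using that presentsD(5)[OF P] by (auto simp: R'_def ev_emb)
  qed
  have "presents Y R' g S"
  proof (rule presentsI)
    show "finite Y" "finite R'" using I(1) presentsD(1,2)[OF P] by (simp_all add: Y_def R'_def)
    show "ev g r = 0" if "r \<in> R'" for r using that by (rule R'_0)
    show "g y = 0" if "y \<notin> Y" for y using that by (rule g_out)
    show "S = range (ev g)"
    proof
      show "range (ev g) \<subseteq> S" using ev_in_subgrp[OF S(1)] g_S by blast
      show "S \<subseteq> range (ev g)"
      proof
        fix s assume s: "s \<in> S"
        then have "s - \<tau> (\<kappa> s) \<in> H" using I(2)[of s "\<tau> (\<kappa> s)"] \<tau> by auto
        then obtain u where "ev f u = s - \<tau> (\<kappa> s)" using HR by auto
        then have "ev g (emb u @ [(Inr (\<kappa> s), True)]) = s"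
          using s by (simp add: ev_emb g_def)
        then show "s \<in> range (ev g)" by (metis rangeI)
      qed
    qed
    show "eqv Y R' w []" if "ev g w = 0" for w
    proof -
      have "\<kappa> 0 \<in> \<kappa> ` S" using sD(1) by simp
      from push[OF this, of w] obtain u j where
        uj: "j \<in> \<kappa> ` S" "eqv Y R' ((Inr (\<kappa> 0), True) # w) (emb u @ [(Inr j, True)])" by blast
      have "eqv Y R' w ((Inr (\<kappa> 0), True) # w)"
        using eqv.sym[OF eqv_append[OF base eqv.refl, of w]] by simp
      then have *: "eqv Y R' w (emb u @ [(Inr j, True)])" using uj(2) by (rule eqv.trans)
      have "ev g w = ev g (emb u @ [(Inr j, True)])" by (rule eqv_sound[OF R'_0 g_out *])
      then have 0: "ev f u + \<tau> j = 0" using that uj(1) by (simp add: ev_emb g_def)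
      then have "\<tau> j = - ev f u" by (simp only: add_eq_0_iff)
      then have "\<tau> j \<in> H" using HR hD(3)[of "ev f u"] by simp
      then have "\<kappa> (\<tau> j) = \<kappa> 0" using I(2)[of "\<tau> j" 0] \<tau>(1)[OF uj(1)] sD(1) by simp
      then have j: "j = \<kappa> 0" using \<tau>(2)[OF uj(1)] by simp
      then have "ev f u = 0" using 0 \<tau>(3)[OF uj(1)] by simp
      then have "eqv X R u []" using presentsD(4)[OF P] by blast
      then have "eqv Y R' (emb u) []" using emb_eqv[of u "[]"] by (simp add: emb_def)
      then have "eqv Y R' (emb u @ [(Inr j, True)]) []"
        using eqv_append[of Y R' "emb u" "[]" "[(Inr j, True)]" "[]"] base j by simp
      with * show ?thesis by (rule eqv.trans)
    qed
  qed
  then show ?thesis by (rule fin_presI)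
qed

section \<open>Abstract groups and groups of permutations\<close>

lemma double_eq_imp_0: "x = x + x \<Longrightarrow> x = (0 :: 'g::group_add)"
  using add_left_imp_eq[of x x 0] by simp

definition cay :: "('a, 'b) monoid_scheme \<Rightarrow> 'a \<Rightarrow> 'a sym" where
  "cay G g = perm_on (carrier G) (\<lambda>x. g \<otimes>\<^bsub>G\<^esub> x)"

context group
begin

lemma apply_cay:
  assumes "g \<in> carrier G"
  shows "apply_sym (cay G g) x = (if x \<in> carrier G then g \<otimes> x else x)"
proof -
  have "bij_betw (\<lambda>x. g \<otimes> x) (carrier G) (carrier G)"
    using assms by (intro bij_betw_byWitness[of _ "\<lambda>x. inv g \<otimes> x"]) (auto simp: m_assoc[symmetric])
  then show ?thesis unfolding cay_def by (rule apply_perm_on)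
qed

lemma cay_mult: "g \<in> carrier G \<Longrightarrow> h \<in> carrier G \<Longrightarrow> cay G (g \<otimes> h) = cay G g + cay G h"
  by (rule sym_eqI) (simp add: apply_cay m_assoc)

lemma cay_inj: "inj_on (cay G) (carrier G)"
proof (rule inj_onI)
  fix g h assume "g \<in> carrier G" "h \<in> carrier G" "cay G g = cay G h"
  then have "apply_sym (cay G g) \<one> = apply_sym (cay G h) \<one>" by simp
  then show "g = h" using \<open>g \<in> carrier G\<close> \<open>h \<in> carrier G\<close> by (simp add: apply_cay)
qed

lemma cay_one: "cay G \<one> = 0"
  using cay_mult[of \<one> \<one>] by (intro double_eq_imp_0) simp

lemma cay_inv: "g \<in> carrier G \<Longrightarrow> cay G (inv g) = - cay G g"
  using cay_mult[of "inv g" g] by (simp add: cay_one eq_neg_iff_add_eq_0)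

lemma cay_eq_0_iff: "g \<in> carrier G \<Longrightarrow> cay G g = 0 \<longleftrightarrow> g = \<one>"
  using inj_onD[OF cay_inj, of g \<one>] by (auto simp: cay_one)

lemma subgrp_cay: "subgroup H G \<Longrightarrow> subgrp (cay G ` H)"
proof -
  assume H: "subgroup H G"
  interpret H: subgroup H G by (rule H)
  show ?thesis unfolding subgrp_def
    using imageI[OF H.one_closed, of "cay G"] by (auto simp: cay_one cay_mult[symmetric] cay_inv[symmetric])
qed

end

text \<open>Letters outside \<open>A\<close> are dropped because \<open>eqv\<close> makes them
  trivial; this retracts all words onto the carrier of the free group.\<close>

definition red :: "'x set \<Rightarrow> 'x word \<Rightarrow> 'x word" where
  "red A w = foldr reduced_cons (filter (\<lambda>l. fst l \<in> A) w) []"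

lemma red_in_free_group: "red A w \<in> carrier (free_group A)"
  using set_foldr[of "filter (\<lambda>l. fst l \<in> A) w" "[]"]
  by (auto simp: red_def free_group_def intro!: reduced_foldr)

lemma red_free_group: "w \<in> carrier (free_group A) \<Longrightarrow> red A w = w"
proof -
  assume w: "w \<in> carrier (free_group A)"
  then have "filter (\<lambda>l. fst l \<in> A) w = w" by (auto simp: free_group_def filter_id_conv)
  then show ?thesis using w by (simp add: red_def foldr_Nil free_group_def)
qed

lemma eqv_reduced_cons: "eqv X R (l # w) (reduced_cons l w)"
  using eqv.cancel[of X R "[]" l] by (auto simp: reduced_cons_def split: list.split)

lemma eqv_foldr: "eqv X R (u @ v) (foldr reduced_cons u v)"
proof (induction u)
  case (Cons l u)
  have "eqv X R ([l] @ (u @ v)) ([l] @ foldr reduced_cons u v)"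
    by (rule eqv_append[OF eqv.refl Cons])
  from eqv.trans[OF this] eqv_reduced_cons show ?case by fastforce
qed simp

lemma eqv_red: "eqv A R w (red A w)"
proof -
  have "eqv A R w (filter (\<lambda>l. fst l \<in> A) w)"
  proof (induction w)
    case (Cons l w)
    have *: "eqv A R ([l] @ w) ([l] @ filter (\<lambda>l. fst l \<in> A) w)"
      by (rule eqv_append[OF eqv.refl Cons])
    have "eqv A R ([] @ l # w) ([] @ w)" if "fst l \<notin> A" using that by (rule eqv.outside)
    then show ?case using * eqv.trans[OF _ Cons] by auto
  qed simp
  from eqv.trans[OF this] show ?thesis
    using eqv_foldr[of A R "filter (\<lambda>l. fst l \<in> A) w" "[]"] by (simp add: red_def)
qed

text \<open>The link between two notions of evaluation: words in permutations, where letters outside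
  \<open>A\<close> are allowed, and homomorphisms out of the free group on \<open>A\<close>.\<close>

lemma ev_cay:
  assumes H: "group H" and h: "h \<in> hom (free_group A) H"
    and f: "\<And>x. f x = (if x \<in> A then cay H (h [(x, True)]) else 0)"
  shows "ev f w = cay H (h (red A w))"
proof -
  interpret H: group H by (rule H)
  interpret F: group "free_group A" by (rule group_free_group)
  interpret h: group_hom "free_group A" H h
    by (simp add: group_hom.intro group_hom_axioms.intro F.group_axioms H h)
  have one: "\<one>\<^bsub>free_group A\<^esub> = []" by (simp add: free_group_def)
  have single: "[l] \<in> carrier (free_group A)" if "fst l \<in> A" for l
    using that by (simp add: free_group_def reduced_Cons)
  have lval_f: "lval f l = cay H (h [l])" if l: "fst l \<in> A" for l
  proof (cases "snd l")
    case True
    then show ?thesis using l by (cases l) (simp add: f)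
  next
    case False
    define m where "m = (fst l, True)"
    have "[l] \<otimes>\<^bsub>free_group A\<^esub> [m] = []"
      using False by (cases l) (auto simp: free_group_def reduced_cons_def inv_letter_def m_def)
    then have "h [l] \<otimes>\<^bsub>H\<^esub> h [m] = \<one>\<^bsub>H\<^esub>"
      using h.hom_mult[OF single[OF l] single[of m]] l h.hom_one one by (simp add: m_def)
    then have "cay H (h [l]) + cay H (h [m]) = 0"
      using single[OF l] single[of m] l by (simp add: H.cay_mult[symmetric] H.cay_one m_def)
    then show ?thesis using False l by (simp add: lval_def f m_def eq_neg_iff_add_eq_0[symmetric])
  qed
  show ?thesis
  proof (induction w)
    case Nil
    show ?case using h.hom_one by (simp add: red_def one H.cay_one)
  next
    case (Cons l w)
    show ?case
    proof (cases "fst l \<in> A")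
      case True
      have "red A (l # w) = [l] \<otimes>\<^bsub>free_group A\<^esub> red A w"
        using True by (simp add: red_def free_group_def)
      then show ?thesis
        using True single red_in_free_group[of A w] by (simp add: lval_f H.cay_mult Cons)
    next
      case False
      then have "lval f l = 0" by (simp add: lval_def f)
      then show ?thesis using False by (simp add: red_def Cons[unfolded red_def])
    qed
  qed
qed

lemma finitely_presented_imp_fin_pres:
  assumes G: "finitely_presented G"
  shows "fin_pres (cay G ` carrier G)"
proof -
  interpret G: group G using G by (simp add: finitely_presented_def)
  obtain A :: "nat set" and R where A: "finite A" "finite R" "R \<subseteq> carrier (free_group A)"
    and iso: "free_group A Mod normal_closure (free_group A) R \<cong> G"
    using G by (auto simp: finitely_presented_def)
  interpret F: group "free_group A" by (rule group_free_group)
  define N where "N = normal_closure (free_group A) R"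
  interpret N: normal N "free_group A"
    unfolding N_def using A(3) by (rule F.normal_closure_normal)
  obtain \<psi> where \<psi>: "\<psi> \<in> iso (free_group A Mod N) G" using iso by (auto simp: is_iso_def N_def)
  define h where "h w = \<psi> (N #>\<^bsub>free_group A\<^esub> w)" for w
  have h: "h \<in> hom (free_group A) G"
    using hom_compose[OF N.r_coset_hom_Mod, of \<psi> G] \<psi> by (simp add: iso_def h_def[abs_def] comp_def)
  have h_surj: "h ` carrier (free_group A) = carrier G"
  proof -
    have "\<psi> ` carrier (free_group A Mod N) = carrier G" using \<psi> by (simp add: iso_def bij_betw_def)
    moreover have "carrier (free_group A Mod N) = (\<lambda>w. N #>\<^bsub>free_group A\<^esub> w) ` carrier (free_group A)"
      by (auto simp: FactGroup_def RCOSETS_def)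
    ultimately show ?thesis by (simp add: h_def image_image)
  qed
  interpret Q: group "free_group A Mod N" by (rule N.factorgroup_is_group)
  have in_N: "w \<in> N" if w: "w \<in> carrier (free_group A)" "h w = \<one>\<^bsub>G\<^esub>" for w
  proof -
    have "\<psi> N = \<one>\<^bsub>G\<^esub>"
      using group_hom.hom_one[of "free_group A Mod N" G \<psi>] \<psi>
      by (simp add: group_hom_def group_hom_axioms_def iso_def Q.group_axioms G.group_axioms)
    then have "N #>\<^bsub>free_group A\<^esub> w = N"
      using w \<psi> Q.one_closed inj_onD[of \<psi> "carrier (free_group A Mod N)" "N #>\<^bsub>free_group A\<^esub> w" N]
      by (auto simp: h_def iso_def bij_betw_def FactGroup_def RCOSETS_def)
    then show ?thesis using F.rcos_self[OF w(1) N.subgroup_axioms] by simp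
  qed
  have h_N: "h w = \<one>\<^bsub>G\<^esub>" if "w \<in> N" for w
  proof -
    have "N #>\<^bsub>free_group A\<^esub> w = N" using that by (simp add: F.coset_join2 N.subgroup_axioms N.mem_carrier)
    then show ?thesis
      using group_hom.hom_one[of "free_group A Mod N" G \<psi>] \<psi>
      by (simp add: h_def group_hom_def group_hom_axioms_def iso_def Q.group_axioms G.group_axioms)
  qed
  have R_N: "R \<subseteq> N" by (auto simp: N_def normal_closure_def)
  \<comment> \<open>The reduced words that are \<open>eqv\<close> to the empty word form a normal
    subgroup containing \<open>R\<close>, hence containing the normal closure. So triviality in the
    quotient implies triviality for \<open>eqv\<close>.\<close>
  define K where "K = {w \<in> carrier (free_group A). eqv A R w []}"
  have mult: "u \<otimes>\<^bsub>free_group A\<^esub> v = foldr reduced_cons u v" for u v by (simp add: free_group_def)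
  have one: "\<one>\<^bsub>free_group A\<^esub> = []" by (simp add: free_group_def)
  have eqv_mult: "eqv A R (u @ v) (u \<otimes>\<^bsub>free_group A\<^esub> v)" for u v by (simp add: mult eqv_foldr)
  have eqv_inv: "eqv A R (inv\<^bsub>free_group A\<^esub> u) (winv u)" if "u \<in> carrier (free_group A)" for u
    using eqv_mult[of "inv\<^bsub>free_group A\<^esub> u" u] F.l_inv[OF that] one by (subst eqv_iff_Nil) simp
  have "K \<lhd> free_group A"
  proof (rule F.normal_invI)
    show "subgroup K (free_group A)"
    proof (rule F.subgroupI)
      show "K \<noteq> {}" using F.one_closed one by (auto simp: K_def)
      show "inv\<^bsub>free_group A\<^esub> u \<in> K" if "u \<in> K" for u
        using that eqv.trans[OF eqv_inv[of u]] eqv_winv[of A R u "[]"] by (auto simp: K_def)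
      show "u \<otimes>\<^bsub>free_group A\<^esub> v \<in> K" if "u \<in> K" "v \<in> K" for u v
        using that eqv.trans[OF eqv.sym[OF eqv_mult[of u v]]] eqv_append[of A R u "[]" v "[]"]
        by (auto simp: K_def)
    qed (auto simp: K_def)
    fix x u assume x: "x \<in> carrier (free_group A)" and u: "u \<in> K"
    have "eqv A R (x \<otimes>\<^bsub>free_group A\<^esub> u \<otimes>\<^bsub>free_group A\<^esub> inv\<^bsub>free_group A\<^esub> x) ((x @ u) @ winv x)"
      by (rule eqv.trans[OF eqv.sym[OF eqv_mult] eqv_append[OF eqv.sym[OF eqv_mult] eqv_inv[OF x]]])
    also have "eqv A R ((x @ u) @ winv x) (x @ [] @ winv x)"
      using u eqv_context[of A R u "[]" x "winv x"] by (simp add: K_def)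
    also have "eqv A R (x @ [] @ winv x) []" using eqv_winv_right by simp
    finally show "x \<otimes>\<^bsub>free_group A\<^esub> u \<otimes>\<^bsub>free_group A\<^esub> inv\<^bsub>free_group A\<^esub> x \<in> K"
      using x u by (simp add: K_def)
  qed
  moreover have "R \<subseteq> K" using A(3) eqv.relator[of _ R A "[]" "[]"] by (auto simp: K_def)
  ultimately have N_K: "N \<subseteq> K" by (auto simp: N_def normal_closure_def)
  define f where "f x = (if x \<in> A then cay G (h [(x, True)]) else 0)" for x
  have ev_f: "ev f w = cay G (h (red A w))" for w
    by (rule ev_cay[OF G.group_axioms h f_def])
  have h_red: "h (red A w) \<in> carrier G" for w
    using h red_in_free_group[of A w] by (auto simp: hom_def)
  have "presents A R f (cay G ` carrier G)"
  proof (rule presentsI)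
    show "cay G ` carrier G = range (ev f)"
    proof
      show "range (ev f) \<subseteq> cay G ` carrier G" using h_red by (auto simp: ev_f)
      show "cay G ` carrier G \<subseteq> range (ev f)"
      proof (clarsimp simp: h_surj[symmetric])
        fix w assume "w \<in> carrier (free_group A)"
        then have "cay G (h w) = ev f w" by (simp add: ev_f red_free_group)
        then show "cay G (h w) \<in> range (ev f)" by simp
      qed
    qed
    show "ev f r = 0" if "r \<in> R" for r
      using that A(3) R_N h_N[of r] by (auto simp: ev_f red_free_group subset_iff G.cay_one)
    show "eqv A R w []" if "ev f w = 0" for w
    proof -
      have "red A w \<in> K"
        using that h_red[of w] in_N[OF red_in_free_group] N_K by (auto simp: ev_f G.cay_eq_0_iff)
      then show ?thesis using eqv.trans[OF eqv_red[of A R w]] by (simp add: K_def)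
    qed
  qed (use A in \<open>auto simp: f_def\<close>)
  then show ?thesis by (rule fin_presI)
qed

lemma fin_pres_imp_finitely_presented:
  fixes \<kappa> :: "'p \<Rightarrow> 'g::group_add"
  assumes P: "group P" and inj: "inj_on \<kappa> (carrier P)"
    and hom: "\<And>x y. x \<in> carrier P \<Longrightarrow> y \<in> carrier P \<Longrightarrow> \<kappa> (x \<otimes>\<^bsub>P\<^esub> y) = \<kappa> x + \<kappa> y"
    and fp: "fin_pres (\<kappa> ` carrier P)"
  shows "finitely_presented P"
proof -
  interpret P: group P by (rule P)
  obtain A :: "nat set" and R f where pr: "presents A R f (\<kappa> ` carrier P)"
    using fp by (auto simp: fin_pres_def)
  interpret F: group "free_group A" by (rule group_free_group)
  define h where "h w = inv_into (carrier P) \<kappa> (ev f w)" for w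
  have ev_im: "ev f w \<in> \<kappa> ` carrier P" for w using presentsD(3)[OF pr] by auto
  have h_carrier: "h w \<in> carrier P" and \<kappa>_h: "\<kappa> (h w) = ev f w" for w
    using ev_im[of w] by (auto simp: h_def inv_into_into f_inv_into_f)
  have ev_foldr: "ev f (foldr reduced_cons u v) = ev f u + ev f v" for u v
    using eqv_sound[OF _ _ eqv_foldr, of "{}" f UNIV u v] by simp
  have h: "h \<in> hom (free_group A) P"
  proof (rule homI)
    fix u v
    have "\<kappa> (h (u \<otimes>\<^bsub>free_group A\<^esub> v)) = \<kappa> (h u \<otimes>\<^bsub>P\<^esub> h v)"
      by (simp add: \<kappa>_h hom h_carrier) (simp add: free_group_def ev_foldr)
    then show "h (u \<otimes>\<^bsub>free_group A\<^esub> v) = h u \<otimes>\<^bsub>P\<^esub> h v"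
      using inj h_carrier by (auto dest: inj_onD)
  qed (simp add: h_carrier)
  interpret h: group_hom "free_group A" P h
    by (simp add: group_hom.intro group_hom_axioms.intro F.group_axioms P h)
  have \<kappa>_0: "\<kappa> \<one>\<^bsub>P\<^esub> = 0" using hom[of "\<one>\<^bsub>P\<^esub>" "\<one>\<^bsub>P\<^esub>"] by (intro double_eq_imp_0) simp
  have h_one: "h w = \<one>\<^bsub>P\<^esub> \<longleftrightarrow> ev f w = 0" for w
    using inj_onD[OF inj, of "h w" "\<one>\<^bsub>P\<^esub>"] \<kappa>_h[of w] \<kappa>_0 h_carrier[of w] by auto
  have ev_red: "ev f (red A w) = ev f w" for w
    using eqv_sound[OF presentsD(5,6)[OF pr] eqv_red] by metis
  have h_surj: "h ` carrier (free_group A) = carrier P"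
  proof
    show "carrier P \<subseteq> h ` carrier (free_group A)"
    proof
      fix x assume x: "x \<in> carrier P"
      then obtain w where "\<kappa> x = ev f w" using presentsD(3)[OF pr] by blast
      then have "\<kappa> (h (red A w)) = \<kappa> x" by (simp add: \<kappa>_h ev_red)
      then have "h (red A w) = x" using inj x h_carrier by (auto dest: inj_onD)
      then show "x \<in> h ` carrier (free_group A)" using red_in_free_group by blast
    qed
  qed (auto simp: h_carrier)
  define R' where "R' = red A ` R"
  have R': "R' \<subseteq> carrier (free_group A)" by (auto simp: R'_def red_in_free_group)
  define N where "N = normal_closure (free_group A) R'"
  interpret N: normal N "free_group A"
    unfolding N_def using R' by (rule F.normal_closure_normal)
  interpret Q: group "free_group A Mod N" by (rule N.factorgroup_is_group)
  have "R' \<subseteq> kernel (free_group A) P h"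
    using presentsD(5)[OF pr] by (auto simp: R'_def kernel_def red_in_free_group h_one ev_red)
  then have "N \<subseteq> kernel (free_group A) P h"
    using h.normal_kernel by (auto simp: N_def normal_closure_def)
  \<comment> \<open>Words are evaluated in the quotient by \<open>N\<close>, where the relators
    vanish; soundness of \<open>eqv\<close> then puts \<open>w\<close> into
    \<open>N\<close>.\<close>
  moreover have "kernel (free_group A) P h \<subseteq> N"
  proof
    fix w assume "w \<in> kernel (free_group A) P h"
    then have w: "w \<in> carrier (free_group A)" "ev f w = 0" by (simp_all add: kernel_def h_one)
    define f' where "f' x = (if x \<in> A
      then cay (free_group A Mod N) (N #>\<^bsub>free_group A\<^esub> [(x, True)]) else 0)" for x
    have ev_f': "ev f' u = cay (free_group A Mod N) (N #>\<^bsub>free_group A\<^esub> red A u)" for u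
      by (rule ev_cay[OF Q.group_axioms N.r_coset_hom_Mod f'_def])
    have coset_N: "N #>\<^bsub>free_group A\<^esub> u = \<one>\<^bsub>free_group A Mod N\<^esub>" if "u \<in> N" for u
      using that by (simp add: F.coset_join2 N.subgroup_axioms N.mem_carrier)
    have "red A r \<in> N" if "r \<in> R" for r
      using that by (auto simp: N_def normal_closure_def R'_def)
    then have "ev f' w = ev f' []"
      using w presentsD(4)[OF pr]
      by (intro eqv_sound[of R f' A]) (auto simp: ev_f' coset_N Q.cay_one f'_def simp del: one_FactGroup)
    then have "cay (free_group A Mod N) (N #>\<^bsub>free_group A\<^esub> w) = 0"
      using w(1) by (simp add: ev_f' red_free_group)
    moreover have "N #>\<^bsub>free_group A\<^esub> w \<in> carrier (free_group A Mod N)"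
      using w(1) by (auto simp: FactGroup_def RCOSETS_def)
    ultimately have "N #>\<^bsub>free_group A\<^esub> w = N" by (simp add: Q.cay_eq_0_iff)
    then show "w \<in> N" using F.rcos_self[OF w(1) N.subgroup_axioms] by simp
  qed
  ultimately have "N = kernel (free_group A) P h" by blast
  then have "free_group A Mod N \<cong> P" using h.FactGroup_iso[OF h_surj] by simp
  then show ?thesis
    unfolding finitely_presented_def
    using P presentsD(1,2)[OF pr] R' by (auto simp: N_def R'_def)
qed

definition free_pair :: "'g::group_add \<Rightarrow> 'g \<Rightarrow> bool" where
  "free_pair x y \<longleftrightarrow> (\<forall>w. reduced w \<longrightarrow> w \<noteq> [] \<longrightarrow> ev (\<lambda>b. if b then x else y) w \<noteq> 0)"

lemma free_pair_imp_free_subgroup: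
  assumes G: "group G" and xy: "x \<in> carrier G" "y \<in> carrier G" and fr: "free_pair (cay G x) (cay G y)"
  shows "\<exists>H. subgroup H G \<and> is_free_group (G\<lparr>carrier := H\<rparr>) \<and> \<not> comm_group (G\<lparr>carrier := H\<rparr>)"
proof -
  interpret G: group G by (rule G)
  define A where "A = {x, y}"
  obtain h where h: "h \<in> hom (free_group A) G" "\<forall>z\<in>A. h [(z, True)] = z"
    using free_group_universal[OF G, of A "\<lambda>z. z"] xy by (auto simp: A_def)
  interpret F: group "free_group A" by (rule group_free_group)
  interpret h: group_hom "free_group A" G h
    by (simp add: group_hom.intro group_hom_axioms.intro F.group_axioms G h)
  define f where "f z = (if z \<in> A then cay G (h [(z, True)]) else 0)" for z
  have ev_f: "ev f w = cay G (h (red A w))" for w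
    by (rule ev_cay[OF G h(1) f_def])
  have inj: "inj_on h (carrier (free_group A))"
  proof (rule h.inj_on_one_iff[THEN iffD2], intro allI impI)
    fix w assume w: "w \<in> carrier (free_group A)" "h w = \<one>\<^bsub>G\<^esub>"
    \<comment> \<open>Letters are renamed by whether they equal \<open>x\<close>. As
      \<open>A\<close> contains only \<open>x\<close> and \<open>y\<close>, this is injective on
      \<open>A\<close> and keeps the word reduced.\<close>
    define w' where "w' = map (\<lambda>l. (fst l = x, snd l)) w"
    have A_w: "fst ` set w \<subseteq> A" and "reduced w" using w by (simp_all add: free_group_def)
    then have "reduced w'"
      unfolding w'_def
    proof (induction w)
      case (Cons l w)
      then show ?case
        by (cases w) (auto simp: reduced_Cons inv_letter_def A_def prod_eq_iff)
    qed simp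
    moreover have "ev (\<lambda>b. if b then cay G x else cay G y) w' = ev f w"
      using A_w unfolding w'_def
      by (induction w) (auto simp: lval_def f_def A_def h(2)[unfolded A_def, simplified])
    moreover have "ev f w = 0" using w by (simp add: ev_f red_free_group G.cay_one)
    ultimately have "w' = []" using fr by (auto simp: free_pair_def)
    then show "w = \<one>\<^bsub>free_group A\<^esub>" by (simp add: w'_def free_group_def)
  qed
  define H where "H = h ` carrier (free_group A)"
  have sub: "subgroup H G" unfolding H_def by (rule h.img_is_subgroup)
  have "h \<in> iso (free_group A) (G\<lparr>carrier := H\<rparr>)"
    using inj h(1) by (auto simp: iso_def hom_def bij_betw_def H_def)
  then have "free_group A \<cong> G\<lparr>carrier := H\<rparr>" by (auto simp: is_iso_def)
  then have "is_free_group (G\<lparr>carrier := H\<rparr>)"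
    using G.subgroup_imp_group[OF sub] by (auto simp: is_free_group_def)
  moreover have "\<not> comm_group (G\<lparr>carrier := H\<rparr>)"
  proof
    assume "comm_group (G\<lparr>carrier := H\<rparr>)"
    then interpret C: comm_group "G\<lparr>carrier := H\<rparr>" .
    have "[(z, True)] \<in> carrier (free_group A)" if "z \<in> A" for z
      using that by (simp add: free_group_def reduced_Cons)
    then have "x \<in> H" "y \<in> H" using h(2) unfolding H_def by (force simp: A_def)+
    then have "x \<otimes>\<^bsub>G\<^esub> y = y \<otimes>\<^bsub>G\<^esub> x" using C.m_comm[of x y] by simp
    then have "cay G x + cay G y = cay G y + cay G x" using xy by (simp flip: G.cay_mult)
    \<comment> \<open>The reduced word x y x^-1 y^-1 would be trivial in a commutative
      group.\<close>
    moreover have "ev (\<lambda>b. if b then cay G x else cay G y) [(True, True), (False, True), (True, False), (False, False)]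
        = (cay G x + cay G y) - (cay G y + cay G x)"
      by (simp add: diff_conv_add_uminus minus_add add.assoc del: add_uminus_conv_diff)
    ultimately have "ev (\<lambda>b. if b then cay G x else cay G y)
        [(True, True), (False, True), (True, False), (False, False)] = 0" by simp
    moreover have "reduced [(True, True), (False, True), (True, False), (False, False)]"
      by (simp add: reduced_def inv_letter_def)
    ultimately show False using fr unfolding free_pair_def by blast
  qed
  ultimately show ?thesis using sub by blast
qed

section \<open>Amalgamated products\<close>

definition alternating :: "'g::group_add set \<Rightarrow> 'g set \<Rightarrow> (bool \<times> 'g) list \<Rightarrow> bool" where
  "alternating A B w \<longleftrightarrow> (\<forall>(s, g)\<in>set w. g \<in> (if s then A - B else B - A)) \<and>
     successively (\<lambda>x y. fst x \<noteq> fst y) w"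

lemma alternating_Nil [simp]: "alternating A B []"
  by (simp add: alternating_def)

lemma alternating_Cons:
  "alternating A B (x # w) \<longleftrightarrow> snd x \<in> (if fst x then A - B else B - A) \<and> alternating A B w \<and>
     (w = [] \<or> fst (hd w) \<noteq> fst x)"
  by (cases w) (auto simp: alternating_def split: prod.splits)

lemma alternating_append:
  "alternating A B (v @ w) \<longleftrightarrow> alternating A B v \<and> alternating A B w \<and>
     (v = [] \<or> w = [] \<or> fst (last v) \<noteq> fst (hd w))"
  by (auto simp: alternating_def successively_append_iff)

text \<open>The action of both factors on the normal forms of their amalgam: a state \<open>(c, l)\<close> stands
  for \<open>c\<close> in the amalgamated subgroup followed by a list of coset representatives.\<close>

lemma amalgam_action:
  fixes A B :: "'g::group_add set"
  assumes A: "subgrp A" and B: "subgrp B"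
  obtains \<rho> :: "bool \<Rightarrow> 'g \<Rightarrow> ('g \<times> (bool \<times> 'g) list) sym"
  where "\<And>s g h. g \<in> (if s then A else B) \<Longrightarrow> h \<in> (if s then A else B) \<Longrightarrow> \<rho> s (g + h) = \<rho> s g + \<rho> s h"
    and "\<And>g. g \<in> A \<Longrightarrow> g \<in> B \<Longrightarrow> \<rho> True g = \<rho> False g"
    and "\<And>w. alternating A B w \<Longrightarrow> w \<noteq> [] \<Longrightarrow> sum_list (map (\<lambda>(s, g). \<rho> s g) w) \<noteq> 0"
proof -
  define C where "C = A \<inter> B"
  define F where "F s = (if s then A else B)" for s
  have F: "subgrp (F s)" for s using A B by (simp add: F_def)
  have C: "subgrp C" using A B by (auto simp: C_def subgrp_def)
  have CF: "C \<subseteq> F s" for s by (auto simp: C_def F_def)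
  note cD = subgrpD[OF C] and fD = subgrpD[OF F]
  \<comment> \<open>The predicate under SOME depends only on the coset of \<open>x\<close> modulo
    \<open>C\<close>, so \<open>rep\<close> is constant on cosets; the coset \<open>C\<close> itself
    gets 0.\<close>
  define rep where "rep x = (if x \<in> C then 0 else SOME y. x - y \<in> C)" for x
  have rep_diff: "x - rep x \<in> C" for x
  proof (cases "x \<in> C")
    case False
    have "x - (SOME y. x - y \<in> C) \<in> C" by (rule someI[of _ x]) (simp add: cD)
    then show ?thesis using False by (simp add: rep_def)
  qed (simp add: rep_def)
  have rep_add: "rep (c + x) = rep x" if "c \<in> C" for c x
  proof -
    have "c + x \<in> C \<longleftrightarrow> x \<in> C" using that by (rule cD(5))
    moreover have "c + x - y \<in> C \<longleftrightarrow> x - y \<in> C" for y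
      using cD(5)[OF that, of "x - y"] by (simp add: algebra_simps)
    ultimately show ?thesis by (simp add: rep_def)
  qed
  have rep_C: "rep x \<in> C \<longleftrightarrow> x \<in> C" for x
    using cD(5)[OF rep_diff[of x], of "rep x"] by simp
  have rep_rep: "rep (rep x) = rep x" for x
    using rep_add[OF rep_diff[of x], of "rep x"] by simp
  have rep_F: "rep x \<in> F s" if "x \<in> F s" for x s
    using that rep_diff[of x] CF[of s] fD(5)[of "x - rep x" s "rep x"] by auto
  define good where "good l \<longleftrightarrow> (\<forall>(s, x)\<in>set l. x \<in> F s \<and> x \<notin> C \<and> rep x = x) \<and>
    successively (\<lambda>x y. fst x \<noteq> fst y) l" for l
  have good_Cons: "good ((s, x) # l) \<longleftrightarrow> x \<in> F s \<and> x \<notin> C \<and> rep x = x \<and> good l \<and> (l = [] \<or> fst (hd l) \<noteq> s)"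
    for s x l by (cases l) (auto simp: good_def)
  define off where "off s l \<longleftrightarrow> l = [] \<or> fst (hd l) \<noteq> s" for s and l :: "(bool \<times> 'g) list"
  define D where "D = {(c, l). c \<in> C \<and> good l}"
  \<comment> \<open>\<open>unf s\<close> merges a leading representative from factor
    \<open>s\<close> into the head, giving an element of \<open>F s\<close> followed by a list that
    starts in the other factor; \<open>fld s\<close> undoes this. Between the two,
    \<open>F s\<close> acts by left translation.\<close>
  define unf where "unf s \<omega> = (case \<omega> of (c, l) \<Rightarrow> if off s l then (c, l) else (c + snd (hd l), tl l))" for s \<omega>
  define fld where "fld s \<omega> = (case \<omega> of (g, l) \<Rightarrow> if g \<in> C then (g, l) else (g - rep g, (s, rep g) # l))"
    for s :: bool and \<omega>
  define E where "E s = {(g, l). g \<in> F s \<and> good l \<and> off s l}" for s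
  have unf_E: "unf s \<omega> \<in> E s" if "\<omega> \<in> D" for s \<omega>
  proof -
    obtain c l where \<omega>: "\<omega> = (c, l)" "c \<in> C" "good l" using \<open>\<omega> \<in> D\<close> by (auto simp: D_def)
    show ?thesis
    proof (cases l)
      case (Cons y l')
      obtain r x where y: "y = (r, x)" by (cases y)
      show ?thesis using \<omega> CF[of s] by (auto simp: Cons y unf_def E_def off_def good_Cons fD)
    qed (use \<omega> CF in \<open>auto simp: unf_def E_def off_def\<close>)
  qed
  have fld_D: "fld s \<omega> \<in> D" if "\<omega> \<in> E s" for s \<omega>
  proof -
    obtain g l where "\<omega> = (g, l)" "g \<in> F s" "good l" "off s l" using \<open>\<omega> \<in> E s\<close> by (auto simp: E_def)
    then show ?thesis
      using rep_diff by (simp add: fld_def D_def good_Cons rep_C rep_rep rep_F) (simp add: off_def)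
  qed
  have fld_unf: "fld s (unf s \<omega>) = \<omega>" if "\<omega> \<in> D" for s \<omega>
  proof -
    obtain c l where \<omega>: "\<omega> = (c, l)" "c \<in> C" "good l" using \<open>\<omega> \<in> D\<close> by (auto simp: D_def)
    show ?thesis
    proof (cases "off s l")
      case False
      then obtain x l' where l: "l = (s, x) # l'" by (cases l) (auto simp: off_def)
      have "c + x \<notin> C" "rep (c + x) = x" using \<omega> by (auto simp: l good_Cons cD(5) rep_add)
      then show ?thesis using \<omega> l False by (simp add: unf_def fld_def)
    qed (use \<omega> in \<open>simp add: unf_def fld_def\<close>)
  qed
  have unf_fld: "unf s (fld s \<omega>) = \<omega>" if "\<omega> \<in> E s" for s \<omega>
  proof -
    obtain g l where "\<omega> = (g, l)" "off s l" using \<open>\<omega> \<in> E s\<close> by (auto simp: E_def)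
    moreover have "\<not> off s ((s, x) # l)" for x by (simp add: off_def)
    ultimately show ?thesis by (simp add: unf_def fld_def)
  qed
  define act where "act s g \<omega> = fld s (g + fst (unf s \<omega>), snd (unf s \<omega>))" for s g \<omega>
  have shift_E: "(g + fst \<omega>, snd \<omega>) \<in> E s" if "g \<in> F s" "\<omega> \<in> E s" for g s \<omega>
    using that by (auto simp: E_def fD)
  have act_D: "act s g \<omega> \<in> D" if "g \<in> F s" "\<omega> \<in> D" for s g \<omega>
    unfolding act_def by (intro fld_D shift_E unf_E that)
  have act_add: "act s (g + h) \<omega> = act s g (act s h \<omega>)" if "g \<in> F s" "h \<in> F s" "\<omega> \<in> D" for s g h \<omega>
    using unf_fld[OF shift_E[OF that(2) unf_E[OF that(3)]]] by (simp add: act_def add.assoc)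
  have act_0: "act s 0 \<omega> = \<omega>" if "\<omega> \<in> D" for s \<omega>
    using fld_unf[OF that] by (simp add: act_def)
  \<comment> \<open>On \<open>C\<close> the action does not depend on \<open>s\<close>; this is the
    amalgamation.\<close>
  have act_C: "act s g (c, l) = (g + c, l)" if "g \<in> C" "(c, l) \<in> D" for s g c l
  proof (cases "off s l")
    case True
    then show ?thesis using that by (simp add: act_def unf_def fld_def D_def cD)
  next
    case False
    then obtain x l' where l: "l = (s, x) # l'" by (cases l) (auto simp: off_def)
    have "g + (c + x) = (g + c) + x" by (simp add: add.assoc)
    moreover have "(g + c) + x \<notin> C" "rep ((g + c) + x) = x"
      using that by (auto simp: l D_def good_Cons cD rep_add)
    ultimately show ?thesis using l False by (simp add: act_def unf_def fld_def del: add.assoc)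
  qed
  have bij: "bij_betw (act s g) D D" if "g \<in> F s" for s g
  proof (rule bij_betw_byWitness[of _ "act s (- g)"])
    show "\<forall>\<omega>\<in>D. act s (- g) (act s g \<omega>) = \<omega>" "\<forall>\<omega>\<in>D. act s g (act s (- g) \<omega>) = \<omega>"
      using that by (auto simp: act_0 fD simp flip: act_add)
  qed (use that act_D fD in auto)
  define \<rho> where "\<rho> s g = perm_on D (act s g)" for s g
  have \<rho>: "apply_sym (\<rho> s g) \<omega> = (if \<omega> \<in> D then act s g \<omega> else \<omega>)" if "g \<in> F s" for s g \<omega>
    unfolding \<rho>_def by (rule apply_perm_on[OF bij[OF that]])
  show ?thesis
  proof (rule that[of \<rho>])
    show "\<rho> s (g + h) = \<rho> s g + \<rho> s h" if "g \<in> (if s then A else B)" "h \<in> (if s then A else B)" for s g h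
      using that act_D by (intro sym_eqI) (simp add: \<rho> fD act_add flip: F_def)
    show "\<rho> True g = \<rho> False g" if "g \<in> A" "g \<in> B" for g
    proof (rule sym_eqI)
      fix \<omega>
      have "g \<in> C" "g \<in> F True" "g \<in> F False" using that by (simp_all add: C_def F_def)
      then show "apply_sym (\<rho> True g) \<omega> = apply_sym (\<rho> False g) \<omega>"
        by (cases \<omega>) (simp add: \<rho> act_C)
    qed
    fix w assume w: "alternating A B w" "w \<noteq> []"
    have D0: "(0, []) \<in> D" by (simp add: D_def cD good_def)
    \<comment> \<open>Each syllable adds one representative to the list, so a nonempty alternating
      word moves the state \<open>(0, [])\<close>.\<close>
    have *: "alternating A B w \<Longrightarrow> \<exists>c l. apply_sym (sum_list (map (\<lambda>(s, g). \<rho> s g) w)) (0, []) = (c, l) \<and>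
        (c, l) \<in> D \<and> length l = length w \<and> (w \<noteq> [] \<longrightarrow> fst (hd l) = fst (hd w))" for w
    proof (induction w)
      case (Cons x w)
      obtain s g where x: "x = (s, g)" by (cases x)
      obtain c l where cl: "apply_sym (sum_list (map (\<lambda>(s, g). \<rho> s g) w)) (0, []) = (c, l)" "(c, l) \<in> D"
        "length l = length w" "w \<noteq> [] \<longrightarrow> fst (hd l) = fst (hd w)"
        using Cons by (auto simp: alternating_Cons)
      have g: "g \<in> F s" "g \<notin> C" using Cons.prems by (auto simp: x alternating_Cons F_def C_def split: if_splits)
      have "off s l" using cl Cons.prems by (cases w) (auto simp: off_def x alternating_Cons)
      then have "act s g (c, l) = (g + c - rep (g + c), (s, rep (g + c)) # l)"
        using g cl(2) by (simp add: act_def unf_def fld_def D_def cD)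
      then show ?case
        using cl act_D[OF g(1) cl(2)] g by (simp add: x \<rho>)
    qed (use D0 in auto)
    show "sum_list (map (\<lambda>(s, g). \<rho> s g) w) \<noteq> 0" using *[OF w(1)] w(2) by auto
  qed
qed

text \<open>The four ends of the two generators carry the four different elements
  \<open>a i\<close>. In a reduced word, neighbouring letters therefore leave
  \<open>- a i + a j\<close> with \<open>i \<noteq> j\<close> between two syllables \<open>b\<close>
  or \<open>- b\<close>, and this lies in \<open>A\<close> but not in \<open>B\<close>. Apart from
  its two ends the word is thus alternating.\<close>

lemma free_pair_of_alternating:
  fixes A B :: "'g::group_add set" and a :: "nat \<Rightarrow> 'g"
  assumes A: "subgrp A" and B: "subgrp B"
    and alt: "\<And>w. alternating A B w \<Longrightarrow> w \<noteq> [] \<Longrightarrow> sum_list (map snd w) \<noteq> 0"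
    and a: "\<And>i. i < 4 \<Longrightarrow> a i \<in> A" "\<And>i j. i < 4 \<Longrightarrow> j < 4 \<Longrightarrow> i \<noteq> j \<Longrightarrow> - a i + a j \<notin> B"
    and b: "b \<in> B" "b \<notin> A"
  shows "free_pair (a 0 + b - a 1) (a 2 + b - a 3)"
proof -
  note aD = subgrpD[OF A] and bD = subgrpD[OF B]
  define f where "f c = (if c then a 0 + b - a 1 else a 2 + b - a 3)" for c
  \<comment> \<open>\<open>st l\<close> and \<open>en l\<close> are the indices at the two ends of
    the letter \<open>l\<close>. As \<open>en l = st (inv_letter l)\<close> and \<open>st\<close> is
    injective, \<open>en l = st m\<close> would mean that \<open>l\<close> and \<open>m\<close>
    cancel.\<close>
  define st where "st l = (if fst l then 0 else 2) + (if snd l then 0 else 1 :: nat)" for l :: "bool \<times> bool"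
  define en where "en l = st (inv_letter l)" for l
  define \<beta> where "\<beta> l = (if snd l then b else - b)" for l :: "bool \<times> bool"
  have st4: "st l < 4" "en l < 4" for l by (simp_all add: st_def en_def)
  have st_inj: "st l = st m \<Longrightarrow> l = m" for l m by (auto simp: st_def prod_eq_iff split: if_splits)
  have \<beta>: "\<beta> l \<in> B - A" for l using b aD(7) bD(3) by (auto simp: \<beta>_def)
  have lval_f: "lval f l = a (st l) + \<beta> l - a (en l)" for l
    by (cases l) (auto simp: lval_def f_def st_def en_def \<beta>_def inv_letter_def numeral_eq_Suc algebra_simps
        diff_conv_add_uminus minus_add simp del: add_uminus_conv_diff)
  have *: "\<exists>v l'. alternating A B (v @ [(False, \<beta> l')]) \<and> hd (v @ [(False, \<beta> l')]) = (False, \<beta> (hd w)) \<and>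
      ev f w = a (st (hd w)) + sum_list (map snd (v @ [(False, \<beta> l')])) - a (en (last w))"
    if "reduced w" "w \<noteq> []" for w using that
  proof (induction w)
    case (Cons l w)
    show ?case
    proof (cases "w = []")
      case True
      then show ?thesis
        using \<beta> by (intro exI[of _ "[]"] exI[of _ l]) (simp add: lval_f alternating_Cons)
    next
      case False
      with Cons obtain v l' where v: "alternating A B (v @ [(False, \<beta> l')])"
        "hd (v @ [(False, \<beta> l')]) = (False, \<beta> (hd w))"
        "ev f w = a (st (hd w)) + sum_list (map snd (v @ [(False, \<beta> l')])) - a (en (last w))"
        by (auto simp: reduced_Cons)
      have ne: "en l \<noteq> st (hd w)" using Cons.prems False st_inj[of "inv_letter l" "hd w"] by (auto simp: reduced_Cons en_def)
      define m where "m = - a (en l) + a (st (hd w))"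
      have m: "m \<in> A - B" using a st4 ne by (simp add: m_def aD)
      have "alternating A B (((False, \<beta> l) # (True, m) # v) @ [(False, \<beta> l')])"
        using v(1,2) m \<beta> by (simp add: alternating_Cons)
      moreover have "ev f (l # w) = a (st l) + sum_list (map snd (((False, \<beta> l) # (True, m) # v) @ [(False, \<beta> l')]))
          - a (en (last w))"
        by (simp add: lval_f v(3) m_def diff_conv_add_uminus add.assoc del: add_uminus_conv_diff)
      ultimately show ?thesis using False
        by (intro exI[of _ "(False, \<beta> l) # (True, m) # v"] exI[of _ l']) simp
    qed
  qed simp
  show ?thesis
    unfolding free_pair_def f_def[symmetric]
  proof (intro allI impI notI)
    fix w assume w: "reduced w" "w \<noteq> []" "ev f w = 0"
    obtain v l where v: "alternating A B (v @ [(False, \<beta> l)])"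
      "ev f w = a (st (hd w)) + sum_list (map snd (v @ [(False, \<beta> l)])) - a (en (last w))"
      using *[OF w(1,2)] by blast
    \<comment> \<open>Conjugation brings the two ends together as \<open>\<delta>\<close>. It is
      absorbed by the last syllable if it lies in \<open>B\<close> and becomes a further syllable
      from \<open>A\<close> otherwise.\<close>
    define \<delta> where "\<delta> = - a (en (last w)) + a (st (hd w))"
    have \<delta>: "\<delta> \<in> A" using a st4 by (simp add: \<delta>_def aD)
    have "- a (st (hd w)) + ev f w + a (st (hd w)) = 0" using w(3) by simp
    then have sum0: "sum_list (map snd v) + \<beta> l + \<delta> = 0"
      unfolding v(2) \<delta>_def by (simp add: diff_conv_add_uminus add.assoc del: add_uminus_conv_diff)
    show False
    proof (cases "\<delta> \<in> B")
      case True
      have "alternating A B (v @ [(False, \<beta> l + \<delta>)])"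
        using v(1) True \<delta> \<beta>[of l] by (auto simp: alternating_append alternating_Cons aD bD)
      from alt[OF this] sum0 show False by (simp add: add.assoc)
    next
      case False
      have "alternating A B (v @ [(False, \<beta> l), (True, \<delta>)])"
        using v(1) False \<delta> by (auto simp: alternating_append alternating_Cons)
      from alt[OF this] sum0 show False by (simp add: add.assoc)
    qed
  qed
qed

section \<open>Heights of words\<close>

declare plus_fun_apply [simp del] zero_fun_apply [simp del]

text \<open>Letters \<open>Inl i\<close> with \<open>i < d\<close> are lifts of a basis of \<open>\<int>\<^sup>d\<close>; letters \<open>Inr k\<close> lie in the kernel.\<close>

definition uvec :: "nat \<Rightarrow> nat + 'k \<Rightarrow> nat \<Rightarrow> int" where
  "uvec d y = (case y of Inl i \<Rightarrow> (if i < d then (\<lambda>j. if j = i then 1 else 0) else 0) | Inr k \<Rightarrow> 0)"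

abbreviation wt :: "nat \<Rightarrow> (nat + 'k) word \<Rightarrow> nat \<Rightarrow> int" where
  "wt d \<equiv> ev (uvec d)"

abbreviation lwt :: "nat \<Rightarrow> (nat + 'k) \<times> bool \<Rightarrow> nat \<Rightarrow> int" where
  "lwt d \<equiv> lval (uvec d)"

definition supp :: "nat \<Rightarrow> (nat \<Rightarrow> int) \<Rightarrow> bool" where
  "supp d p \<longleftrightarrow> (\<forall>i\<ge>d. p i = 0)"

lemma supp_simps [simp]:
  "supp d 0" "supp d p \<Longrightarrow> supp d q \<Longrightarrow> supp d (p + q)" "supp d p \<Longrightarrow> supp d (- p)"
  "supp d p \<Longrightarrow> supp d q \<Longrightarrow> supp d (p - q)"
  by (auto simp: supp_def plus_fun_apply zero_fun_apply)

lemma supp_lwt [simp]: "supp d (lwt d l)"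
  by (cases l; cases "fst l") (auto simp: supp_def uvec_def lval_def zero_fun_apply)

lemma supp_wt [simp]: "supp d (wt d w)"
  by (induction w) auto

definition hgt :: "nat \<Rightarrow> (nat \<Rightarrow> real) \<Rightarrow> (nat \<Rightarrow> int) \<Rightarrow> real" where
  "hgt d u p = (\<Sum>i<d. u i * real_of_int (p i))"

lemma hgt_0 [simp]: "hgt d u 0 = 0"
  and hgt_add: "hgt d u (p + q) = hgt d u p + hgt d u q"
  and hgt_uminus [simp]: "hgt d u (- p) = - hgt d u p"
  and hgt_neg [simp]: "hgt d (\<lambda>i. - u i) p = - hgt d u p"
  by (simp_all add: hgt_def algebra_simps sum.distrib sum_negf plus_fun_apply zero_fun_apply)

lemma hgt_diff: "hgt d u (p - q) = hgt d u p - hgt d u q"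
  by (simp add: hgt_def algebra_simps sum_subtractf)

lemma hgt_unit: "i < d \<Longrightarrow> hgt d u (lwt d (Inl i, b)) = (if b then u i else - u i)"
  by (auto simp: hgt_def uvec_def lval_def if_distrib[of real_of_int] if_distrib[of "(*) _"]
      if_distrib[of uminus] cong: if_cong)

primrec above :: "nat \<Rightarrow> (nat \<Rightarrow> real) \<Rightarrow> real \<Rightarrow> (nat \<Rightarrow> int) \<Rightarrow> (nat + 'k) word \<Rightarrow> bool" where
  "above d u c p [] \<longleftrightarrow> c \<le> hgt d u p"
| "above d u c p (l # w) \<longleftrightarrow> c \<le> hgt d u p \<and> above d u c (p + lwt d l) w"

lemma above_start: "above d u c p w \<Longrightarrow> c \<le> hgt d u p"
  by (cases w) auto

lemma above_append: "above d u c p (v @ w) \<longleftrightarrow> above d u c p v \<and> above d u c (p + wt d v) w"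
  by (induction v arbitrary: p) (auto simp: add.assoc dest: above_start)

lemma above_end: "above d u c p w \<Longrightarrow> c \<le> hgt d u (p + wt d w)"
  using above_append[of d u c p w "[]"] by simp

lemma above_mono: "above d u c p w \<Longrightarrow> c' \<le> c \<Longrightarrow> above d u c' p w"
  by (induction w arbitrary: p) auto

lemma above_winv: "above d u c p w \<Longrightarrow> above d u c (p + wt d w) (winv w)"
proof (induction w arbitrary: p)
  case (Cons l w)
  then have "above d u c (p + lwt d l + wt d w) (winv w)" by simp
  moreover have "p + wt d (l # w) + wt d (winv w) = p + lwt d l" by (simp add: add.assoc)
  ultimately show ?case
    using Cons.prems above_start[of d u c "p + lwt d l" w] by (simp add: above_append add.assoc)
qed simp

lemma above_exists: "\<exists>c'\<le>c. above d u c' p w"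
proof (induction w arbitrary: p)
  case Nil
  then show ?case by (auto intro: exI[of _ "min c (hgt d u p)"])
next
  case (Cons l w)
  then obtain c' where "c' \<le> c" "above d u c' (p + lwt d l) w" by blast
  then show ?case
    by (intro exI[of _ "min c' (hgt d u p)"]) (auto intro: above_mono)
qed

text \<open>As long as letters remain to be spent, one of them keeps the path in the strip: otherwise all
  of them would lead away from the height of \<open>q\<close>.\<close>

lemma path_in_strip:
  assumes B: "\<And>i. i < d \<Longrightarrow> \<bar>u i\<bar> \<le> B" and width: "lo + 2 * B \<le> hi"
    and "supp d p" "supp d q" "lo \<le> hgt d u p" "hgt d u p \<le> hi" "lo \<le> hgt d u q" "hgt d u q \<le> hi"
  shows "\<exists>w :: (nat + 'k) word. wt d w = q - p \<and> above d u lo p w \<and> above d (\<lambda>i. - u i) (- hi) p w"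
  using assms(3-8)
proof (induction "\<Sum>i<d. nat \<bar>q i - p i\<bar>" arbitrary: p rule: less_induct)
  case less
  show ?case
  proof (cases "\<exists>i<d. q i \<noteq> p i")
    case False
    then have "q = p" using less.prems(1,2) by (auto simp: supp_def fun_eq_iff) (metis not_less)
    then show ?thesis using less.prems by (intro exI[of _ "[]"]) simp
  next
    case True
    \<comment> \<open>\<open>sg i\<close> is the change of height caused by a step towards
      \<open>q\<close> in coordinate \<open>i\<close>.\<close>
    define sg where "sg i = (if p i < q i then u i else - u i)" for i
    have hq: "hgt d u q - hgt d u p = (\<Sum>i<d. sg i * real_of_int \<bar>q i - p i\<bar>)"
      unfolding hgt_diff[symmetric] unfolding hgt_def
      by (intro sum.cong refl) (auto simp: sg_def algebra_simps)
    have "\<exists>i<d. q i \<noteq> p i \<and> lo \<le> hgt d u p + sg i \<and> hgt d u p + sg i \<le> hi"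
    proof (rule ccontr)
      assume "\<not> ?thesis"
      then have out: "hgt d u p + sg i < lo \<or> hi < hgt d u p + sg i" if "i < d" "q i \<noteq> p i" for i
        using that by force
      have sgB: "\<bar>sg i\<bar> \<le> B" if "i < d" for i using B[OF that] by (auto simp: sg_def)
      obtain i where i: "i < d" "q i \<noteq> p i" using True by blast
      \<comment> \<open>A step that leaves above \<open>hi\<close> starts above
        \<open>hi - B\<close>, so by the width of the strip no other step can leave below
        \<open>lo\<close>. Then all contributions to the height of \<open>q\<close> have the same
        sign, and a single one already carries \<open>q\<close> above \<open>hi\<close>.\<close>
      have term_le: "sg j * real_of_int \<bar>q j - p j\<bar> \<ge> 0 \<and> sg i * 1 \<le> sg i * real_of_int \<bar>q i - p i\<bar>"
        if "hi < hgt d u p + sg i" "j < d" for j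
      proof -
        have "sg i > 0" using that(1) less.prems by linarith
        moreover have "sg j \<ge> 0" if "q j \<noteq> p j"
          using out[OF \<open>j < d\<close> that] sgB[OF \<open>j < d\<close>] sgB[OF i(1)] \<open>hi < hgt d u p + sg i\<close> width less.prems by linarith
        moreover have "real_of_int \<bar>q i - p i\<bar> \<ge> 1" using i by linarith
        ultimately show ?thesis
          by (cases "q j = p j") (auto intro!: mult_left_mono)
      qed
      have term_ge: "sg j * real_of_int \<bar>q j - p j\<bar> \<le> 0 \<and> sg i * 1 \<ge> sg i * real_of_int \<bar>q i - p i\<bar>"
        if "hgt d u p + sg i < lo" "j < d" for j
      proof -
        have "sg i < 0" using that(1) less.prems by linarith
        moreover have "sg j \<le> 0" if "q j \<noteq> p j"
          using out[OF \<open>j < d\<close> that] sgB[OF \<open>j < d\<close>] sgB[OF i(1)] \<open>hgt d u p + sg i < lo\<close> width less.prems by linarith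
        moreover have "real_of_int \<bar>q i - p i\<bar> \<ge> 1" using i by linarith
        ultimately show ?thesis
          by (cases "q j = p j") (auto intro!: mult_left_mono_neg mult_nonpos_nonneg)
      qed
      from out[OF i] show False
      proof
        assume "hi < hgt d u p + sg i"
        then have "sg i \<le> hgt d u q - hgt d u p"
          unfolding hq using term_le i
          by (intro order_trans[OF _ member_le_sum[of i "{..<d}" "\<lambda>i. sg i * real_of_int \<bar>q i - p i\<bar>"]]) auto
        then show False using \<open>hi < hgt d u p + sg i\<close> less.prems by linarith
      next
        assume "hgt d u p + sg i < lo"
        then have "- sg i \<le> (\<Sum>i<d. - (sg i * real_of_int \<bar>q i - p i\<bar>))"
          using term_ge i
          by (intro order_trans[OF _ member_le_sum[of i "{..<d}" "\<lambda>i. - (sg i * real_of_int \<bar>q i - p i\<bar>)"]]) auto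
        then show False using \<open>hgt d u p + sg i < lo\<close> less.prems hq by (simp add: sum_negf)
      qed
    qed
    then obtain i where i: "i < d" "q i \<noteq> p i" "lo \<le> hgt d u p + sg i" "hgt d u p + sg i \<le> hi" by blast
    define l where "l = (Inl i :: nat + 'k, p i < q i)"
    define p' where "p' = p + lwt d l"
    have hp': "hgt d u p' = hgt d u p + sg i"
      using i(1) by (simp add: p'_def hgt_add l_def hgt_unit sg_def del: lval_Pair)
    have p'_i: "p' j = p j + (if j = i then (if p i < q i then 1 else -1) else 0)" for j
      using i(1) by (auto simp: p'_def l_def lval_def uvec_def plus_fun_apply)
    have "(\<Sum>j<d. nat \<bar>q j - p' j\<bar>) < (\<Sum>j<d. nat \<bar>q j - p j\<bar>)"
      using i(1,2) by (intro sum_strict_mono_ex1) (auto simp: p'_i)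
    then obtain w :: "(nat + 'k) word" where w: "wt d w = q - p'" "above d u lo p' w" "above d (\<lambda>i. - u i) (- hi) p' w"
      using less.hyps[of p'] less.prems i hp' by (auto simp: p'_def)
    show ?thesis
      using w less.prems by (intro exI[of _ "l # w"]) (auto simp: p'_def)
  qed
qed

section \<open>One of two opposite half spaces carries the kernel\<close>

definition alph :: "nat \<Rightarrow> 'g set \<Rightarrow> (nat + 'g) set" where
  "alph d A = Inl ` {..<d} \<union> Inr ` A"

definition gen :: "nat \<Rightarrow> (nat \<Rightarrow> 'g::group_add) \<Rightarrow> 'g set \<Rightarrow> nat + 'g \<Rightarrow> 'g" where
  "gen d t A y = (case y of Inl i \<Rightarrow> if i < d then t i else 0 | Inr k \<Rightarrow> if k \<in> A then k else 0)"

text \<open>By \<open>wt_0\<close> the weight of words is a homomorphism from \<open>S\<close> to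
  Z^d. \<open>comm\<close> puts the commutators of the lifts among the kernel generators, so that
  words of weight 0 become products of conjugates of letters from \<open>A\<close>.\<close>

locale zd_extension =
  fixes d :: nat and t :: "nat \<Rightarrow> 'g::group_add" and A :: "'g set"
    and R :: "(nat + 'g) word set" and S :: "'g set"
  assumes pres: "presents (alph d A) R (gen d t A) S"
    and wt_0: "\<And>w. ev (gen d t A) w = 0 \<Longrightarrow> wt d w = 0"
    and comm: "\<And>x y. fst x < d \<Longrightarrow> fst y < d \<Longrightarrow> lval t x + lval t y - lval t x - lval t y \<in> A"
begin

abbreviation evG :: "(nat + 'g) word \<Rightarrow> 'g" where "evG \<equiv> ev (gen d t A)"

definition Nker :: "'g set" where
  "Nker = {evG w | w. wt d w = 0}"

definition Nge :: "(nat \<Rightarrow> real) \<Rightarrow> real \<Rightarrow> 'g set" where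
  "Nge u c = {evG w | w. wt d w = 0 \<and> above d u c 0 w}"

lemma Nge_mono: "c' \<le> c \<Longrightarrow> Nge u c \<subseteq> Nge u c'"
  by (auto simp: Nge_def intro: above_mono)

lemma subgrp_Nge: "c \<le> 0 \<Longrightarrow> subgrp (Nge u c)"
  unfolding subgrp_def
proof (intro conjI ballI)
  assume c: "c \<le> 0"
  show "0 \<in> Nge u c" using c by (auto simp: Nge_def intro!: exI[of _ "[]"])
  fix x assume "x \<in> Nge u c"
  then obtain v where v: "x = evG v" "wt d v = 0" "above d u c 0 v" by (auto simp: Nge_def)
  have "above d u c 0 (winv v)" using above_winv[OF v(3)] v(2) by simp
  then show "- x \<in> Nge u c" using v by (auto simp: Nge_def intro!: exI[of _ "winv v"])
  fix y assume "y \<in> Nge u c"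
  then obtain w where w: "y = evG w" "wt d w = 0" "above d u c 0 w" by (auto simp: Nge_def)
  show "x + y \<in> Nge u c"
    using v w by (auto simp: Nge_def above_append intro!: exI[of _ "v @ w"])
qed

text \<open>If neither half space carried the kernel, the kernel would be an amalgam of the subgroups
  carried by two overlapping half spaces, over the subgroup carried by their intersection.\<close>

theorem half_space_dichotomy:
  assumes nofree: "\<And>x y. x \<in> S \<Longrightarrow> y \<in> S \<Longrightarrow> \<not> free_pair x y"
  shows "(\<exists>c\<le>0. Nker \<subseteq> Nge u c) \<or> (\<exists>c\<le>0. Nker \<subseteq> Nge (\<lambda>i. - u i) c)"
proof (rule ccontr)
  assume neg: "\<not> ?thesis"
  define B where "B = 1 + (\<Sum>i<d. \<bar>u i\<bar>)"
  have uB: "\<bar>u i\<bar> \<le> B" if "i < d" for i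
    using member_le_sum[of i "{..<d}" "\<lambda>i. \<bar>u i\<bar>"] that by (simp add: B_def)
  have B1: "B \<ge> 1" by (simp add: B_def sum_nonneg)
  have lB: "\<bar>hgt d u (lwt d l)\<bar> \<le> B" for l :: "(nat + 'g) \<times> bool"
  proof (cases "\<exists>i b. i < d \<and> l = (Inl i, b)")
    case True
    then show ?thesis using uB by (auto simp: hgt_unit simp del: lval_Pair)
  next
    case False
    then have "lwt d l = 0"
      by (cases l; cases "fst l") (auto simp: lval_def uvec_def)
    then show ?thesis using B1 by simp
  qed
  \<comment> \<open>The path of a relator, of a cancelling pair or of a single letter never strays
    by more than \<open>D\<close> in height; the summand 2 covers the last two cases. Two half
    spaces that overlap in a slab of width \<open>L = 2 * D\<close> therefore contain each such path
    wholly in one of them (\<open>short\<close>).\<close>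
  define D where "D = B * real (sum length R + 2)"
  have D: "B * real (length w) \<le> D" if "length w \<le> 2 \<or> w \<in> R" for w
  proof -
    have "length w \<le> sum length R" if "w \<in> R"
      using that presentsD(2)[OF pres] by (intro member_le_sum) auto
    then have "length w \<le> sum length R + 2" using that by auto
    then have "real (length w) \<le> real (sum length R + 2)" by (simp only: of_nat_le_iff)
    then show ?thesis unfolding D_def using B1 by (intro mult_left_mono) auto
  qed
  define L where "L = 2 * D"
  have L: "L \<ge> 2 * B" "L \<ge> 0" using D[of "[_]"] B1 by (simp_all add: L_def)
  define u' where "u' = (\<lambda>i. - u i)"
  have short: "above d u 0 p w \<or> above d u' (- L) p w" if "B * real (length w) \<le> D" for p and w :: "(nat + 'g) word"
  proof -
    have "above d u 0 p w" if "D \<le> hgt d u p"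
    proof -
      have "B * real (length w) \<le> hgt d u p" using that \<open>B * real (length w) \<le> D\<close> by linarith
      then show ?thesis
      proof (induction w arbitrary: p)
        case (Cons m w)
        have "0 \<le> B * real (length w)" using B1 by simp
        moreover have "B + B * real (length w) \<le> hgt d u p" using Cons.prems by (simp add: algebra_simps)
        ultimately have "0 \<le> hgt d u p" "B * real (length w) \<le> hgt d u (p + lwt d m)"
          unfolding hgt_add using lB[of m] B1 by linarith+
        then show ?case using Cons.IH by simp
      qed simp
    qed
    moreover have "above d u' (- L) p w" if "hgt d u p \<le> D"
    proof -
      have "hgt d u p + B * real (length w) \<le> L" using that \<open>B * real (length w) \<le> D\<close> by (simp add: L_def)
      then show ?thesis
      proof (induction w arbitrary: p)
        case (Cons m w)
        have "0 \<le> B * real (length w)" using B1 by simp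
        moreover have "hgt d u p + (B + B * real (length w)) \<le> L" using Cons.prems by (simp add: algebra_simps)
        ultimately have "hgt d u p \<le> L" "hgt d u (p + lwt d m) + B * real (length w) \<le> L"
          unfolding hgt_add using lB[of m] B1 by linarith+
        then show ?case using Cons.IH by (simp add: u'_def)
      qed (simp add: u'_def)
    qed
    ultimately show ?thesis by linarith
  qed
  \<comment> \<open>Base paths from 0 to \<open>p\<close> that stay in each of the two half spaces
    to which \<open>p\<close> belongs. The empty path at 0 makes \<open>loop 0 w\<close> the value
    of a closed word \<open>w\<close>.\<close>
  have "\<exists>w :: (nat + 'g) word. wt d w = p \<and> (0 \<le> hgt d u p \<longrightarrow> above d u 0 0 w) \<and>
      (hgt d u p \<le> L \<longrightarrow> above d u' (- L) 0 w) \<and> (p = 0 \<longrightarrow> w = [])" if p: "supp d p" for p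
  proof (cases "p = 0")
    case True
    then show ?thesis using L by (intro exI[of _ "[]"]) simp
  next
    case False
    have "min 0 (hgt d u p) + 2 * B \<le> max L (hgt d u p)" "0 \<le> max L (hgt d u p)"
      using L min.cobounded1[of 0 "hgt d u p"] max.cobounded1[of L "hgt d u p"] by linarith+
    then obtain w :: "(nat + 'g) word" where "wt d w = p" "above d u (min 0 (hgt d u p)) 0 w"
      "above d u' (- max L (hgt d u p)) 0 w"
      using path_in_strip[where d = d and u = u and B = B and lo = "min 0 (hgt d u p)" and hi = "max L (hgt d u p)" and p = 0 and q = p] p L uB
      by (auto simp: u'_def)
    then show ?thesis using False by (intro exI[of _ w]) (auto intro: above_mono simp: min_def max_def)
  qed
  then obtain \<omega> where \<omega>: "wt d (\<omega> p) = p" "0 \<le> hgt d u p \<Longrightarrow> above d u 0 0 (\<omega> p)"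
    "hgt d u p \<le> L \<Longrightarrow> above d u' (- L) 0 (\<omega> p)" "p = 0 \<Longrightarrow> \<omega> p = ([] :: (nat + 'g) word)"
    if "supp d p" for p by metis
  define A0 where "A0 = Nge u 0"
  define B0 where "B0 = Nge u' (- L)"
  have A0: "subgrp A0" and B0: "subgrp B0" using L by (simp_all add: A0_def B0_def subgrp_Nge)
  define loop where "loop p w = evG (\<omega> p) + evG w - evG (\<omega> (p + wt d w))" for p and w :: "(nat + 'g) word"
  have loop_ge: "loop p w \<in> Nge v c"
    if p: "supp d p" and w: "above d v c p w" and \<omega>': "above d v c 0 (\<omega> p)" "above d v c 0 (\<omega> (p + wt d w))"
    for p w v c
  proof -
    have "above d v c (p + wt d w) (winv (\<omega> (p + wt d w)))"
      using above_winv[OF \<omega>'(2)] p by (simp add: \<omega>)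
    then have "above d v c 0 (\<omega> p @ w @ winv (\<omega> (p + wt d w)))"
      using \<omega>' w p by (simp add: above_append \<omega>)
    moreover have "wt d (\<omega> p @ w @ winv (\<omega> (p + wt d w))) = 0" using p by (simp add: \<omega>)
    moreover have "loop p w = evG (\<omega> p @ w @ winv (\<omega> (p + wt d w)))" by (simp add: loop_def algebra_simps)
    ultimately show ?thesis unfolding Nge_def by blast
  qed
  have loop_A0: "loop p w \<in> A0" if "supp d p" "above d u 0 p w" for p w
    unfolding A0_def using that above_start[OF that(2)] above_end[OF that(2)] by (intro loop_ge \<omega>) simp_all
  have loop_B0: "loop p w \<in> B0" if "supp d p" "above d u' (- L) p w" for p w
    unfolding B0_def using that above_start[OF that(2)] above_end[OF that(2)]
    by (intro loop_ge \<omega>) (simp_all add: u'_def)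
  have loop_append: "loop p (v @ w) = loop p v + loop (p + wt d v) w" for p v w
    by (simp add: loop_def diff_conv_add_uminus add.assoc del: add_uminus_conv_diff)
  have loop_Cons: "loop p (l # w) = loop p [l] + loop (p + lwt d l) w" for p l w
    using loop_append[of p "[l]" w] by simp
  have loop_0: "loop p w = 0" if "evG w = 0" for p w
    using that wt_0[OF that] by (simp add: loop_def)
  have Nker_loop: "evG w = loop 0 w" if "wt d w = 0" for w using that by (simp add: loop_def \<omega>)
  have Nker_sub: "Nker \<subseteq> M" if M: "subgrp M" "A0 \<subseteq> M" "B0 \<subseteq> M" for M
  proof -
    have "loop p w \<in> M" if "supp d p" for p w using that
    proof (induction w arbitrary: p)
      case Nil
      then show ?case using subgrpD(1)[OF M(1)] by (simp add: loop_def)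
    next
      case (Cons l w)
      have "loop p [l] \<in> M" using short[of "[l]" p] D[of "[l]"] loop_A0 loop_B0 M(2,3) Cons.prems by auto
      then show ?case using Cons subgrpD(2)[OF M(1)] by (subst loop_Cons) simp
    qed
    then show ?thesis using Nker_loop by (auto simp: Nker_def)
  qed
  obtain \<rho> :: "bool \<Rightarrow> 'g \<Rightarrow> ('g \<times> (bool \<times> 'g) list) sym" where
    \<rho>_add: "\<And>s g h. g \<in> (if s then A0 else B0) \<Longrightarrow> h \<in> (if s then A0 else B0) \<Longrightarrow> \<rho> s (g + h) = \<rho> s g + \<rho> s h"
    and \<rho>_eq: "\<And>g. g \<in> A0 \<Longrightarrow> g \<in> B0 \<Longrightarrow> \<rho> True g = \<rho> False g"
    and \<rho>_alt: "\<And>w. alternating A0 B0 w \<Longrightarrow> w \<noteq> [] \<Longrightarrow> sum_list (map (\<lambda>(s, g). \<rho> s g) w) \<noteq> 0"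
    using amalgam_action[OF A0 B0] by metis
  have \<rho>_0: "\<rho> s 0 = 0" for s
    using \<rho>_add[of 0 s 0] subgrpD(1)[OF A0] subgrpD(1)[OF B0] by (intro double_eq_imp_0) simp
  \<comment> \<open>The map from the kernel to the amalgam, edge by edge: an edge inside the first
    half space goes to the first factor, any other to the second, and \<open>cc\<close> adds up
    along a path. By \<open>short\<close>, each elementary change of a word happens inside one half
    space, where \<open>cc\<close> is the image of a single loop; hence \<open>cc\<close> respects
    the relators.\<close>
  define \<sigma> where "\<sigma> p l = (if 0 \<le> hgt d u p \<and> 0 \<le> hgt d u (p + lwt d l) then \<rho> True (loop p [l]) else \<rho> False (loop p [l]))"
    for p l
  define cc where "cc = rec_list (\<lambda>p. 0) (\<lambda>l w r p. \<sigma> p l + r (p + lwt d l))"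
  have cc [simp]: "cc [] p = 0" "cc (l # w) p = \<sigma> p l + cc w (p + lwt d l)" for l w p
    by (simp_all add: cc_def)
  have cc_append: "cc (v @ w) p = cc v p + cc w (p + wt d v)" for v w p
    by (induction v arbitrary: p) (simp_all add: add.assoc)
  have cc_A0: "cc w p = \<rho> True (loop p w)" if "supp d p" "above d u 0 p w" for w p using that
  proof (induction w arbitrary: p)
    case Nil
    then show ?case by (simp add: loop_def \<rho>_0)
  next
    case (Cons l w)
    have "\<sigma> p l = \<rho> True (loop p [l])"
      using Cons.prems above_start[of d u 0 "p + lwt d l" w] by (auto simp: \<sigma>_def)
    moreover have "loop p [l] \<in> A0" "loop (p + lwt d l) w \<in> A0"
      using Cons.prems above_start[of d u 0 "p + lwt d l" w] by (auto intro!: loop_A0)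
    ultimately show ?case using Cons \<rho>_add[of _ True] by (subst loop_Cons) simp
  qed
  have cc_B0: "cc w p = \<rho> False (loop p w)" if "supp d p" "above d u' (- L) p w" for w p using that
  proof (induction w arbitrary: p)
    case Nil
    then show ?case by (simp add: loop_def \<rho>_0)
  next
    case (Cons l w)
    have *: "loop p [l] \<in> B0" "loop (p + lwt d l) w \<in> B0"
      using Cons.prems above_start[of d u' "- L" "p + lwt d l" w] by (auto intro!: loop_B0)
    moreover have "\<sigma> p l = \<rho> False (loop p [l])"
      using *(1) Cons.prems loop_A0[of p "[l]"] \<rho>_eq by (auto simp: \<sigma>_def)
    ultimately show ?case using Cons \<rho>_add[of _ False] by (subst loop_Cons) simp
  qed
  have cc_short: "cc w p = 0" if "supp d p" "evG w = 0" "B * real (length w) \<le> D" for w p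
    using short[OF that(3), of p] cc_A0 cc_B0 loop_0[OF that(2)] that(1) by (auto simp: \<rho>_0)
  have cc_eqv: "supp d p \<longrightarrow> cc v p = cc w p" if "eqv (alph d A) R v w" for v w p
    using that
  proof (induction arbitrary: p rule: eqv.induct)
    case (cancel a l b)
    have *: "evG [l, inv_letter l] = 0" by simp
    have "cc ([l, inv_letter l] @ b) q = cc b q" if "supp d q" for q
      using cc_short[OF that *] D[of "[l, inv_letter l]"] wt_0[OF *] by (subst cc_append) simp
    then show ?case by (simp add: cc_append del: cc(2))
  next
    case (relator r a b)
    have *: "evG r = 0" using presentsD(5)[OF pres relator] .
    show ?case using cc_short[OF _ *, of "p + wt d a"] D[of r] relator wt_0[OF *] by (simp add: cc_append)
  next
    case (outside l a b)
    have *: "evG [l] = 0" using presentsD(6)[OF pres outside] by (simp add: lval_def)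
    have "cc ([l] @ b) q = cc b q" if "supp d q" for q
      using cc_short[OF that *] D[of "[l]"] wt_0[OF *] by (subst cc_append) simp
    then show ?case by (simp add: cc_append del: cc(2))
  qed auto
  have alt: "sum_list (map snd v) \<noteq> 0" if v: "alternating A0 B0 v" "v \<noteq> []" for v
  proof
    assume sum0: "sum_list (map snd v) = 0"
    have "\<exists>w. evG w = sum_list (map snd v) \<and> wt d w = 0 \<and> cc w 0 = sum_list (map (\<lambda>(s, g). \<rho> s g) v)"
      using v(1)
    proof (induction v)
      case Nil
      show ?case by (intro exI[of _ "[]"]) simp
    next
      case (Cons x v)
      obtain s g where x: "x = (s, g)" by (cases x)
      obtain w where w: "evG w = sum_list (map snd v)" "wt d w = 0" "cc w 0 = sum_list (map (\<lambda>(s, g). \<rho> s g) v)"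
        using Cons by (auto simp: alternating_Cons)
      have "g \<in> (if s then A0 else B0)" using Cons.prems by (auto simp: x alternating_Cons split: if_splits)
      then obtain wg where wg: "g = evG wg" "wt d wg = 0" "if s then above d u 0 0 wg else above d u' (- L) 0 wg"
        by (cases s) (auto simp: A0_def B0_def Nge_def)
      have "cc wg 0 = \<rho> s g"
        using wg Nker_loop[OF wg(2)] cc_A0[of 0 wg] cc_B0[of 0 wg] by (cases s) simp_all
      then show ?case using w wg by (intro exI[of _ "wg @ w"]) (simp add: x cc_append)
    qed
    then obtain w where "evG w = 0" "cc w 0 = sum_list (map (\<lambda>(s, g). \<rho> s g) v)" using sum0 by auto
    moreover have "cc w 0 = cc [] 0" using cc_eqv[of w "[]" 0] presentsD(4)[OF pres] \<open>evG w = 0\<close> by simp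
    ultimately show False using \<rho>_alt[OF v] by simp
  qed
  \<comment> \<open>As \<open>c\<close> decreases, the subgroups \<open>Nge u' c\<close> exhaust the
    elements of \<open>A0\<close>, but none contains all of \<open>A0\<close>. Three choices at
    growing depth give, together with 0, four elements of \<open>A0\<close> that are pairwise
    incongruent modulo \<open>B0\<close>.\<close>
  have pick: "\<exists>x c'. x \<in> A0 \<and> x \<notin> Nge u' c \<and> c' \<le> c \<and> x \<in> Nge u' c'" if "c \<le> - L" for c
  proof -
    have "\<not> A0 \<subseteq> Nge u' c"
    proof
      assume "A0 \<subseteq> Nge u' c"
      moreover have "B0 \<subseteq> Nge u' c" unfolding B0_def using that by (rule Nge_mono)
      moreover have "c \<le> 0" using that L by linarith
      ultimately have "Nker \<subseteq> Nge u' c" by (intro Nker_sub subgrp_Nge)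
      then show False using neg \<open>c \<le> 0\<close> by (auto simp: u'_def)
    qed
    then obtain x where x: "x \<in> A0" "x \<notin> Nge u' c" by blast
    then obtain w where w: "x = evG w" "wt d w = 0" by (auto simp: A0_def Nge_def)
    obtain c' where "c' \<le> c" "above d u' c' 0 w" using above_exists by blast
    then have "x \<in> Nge u' c'" using w by (auto simp: Nge_def)
    then show ?thesis using x \<open>c' \<le> c\<close> by blast
  qed
  obtain x1 c1 where 1: "x1 \<in> A0" "x1 \<notin> Nge u' (- L)" "c1 \<le> - L" "x1 \<in> Nge u' c1" using pick[of "- L"] by blast
  obtain x2 c2 where 2: "x2 \<in> A0" "x2 \<notin> Nge u' c1" "c2 \<le> c1" "x2 \<in> Nge u' c2" using pick[OF 1(3)] by blast
  obtain x3 c3 where 3: "x3 \<in> A0" "x3 \<notin> Nge u' c2" "c3 \<le> c2" "x3 \<in> Nge u' c3" using pick[of c2] 1 2 by force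
  have sep: "- x + y \<notin> B0 \<and> - y + x \<notin> B0" if "x \<in> Nge u' c" "y \<notin> Nge u' c" "c \<le> - L" for x y c
  proof -
    have M: "subgrp (Nge u' c)" using that L by (intro subgrp_Nge) simp
    have "B0 \<subseteq> Nge u' c" unfolding B0_def using that(3) by (rule Nge_mono)
    moreover have "- x + y \<notin> Nge u' c" "- y + x \<notin> Nge u' c"
      using that subgrpD(5)[OF M, of "- x" y] subgrpD(6)[OF M, of x "- y"] subgrpD(7)[OF M] by auto
    ultimately show ?thesis by blast
  qed
  have zero: "0 \<in> Nge u' (- L)" "0 \<in> A0" using subgrpD(1)[OF A0] subgrpD(1)[OF B0] by (simp_all add: B0_def)
  have c12: "c1 \<le> - L" "c2 \<le> - L" using 1 2 by linarith+
  define a where "a i = (if i = 0 then 0 else if i = 1 then x1 else if i = 2 then x2 else x3)" for i :: nat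
  have in1: "0 \<in> Nge u' c1" "0 \<in> Nge u' c2" "x1 \<in> Nge u' c2"
    using zero(1) 1(4) Nge_mono[OF c12(1)] Nge_mono[OF c12(2)] Nge_mono[OF 2(3)] by blast+
  have a_sep: "- a i + a j \<notin> B0" if "i < 4" "j < 4" "i \<noteq> j" for i j
    using that sep[OF zero(1) 1(2)] sep[OF in1(1) 2(2)] sep[OF in1(2) 3(2)] sep[OF 1(4) 2(2)] sep[OF in1(3) 3(2)]
      sep[OF 2(4) 3(2)] c12 by (auto simp: a_def)
  have a_in: "a i \<in> A0" for i using 1 2 3 zero by (simp add: a_def)
  \<comment> \<open>Otherwise the first half space alone would carry the kernel.\<close>
  have "\<not> B0 \<subseteq> A0"
  proof
    assume "B0 \<subseteq> A0"
    then have "Nker \<subseteq> A0" by (intro Nker_sub A0) simp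
    then show False using neg by (auto simp: A0_def)
  qed
  then obtain b where b: "b \<in> B0" "b \<notin> A0" by blast
  have "free_pair (a 0 + b - a 1) (a 2 + b - a 3)"
    by (rule free_pair_of_alternating[OF A0 B0 alt a_in a_sep b])
  moreover have "subgrp S" "A0 \<subseteq> S" "B0 \<subseteq> S"
    using presentsD(3)[OF pres] subgrp_range_ev by (auto simp: A0_def B0_def Nge_def)
  moreover from this have "a i + b - a j \<in> S" for i j
    using a_in b(1) by (intro subgrpD(2,4)) auto
  ultimately show False using nofree by blast
qed

end

section \<open>Rewriting words as products of conjugates\<close>

definition tvec :: "nat \<Rightarrow> nat \<Rightarrow> nat \<Rightarrow> int" where
  "tvec d i = (if i < d then (\<lambda>j. if j = i then 1 else 0) else 0)"

abbreviation twt :: "nat \<Rightarrow> nat word \<Rightarrow> nat \<Rightarrow> int" where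
  "twt d \<equiv> ev (tvec d)"

definition tword :: "nat \<Rightarrow> nat word \<Rightarrow> bool" where
  "tword d h \<longleftrightarrow> (\<forall>l\<in>set h. fst l < d)"

lemma tword_simps [simp]:
  "tword d []" "tword d (l # h) \<longleftrightarrow> fst l < d \<and> tword d h"
  "tword d (v @ h) \<longleftrightarrow> tword d v \<and> tword d h" "tword d (winv h) \<longleftrightarrow> tword d h"
  by (auto simp: tword_def)

definition inl :: "nat word \<Rightarrow> (nat + 'k) word" where
  "inl = map (\<lambda>(i, b). (Inl i, b))"

lemma inl_simps [simp]:
  "inl [] = []" "inl ((i, b) # h) = (Inl i, b) # inl h" "inl (v @ h) = inl v @ inl h"
  by (simp_all add: inl_def)

lemma ev_inl: "ev e (inl h) = ev (\<lambda>i. e (Inl i)) h"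
  by (induction h) (auto simp: lval_def)

lemma uvec_Inl: "uvec d (Inl i) = tvec d i"
  by (simp add: uvec_def tvec_def)

lemma uvec_Inr: "uvec d (Inr k) = 0"
  by (simp add: uvec_def)

lemma lwt_Inl: "lwt d (Inl i, b) = lval (tvec d) (i, b)"
  by (simp add: lval_def uvec_Inl)

lemma wt_inl: "wt d (inl h) = twt d h"
  by (simp add: ev_inl uvec_Inl)

lemma supp_tvec [simp]: "supp d (lval (tvec d) l)" "supp d (twt d h)"
  using supp_lwt[of d "(Inl (fst l), snd l)"] supp_wt[of d "inl h"] by (simp_all add: lwt_Inl wt_inl)

primrec abv :: "nat \<Rightarrow> (nat \<Rightarrow> real) \<Rightarrow> real \<Rightarrow> (nat \<Rightarrow> int) \<Rightarrow> nat word \<Rightarrow> bool" where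
  "abv d u c p [] \<longleftrightarrow> c \<le> hgt d u p"
| "abv d u c p (l # w) \<longleftrightarrow> c \<le> hgt d u p \<and> abv d u c (p + lval (tvec d) l) w"

lemma abv_start: "abv d u c p w \<Longrightarrow> c \<le> hgt d u p"
  by (cases w) auto

lemma abv_append: "abv d u c p (v @ w) \<longleftrightarrow> abv d u c p v \<and> abv d u c (p + twt d v) w"
  by (induction v arbitrary: p) (auto simp: add.assoc dest: abv_start)

lemma abv_end: "abv d u c p w \<Longrightarrow> c \<le> hgt d u (p + twt d w)"
  using abv_append[of d u c p w "[]"] by simp

text \<open>An entry is a letter conjugated by a word in the lifts. Lifts and letters are parameters
  because the same list is evaluated in the given group, in each of the two copies and in the
  permutation action.\<close>

definition lv :: "(nat \<Rightarrow> 'h::group_add) \<Rightarrow> ('k \<Rightarrow> 'h) \<Rightarrow> (nat word \<times> 'k \<times> bool) list \<Rightarrow> 'h" where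
  "lv T \<alpha> L = sum_list (map (\<lambda>(P, k). ev T P + lval \<alpha> k - ev T P) L)"

lemma lv_simps [simp]:
  "lv T \<alpha> [] = 0" "lv T \<alpha> ((P, k) # L) = ev T P + lval \<alpha> k - ev T P + lv T \<alpha> L"
  "lv T \<alpha> (L @ L') = lv T \<alpha> L + lv T \<alpha> L'"
  by (simp_all add: lv_def)

definition shift :: "nat word \<Rightarrow> (nat word \<times> 'k) list \<Rightarrow> (nat word \<times> 'k) list" where
  "shift h = map (\<lambda>(P, k). (h @ P, k))"

lemma shift_simps [simp]:
  "shift h [] = []" "shift h ((P, k) # L) = (h @ P, k) # shift h L"
  "shift h (L @ L') = shift h L @ shift h L'"
  by (simp_all add: shift_def)

lemma lv_shift: "lv T \<alpha> (shift h L) = ev T h + lv T \<alpha> L - ev T h"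
  by (induction L) (auto simp: diff_conv_add_uminus minus_add add.assoc simp del: add_uminus_conv_diff)

definition lneg :: "(nat word \<times> 'k \<times> bool) list \<Rightarrow> (nat word \<times> 'k \<times> bool) list" where
  "lneg L = rev (map (\<lambda>(P, k). (P, inv_letter k)) L)"

lemma lneg_simps [simp]: "lneg [] = []" "lneg ((P, k) # L) = lneg L @ [(P, inv_letter k)]"
  by (simp_all add: lneg_def)

lemma lv_lneg: "lv T \<alpha> (lneg L) = - lv T \<alpha> L"
  by (induction L) (auto simp: diff_conv_add_uminus minus_add add.assoc simp del: add_uminus_conv_diff)

text \<open>The recursion is the identity [x, y h] = [x, y] y [x, h] y^-1.\<close>

primrec comm_list :: "(nat \<times> bool \<Rightarrow> nat \<times> bool \<Rightarrow> 'k) \<Rightarrow> nat \<times> bool \<Rightarrow> nat word \<Rightarrow> (nat word \<times> 'k \<times> bool) list" where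
  "comm_list c x [] = []"
| "comm_list c x (y # h) = ([], (c x y, True)) # shift [y] (comm_list c x h)"

definition entries_ok :: "nat \<Rightarrow> (nat \<Rightarrow> real) \<Rightarrow> real \<Rightarrow> 'k set \<Rightarrow> (nat \<Rightarrow> int) \<Rightarrow> (nat word \<times> 'k \<times> bool) list \<Rightarrow> bool" where
  "entries_ok d u c0 A p L \<longleftrightarrow> (\<forall>(P, k)\<in>set L. tword d P \<and> fst k \<in> A \<and> abv d u c0 p P)"

lemma entries_ok_simps [simp]:
  "entries_ok d u c0 A p []"
  "entries_ok d u c0 A p ((P, k) # L) \<longleftrightarrow> tword d P \<and> fst k \<in> A \<and> abv d u c0 p P \<and> entries_ok d u c0 A p L"
  "entries_ok d u c0 A p (L @ L') \<longleftrightarrow> entries_ok d u c0 A p L \<and> entries_ok d u c0 A p L'"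
  by (auto simp: entries_ok_def)

lemma entries_ok_lneg [simp]: "entries_ok d u c0 A p (lneg L) \<longleftrightarrow> entries_ok d u c0 A p L"
  by (induction L) auto

lemma entries_ok_shift:
  "tword d h \<Longrightarrow> abv d u c0 p h \<Longrightarrow> entries_ok d u c0 A (p + twt d h) L \<Longrightarrow> entries_ok d u c0 A p (shift h L)"
  by (induction L) (auto simp: abv_append)

text \<open>At slope 0 positive letters count as up and negative ones as down, so that for every
  \<open>u\<close> exactly one of a letter and its inverse is up.\<close>

definition up :: "(nat \<Rightarrow> real) \<Rightarrow> nat \<times> bool \<Rightarrow> bool" where
  "up u x \<longleftrightarrow> (if snd x then 0 \<le> u (fst x) else u (fst x) < 0)"

lemma hgt_tvec: "i < d \<Longrightarrow> hgt d u (lval (tvec d) (i, b)) = (if b then u i else - u i)"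
  using hgt_unit[of i d u b] by (simp add: lwt_Inl del: lval_Pair)

lemma hgt_up: "fst x < d \<Longrightarrow> up u x \<Longrightarrow> 0 \<le> hgt d u (lval (tvec d) x)"
  and hgt_down: "fst x < d \<Longrightarrow> \<not> up u x \<Longrightarrow> hgt d u (lval (tvec d) x) \<le> 0"
  using hgt_tvec[of "fst x" d u "snd x"] by (auto simp: up_def split: if_splits)

lemma abv_ups: "tword d h \<Longrightarrow> \<forall>x\<in>set h. up u x \<Longrightarrow> c \<le> hgt d u p \<Longrightarrow> abv d u c p h"
proof (induction h arbitrary: p)
  case (Cons x h)
  then show ?case using hgt_up[of x d u] by (auto simp: hgt_add intro!: Cons.IH)
qed simp

lemma abv_downs: "tword d h \<Longrightarrow> \<forall>x\<in>set h. \<not> up u x \<Longrightarrow> c \<le> hgt d u (p + twt d h) \<Longrightarrow> abv d u c p h"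
proof (induction h arbitrary: p)
  case (Cons x h)
  then have *: "abv d u c (p + lval (tvec d) x) h" by (simp add: add.assoc)
  then show ?case using hgt_down[of x d u] abv_start[OF *] Cons.prems by (simp add: hgt_add)
qed simp

text \<open>Letters of one kind, up or down, have only one sign in each coordinate. So nothing
  cancels, and the weight shows which coordinates occur.\<close>

lemma twt_same_sign:
  assumes "tword d h" "\<forall>x\<in>set h. up u x = s"
  shows "if up u (i, True) = s then twt d h i \<ge> 0 \<and> ((i, True) \<in> set h \<longrightarrow> twt d h i > 0)
    else twt d h i \<le> 0 \<and> ((i, False) \<in> set h \<longrightarrow> twt d h i < 0)"
  using assms
proof (induction h)
  case Nil
  then show ?case by (simp add: zero_fun_apply)
next
  case (Cons x h)
  obtain j b where x: "x = (j, b)" by (cases x)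
  have ud: "up u (j, False) \<longleftrightarrow> \<not> up u (j, True)" by (auto simp: up_def)
  have "lval (tvec d) x i = (if i = j then (if b then 1 else -1) else 0)"
    using Cons.prems by (auto simp: x lval_def tvec_def)
  then show ?case using Cons ud
    by (cases b) (auto simp: x plus_fun_apply split: if_splits)
qed

text \<open>Isolates what the rewriting uses, so that it applies to the given group, to the
  universal group on the commutator relators and to the action \<open>actE\<close>.\<close>

locale commuting_lifts =
  fixes d :: nat and A :: "'k set" and c :: "nat \<times> bool \<Rightarrow> nat \<times> bool \<Rightarrow> 'k" and e :: "nat + 'k \<Rightarrow> 'h::group_add"
  assumes c_A: "\<And>x y. fst x < d \<Longrightarrow> fst y < d \<Longrightarrow> c x y \<in> A"
    and e_comm: "\<And>x y. fst x < d \<Longrightarrow> fst y < d \<Longrightarrow>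
      lval (\<lambda>i. e (Inl i)) x + lval (\<lambda>i. e (Inl i)) y - lval (\<lambda>i. e (Inl i)) x - lval (\<lambda>i. e (Inl i)) y = e (Inr (c x y))"
    and e_out: "\<And>y. y \<notin> alph d A \<Longrightarrow> e y = 0"
begin

abbreviation "T \<equiv> \<lambda>i. e (Inl i)"
abbreviation "\<alpha> \<equiv> \<lambda>k. e (Inr k)"

lemma lv_comm_list:
  assumes "fst x < d" "tword d h"
  shows "lval T x + ev T h = lv T \<alpha> (comm_list c x h) + ev T h + lval T x"
  using assms(2)
proof (induction h)
  case (Cons y h)
  have "lval T x + ev T (y # h) = \<alpha> (c x y) + lval T y + lval T x + ev T h"
    using e_comm[OF assms(1), of y] Cons.prems
    by (simp add: diff_conv_add_uminus add.assoc flip: e_comm[OF assms(1)] del: add_uminus_conv_diff)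
  also have "\<dots> = \<alpha> (c x y) + lval T y + (lv T \<alpha> (comm_list c x h) + ev T h + lval T x)"
    using Cons by (simp add: add.assoc)
  finally show ?case by (simp add: lv_shift diff_conv_add_uminus add.assoc del: add_uminus_conv_diff)
qed simp

lemma entries_ok_comm_list:
  "fst x < d \<Longrightarrow> tword d h \<Longrightarrow> abv d u c0 p h \<Longrightarrow> entries_ok d u c0 A p (comm_list c x h)"
proof (induction h arbitrary: p)
  case (Cons y h)
  then show ?case
    using abv_start[of d u c0 "p + lval (tvec d) y" h]
    by (auto simp: c_A intro!: entries_ok_shift)
qed simp

text \<open>A kernel letter pulled to the front is conjugated by the lifts it passes. These trace
  the path of \<open>w\<close>, since kernel letters do not move the point.\<close>

lemma split_off_kernel_letters:
  "above d u c0 p w \<Longrightarrow> \<exists>L h. tword d h \<and> twt d h = wt d w \<and> abv d u c0 p h \<and>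
     ev e w = lv T \<alpha> L + ev T h \<and> entries_ok d u c0 A p L"
proof (induction w arbitrary: p)
  case Nil
  then show ?case by (intro exI[of _ "[]"]) simp
next
  case (Cons l w)
  then obtain L h where Lh: "tword d h" "twt d h = wt d w" "abv d u c0 (p + lwt d l) h"
    "ev e w = lv T \<alpha> L + ev T h" "entries_ok d u c0 A (p + lwt d l) L"
    using Cons.IH[of "p + lwt d l"] by (metis above.simps(2))
  have cp: "c0 \<le> hgt d u p" using Cons.prems by simp
  consider i b where "l = (Inl i, b)" "i < d" | k b where "l = (Inr k, b)" "k \<in> A"
    | "lwt d l = 0" "lval e l = 0"
  proof (cases l)
    case (Pair y b)
    show ?thesis
    proof (cases "y \<in> alph d A")
      case True
      then show ?thesis using that Pair by (auto simp: alph_def)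
    next
      case False
      have "lwt d l = 0" using False Pair by (cases y) (auto simp: alph_def lval_def uvec_def)
      then show ?thesis using that(3) e_out[OF False] Pair by (simp add: lval_def)
    qed
  qed
  then show ?case
  proof cases
    case 1
    then have "entries_ok d u c0 A p (shift [(i, b)] L)" using Lh cp
      by (intro entries_ok_shift) (auto simp: lwt_Inl dest: abv_start simp del: lval_Pair)
    moreover have "lval e l = lval T (i, b)" using 1 by (simp add: lval_def)
    ultimately show ?thesis using 1 Lh cp
      by (intro exI[of _ "shift [(i, b)] L"] exI[of _ "(i, b) # h"])
        (simp add: lv_shift lwt_Inl diff_conv_add_uminus add.assoc del: add_uminus_conv_diff lval_Pair)
  next
    case 2
    have "lwt d l = 0" "lval e l = lval \<alpha> (k, b)" using 2 by (simp_all add: lval_def uvec_Inr)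
    then show ?thesis using 2 Lh cp
      by (intro exI[of _ "([], (k, b)) # L"] exI[of _ h]) (simp add: add.assoc)
  next
    case 3
    then show ?thesis using Lh by (intro exI[of _ L] exI[of _ h]) simp
  qed
qed

text \<open>When a down letter passes a word of up letters, the conjugators are prefixes of that
  word read from \<open>p\<close>, and these never fall below the height of
  \<open>p\<close>.\<close>

lemma sort_ups_downs:
  "tword d h \<Longrightarrow> abv d u c0 p h \<Longrightarrow> \<exists>L U D. tword d U \<and> tword d D \<and> (\<forall>x\<in>set U. up u x) \<and> (\<forall>x\<in>set D. \<not> up u x) \<and>
     twt d h = twt d U + twt d D \<and> abv d u c0 p (U @ D) \<and>
     ev T h = lv T \<alpha> L + ev T U + ev T D \<and> entries_ok d u c0 A p L"
proof (induction h arbitrary: p)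
  case Nil
  then show ?case by (intro exI[of _ "[]"]) simp
next
  case (Cons x h)
  then obtain L U D where IH: "tword d U" "tword d D" "\<forall>x\<in>set U. up u x" "\<forall>x\<in>set D. \<not> up u x"
    "twt d h = twt d U + twt d D" "abv d u c0 (p + lval (tvec d) x) (U @ D)"
    "ev T h = lv T \<alpha> L + ev T U + ev T D" "entries_ok d u c0 A (p + lval (tvec d) x) L"
    by fastforce
  have x: "fst x < d" and cp: "c0 \<le> hgt d u p" "c0 \<le> hgt d u (p + lval (tvec d) x)"
    using Cons.prems by (auto dest: abv_start)
  have sh: "entries_ok d u c0 A p (shift [x] L)" using IH x cp by (intro entries_ok_shift) auto
  show ?case
  proof (cases "up u x")
    case True
    then show ?thesis using IH x cp sh
      by (intro exI[of _ "shift [x] L"] exI[of _ "x # U"] exI[of _ D])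
        (simp add: lv_shift diff_conv_add_uminus add.assoc del: add_uminus_conv_diff)
  next
    case False
    have U: "abv d u c0 p U" using IH cp by (intro abv_ups) auto
    have "ev T (x # h) = lv T \<alpha> (shift [x] L) + (lval T x + ev T U) + ev T D"
      by (simp add: IH lv_shift diff_conv_add_uminus add.assoc del: add_uminus_conv_diff)
    also have "\<dots> = lv T \<alpha> (shift [x] L @ comm_list c x U) + ev T U + ev T (x # D)"
      by (simp add: lv_comm_list[OF x IH(1)] add.assoc)
    finally have "ev T (x # h) = \<dots>" .
    moreover have "abv d u c0 p (U @ x # D)"
      using IH(6) U abv_end[OF U] by (simp add: abv_append ac_simps)
    moreover have "entries_ok d u c0 A p (comm_list c x U)" by (rule entries_ok_comm_list[OF x IH(1) U])
    ultimately show ?thesis using IH x cp sh False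
      by (intro exI[of _ "shift [x] L @ comm_list c x U"] exI[of _ U] exI[of _ "x # D"]) (simp add: ac_simps)
  qed
qed

text \<open>Weight 0 forces the inverse of the last up letter to occur among the downs. Bringing it
  forward passes only downs, whose path descends to the height of \<open>p\<close> and no further,
  so all conjugators stay above \<open>c0\<close>.\<close>

lemma cancel_ups_downs:
  "tword d U \<Longrightarrow> tword d D \<Longrightarrow> (\<forall>x\<in>set U. up u x) \<Longrightarrow> (\<forall>x\<in>set D. \<not> up u x) \<Longrightarrow>
   twt d U + twt d D = 0 \<Longrightarrow> c0 \<le> hgt d u p \<Longrightarrow>
   \<exists>L. ev T U + ev T D = lv T \<alpha> L \<and> entries_ok d u c0 A p L"
proof (induction U arbitrary: D rule: rev_induct)
  case Nil
  have "D = []"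
  proof (rule ccontr)
    assume "D \<noteq> []"
    then obtain i b where "(i, b) \<in> set D" by (cases D) auto
    moreover have "twt d D i = 0" using Nil by (simp add: zero_fun_apply)
    moreover have "up u (i, False) \<longleftrightarrow> \<not> up u (i, True)" by (auto simp: up_def)
    ultimately show False using twt_same_sign[of d D u False i] Nil by (cases b) (auto split: if_splits)
  qed
  then show ?case by (intro exI[of _ "[]"]) simp
next
  case (snoc y U)
  obtain i b where y: "y = (i, b)" by (cases y)
  have flip: "up u (i, False) \<longleftrightarrow> \<not> up u (i, True)" by (auto simp: up_def)
  have "inv_letter y \<in> set D"
  proof (rule ccontr)
    assume notin: "inv_letter y \<notin> set D"
    have sum: "twt d (U @ [y]) i + twt d D i = 0"
      using snoc.prems(5) by (metis plus_fun_apply zero_fun_apply)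
    have "(i, c) \<notin> set D" for c
      using notin snoc.prems(3,4) flip by (cases b; cases c) (auto simp: y inv_letter_def)
    then have "twt d D i = 0"
    proof (induction D)
      case (Cons z D)
      then have "lval (tvec d) z i = 0" by (cases z) (auto simp: lval_def tvec_def zero_fun_apply)
      then show ?case using Cons by (simp add: plus_fun_apply)
    qed (simp add: zero_fun_apply)
    moreover have "twt d (U @ [y]) i \<noteq> 0"
      using twt_same_sign[of d "U @ [y]" u True i] snoc.prems(1,3) flip by (cases b) (auto simp: y split: if_splits)
    ultimately show False using sum by simp
  qed
  then obtain D1 D2 where D: "D = D1 @ inv_letter y # D2" by (meson split_list)
  have yd: "fst (inv_letter y) < d" using snoc.prems(1) by (simp add: inv_letter_def)
  define L1 where "L1 = lneg (comm_list c (inv_letter y) D1)"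
  have tw: "tword d D1" "tword d D2" using snoc.prems(2) by (simp_all add: D)
  have w0: "twt d U + twt d (D1 @ D2) = 0"
    using snoc.prems(5) by (simp add: D ac_simps)
  have "ev T D1 - lval T y = lv T \<alpha> L1 + (lval T (inv_letter y) + ev T D1)"
    using lv_comm_list[OF yd tw(1)] by (simp add: L1_def lv_lneg algebra_simps)
  then have "ev T (U @ [y]) + ev T D = ev T (U @ [y]) + (lv T \<alpha> L1 + (lval T (inv_letter y) + ev T D1)) + ev T D2"
    by (simp add: D diff_conv_add_uminus add.assoc del: add_uminus_conv_diff) (simp flip: add.assoc)
  also have "\<dots> = lv T \<alpha> (shift (U @ [y]) L1) + (ev T U + ev T (D1 @ D2))"
    by (simp add: lv_shift diff_conv_add_uminus add.assoc minus_add del: add_uminus_conv_diff)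
  finally have eq: "ev T (U @ [y]) + ev T D = \<dots>" .
  obtain L where L: "ev T U + ev T (D1 @ D2) = lv T \<alpha> L" "entries_ok d u c0 A p L"
    using snoc.IH[of "D1 @ D2"] snoc.prems w0 by (auto simp: D)
  have Uy: "abv d u c0 p (U @ [y])" using snoc.prems by (intro abv_ups) auto
  have "abv d u c0 (p + twt d (U @ [y])) D"
    using snoc.prems by (intro abv_downs) (auto simp: add.assoc)
  then have "entries_ok d u c0 A (p + twt d (U @ [y])) L1"
    unfolding L1_def entries_ok_lneg using tw yd
    by (intro entries_ok_comm_list) (simp_all add: D abv_append)
  then have "entries_ok d u c0 A p (shift (U @ [y]) L1)"
    using snoc.prems Uy by (intro entries_ok_shift) auto
  then show ?case using eq L by (intro exI[of _ "shift (U @ [y]) L1 @ L"]) simp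
qed

lemma closed_word_as_conjugates:
  assumes "above d u c0 0 w" "wt d w = 0"
  shows "\<exists>L. ev e w = lv T \<alpha> L \<and> entries_ok d u c0 A 0 L"
proof -
  obtain L h where Lh: "tword d h" "twt d h = wt d w" "abv d u c0 0 h"
    "ev e w = lv T \<alpha> L + ev T h" "entries_ok d u c0 A 0 L"
    using split_off_kernel_letters[OF assms(1)] by blast
  obtain L' U D where UD: "tword d U" "tword d D" "\<forall>x\<in>set U. up u x" "\<forall>x\<in>set D. \<not> up u x"
    "twt d h = twt d U + twt d D" "abv d u c0 0 (U @ D)"
    "ev T h = lv T \<alpha> L' + ev T U + ev T D" "entries_ok d u c0 A 0 L'"
    using sort_ups_downs[OF Lh(1,3)] by blast
  obtain L'' where "ev T U + ev T D = lv T \<alpha> L''" "entries_ok d u c0 A 0 L''"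
    using cancel_ups_downs[OF UD(1-4), of c0 0] UD Lh(2) assms(2) abv_start[OF UD(6)] by auto
  then show ?thesis using Lh UD
    by (intro exI[of _ "L @ L' @ L''"]) (simp add: add.assoc)
qed

end

definition lword :: "(nat word \<times> 'k \<times> bool) list \<Rightarrow> (nat + 'k) word" where
  "lword L = concat (map (\<lambda>(P, k, b). inl P @ [(Inr k, b)] @ winv (inl P)) L)"

lemma ev_lword: "ev e (lword L) = lv (\<lambda>i. e (Inl i)) (\<lambda>k. e (Inr k)) L"
  by (induction L) (auto simp: lword_def ev_inl lval_def algebra_simps)

definition comm_relators :: "nat \<Rightarrow> (nat \<times> bool \<Rightarrow> nat \<times> bool \<Rightarrow> 'k) \<Rightarrow> (nat + 'k) word set" where
  "comm_relators d c = {inl [x, y, inv_letter x, inv_letter y] @ [(Inr (c x y), False)] | x y. fst x < d \<and> fst y < d}"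

text \<open>The same rewriting is valid in every group with the given commutators, so it may be
  carried out in the universal one.\<close>

lemma closed_word_eqv_conjugates:
  assumes c_A: "\<And>x y. fst x < d \<Longrightarrow> fst y < d \<Longrightarrow> c x y \<in> A"
    and w: "above d u c0 0 w" "wt d w = 0"
  obtains L where "eqv (alph d A) (comm_relators d c) w (lword L)" "entries_ok d u c0 A 0 L"
proof -
  obtain e :: "nat + 'a \<Rightarrow> (nat + 'a) word sym" where
    e: "\<And>w. ev e w = 0 \<longleftrightarrow> eqv (alph d A) (comm_relators d c) w []"
    using universal_group by blast
  interpret commuting_lifts d A c e
  proof
    fix x y :: "nat \<times> bool" assume xy: "fst x < d" "fst y < d"
    then have "inl [x, y, inv_letter x, inv_letter y] @ [(Inr (c x y), False)] \<in> comm_relators d c"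
      unfolding comm_relators_def by blast
    from eqv.relator[OF this, of "alph d A" "[]" "[]"] have
      "ev e (inl [x, y, inv_letter x, inv_letter y] @ [(Inr (c x y), False)]) = 0" by (simp only: e append_Nil append_Nil2)
    then have "ev e (inl [x, y, inv_letter x, inv_letter y]) = e (Inr (c x y))" by (simp add: add_eq_0_iff)
    then show "lval (\<lambda>i. e (Inl i)) x + lval (\<lambda>i. e (Inl i)) y - lval (\<lambda>i. e (Inl i)) x - lval (\<lambda>i. e (Inl i)) y = e (Inr (c x y))"
      unfolding ev_inl by (simp add: diff_conv_add_uminus add.assoc del: add_uminus_conv_diff)
  next
    fix y assume "y \<notin> alph d A"
    then have "eqv (alph d A) (comm_relators d c) ([] @ (y, True) # []) ([] @ [])" by (intro eqv.outside) simp
    then show "e y = 0" using e[of "[(y, True)]"] by simp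
  qed (rule c_A)
  obtain L where L: "ev e w = lv T \<alpha> L" "entries_ok d u c0 A 0 L"
    using closed_word_as_conjugates[OF w] by blast
  have "ev e (w @ winv (lword L)) = 0" using L(1) by (simp add: ev_lword)
  then have "eqv (alph d A) (comm_relators d c) w (lword L)" by (simp only: e eqv_iff_Nil[of _ _ w])
  then show ?thesis using L(2) that by blast
qed

section \<open>Contractions of the kernel\<close>

lemma twt_replicate: "i < d \<Longrightarrow> twt d (replicate n (i, b)) j = (if j = i then (if b then int n else - int n) else 0)"
  by (induction n) (auto simp: plus_fun_apply zero_fun_apply lval_def tvec_def)

definition nrm :: "nat \<Rightarrow> (nat \<Rightarrow> int) \<Rightarrow> int" where
  "nrm d p = (\<Sum>i<d. (p i)\<^sup>2)"

definition ip :: "nat \<Rightarrow> (nat \<Rightarrow> int) \<Rightarrow> (nat \<Rightarrow> int) \<Rightarrow> int" where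
  "ip d p q = (\<Sum>i<d. p i * q i)"

text \<open>The inner product is \<open>s n\<close> times a quantity that tends to
  \<open>hgt d u p\<close>, a positive number.\<close>

lemma ip_tendsto_at_top:
  assumes lim: "\<And>i. i < d \<Longrightarrow> (\<lambda>n. real_of_int (q n i) / s n) \<longlonglongrightarrow> u i"
    and s: "filterlim s at_top sequentially" and pos: "0 < hgt d u p"
  shows "eventually (\<lambda>n. C < ip d (q n) p) sequentially"
proof -
  have "(\<lambda>n. \<Sum>i<d. (real_of_int (q n i) / s n) * real_of_int (p i)) \<longlonglongrightarrow> hgt d u p"
    unfolding hgt_def using lim by (intro tendsto_sum tendsto_mult tendsto_const) auto
  from filterlim_tendsto_pos_mult_at_top[OF this pos s]
  have "eventually (\<lambda>n. real_of_int C < (\<Sum>i<d. (real_of_int (q n i) / s n) * real_of_int (p i)) * s n) sequentially"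
    by (simp add: filterlim_at_top_dense)
  moreover have "eventually (\<lambda>n. 0 < s n) sequentially"
    using s by (simp add: filterlim_at_top_dense)
  ultimately show ?thesis
  proof eventually_elim
    case (elim n)
    have "(\<Sum>i<d. (real_of_int (q n i) / s n) * real_of_int (p i)) * s n = real_of_int (ip d (q n) p)"
      using elim(2) by (simp add: sum_distrib_right ip_def)
    then show ?case using elim(1) by linarith
  qed
qed

context zd_extension
begin

definition cm :: "nat \<times> bool \<Rightarrow> nat \<times> bool \<Rightarrow> 'g" where
  "cm x y = lval t x + lval t y - lval t x - lval t y"

definition tG :: "nat \<Rightarrow> 'g" where "tG i = gen d t A (Inl i)"
definition aG :: "'g \<Rightarrow> 'g" where "aG k = gen d t A (Inr k)"

lemma aG_in [simp]: "k \<in> A \<Longrightarrow> aG k = k"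
  by (simp add: aG_def gen_def)

lemma lval_tG: "fst x < d \<Longrightarrow> lval tG x = lval t x"
  by (simp add: lval_def tG_def gen_def)

lemma cm_A: "fst x < d \<Longrightarrow> fst y < d \<Longrightarrow> cm x y \<in> A"
  by (simp add: cm_def comm)

lemma finite_A: "finite A"
  using presentsD(1)[OF pres] by (auto simp: alph_def dest: finite_imageD)

sublocale G: commuting_lifts d A cm "gen d t A"
proof
  fix x y :: "nat \<times> bool" assume xy: "fst x < d" "fst y < d"
  then have "gen d t A (Inr (cm x y)) = cm x y" using cm_A by (simp add: gen_def)
  then show "lval (\<lambda>i. gen d t A (Inl i)) x + lval (\<lambda>i. gen d t A (Inl i)) y
      - lval (\<lambda>i. gen d t A (Inl i)) x - lval (\<lambda>i. gen d t A (Inl i)) y = gen d t A (Inr (cm x y))"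
    using xy lval_tG by (simp add: cm_def tG_def[abs_def])
next
  fix y :: "nat + 'g" assume "y \<notin> alph d A"
  then show "gen d t A y = 0" using presentsD(6)[OF pres] by blast
qed (rule cm_A)

abbreviation lvG :: "(nat word \<times> 'g \<times> bool) list \<Rightarrow> 'g" where
  "lvG \<equiv> lv tG aG"

lemma evG_lword: "evG (lword L) = lvG L"
  by (simp add: ev_lword tG_def[abs_def] aG_def[abs_def])

lemma evG_inl: "evG (inl h) = ev tG h"
  by (simp add: ev_inl tG_def[abs_def])

text \<open>The inequality says that the points \<open>y\<close> on the contracted paths satisfy \<open>\<bar>q - y\<bar>\<^sup>2 + 4 d K\<^sup>2 < \<bar>q\<bar>\<^sup>2\<close>;
  the margin absorbs detours of length at most \<open>K\<close> from a monotone path.\<close>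

definition contracts :: "nat \<Rightarrow> (nat \<Rightarrow> int) \<Rightarrow> bool" where
  "contracts M q \<longleftrightarrow> (\<exists>i<d. \<exists>b H K L. H \<le> M \<and> K \<le> M \<and> int H \<le> (if b then q i else - q i) \<and>
     (\<forall>k\<in>A. lvG (L k) = - ev tG (replicate H (i, b)) + k + ev tG (replicate H (i, b)) \<and> length (L k) \<le> M \<and>
        (\<forall>(P, l)\<in>set (L k). tword d P \<and> fst l \<in> A \<and> length P \<le> K \<and>
          (\<forall>P1 P2. P = P1 @ P2 \<longrightarrow>
             nrm d (twt d (replicate H (i, b) @ P1)) + 4 * int d * (int K)\<^sup>2
               < 2 * ip d q (twt d (replicate H (i, b) @ P1))))))"

lemma contracts_mono: "contracts M q \<Longrightarrow> M \<le> M' \<Longrightarrow> contracts M' q"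
  unfolding contracts_def by (meson order_trans)

text \<open>Conjugation by a power of a lift that climbs in direction \<open>u\<close> moves the
  half space from height \<open>c\<close> to positive heights. The contracted paths meet only
  finitely many points, all of positive height, and the inner product of \<open>q n\<close> with
  each of them outgrows any bound.\<close>

lemma eventually_contracts:
  assumes half: "Nker \<subseteq> Nge u c" and i0: "i0 < d" "u i0 \<noteq> 0"
    and lim: "\<And>i. i < d \<Longrightarrow> (\<lambda>n. real_of_int (q n i) / s n) \<longlonglongrightarrow> u i"
    and s: "filterlim s at_top sequentially"
  shows "\<exists>M. eventually (\<lambda>n. contracts M (q n)) sequentially"
proof -
  define b where "b = (0 < u i0)"
  \<comment> \<open>\<open>H\<close> steps climb by more than \<open>- c\<close>, so every point of
    height at least \<open>c\<close> is moved to positive height.\<close>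
  define H where "H = nat (\<lceil>\<bar>c\<bar> / \<bar>u i0\<bar>\<rceil> + 1)"
  have H: "- c < real H * \<bar>u i0\<bar>"
  proof -
    have "\<bar>c\<bar> / \<bar>u i0\<bar> < real H" unfolding H_def by linarith
    then have "\<bar>c\<bar> < real H * \<bar>u i0\<bar>" using i0(2) by (simp add: divide_less_eq)
    then show ?thesis by linarith
  qed
  define z where "z = replicate H (i0, b)"
  have hz: "hgt d u (twt d z) = real H * \<bar>u i0\<bar>"
  proof -
    have "hgt d u (twt d z) = (\<Sum>j<d. if j = i0 then u i0 * (if b then real H else - real H) else 0)"
      unfolding hgt_def using i0(1) by (intro sum.cong) (auto simp: z_def twt_replicate)
    then show ?thesis using i0 by (auto simp: b_def)
  qed
  have "\<exists>L. lvG L = - ev tG z + k + ev tG z \<and> entries_ok d u c A 0 L" if k: "k \<in> A" for k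
  proof -
    define w0 where "w0 = winv (inl z) @ [(Inr k, True)] @ inl z"
    have w0: "- ev tG z + k + ev tG z = evG w0" "wt d w0 = 0"
      using k by (simp_all add: w0_def evG_inl gen_def add.assoc uvec_Inr)
    then have "- ev tG z + k + ev tG z \<in> Nker" unfolding Nker_def by blast
    then have "- ev tG z + k + ev tG z \<in> Nge u c" using half by (rule rev_subsetD)
    then obtain w where w: "- ev tG z + k + ev tG z = evG w" "wt d w = 0" "above d u c 0 w"
      by (auto simp: Nge_def)
    from G.closed_word_as_conjugates[OF w(3,2)] w(1) show ?thesis
      by (auto simp: tG_def[abs_def] aG_def[abs_def])
  qed
  then obtain L where L: "lvG (L k) = - ev tG z + k + ev tG z" "entries_ok d u c A 0 (L k)" if "k \<in> A" for k
    by metis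
  define E where "E = (\<Union>k\<in>A. fst ` set (L k))"
  have E: "finite E" using finite_A by (simp add: E_def)
  define K where "K = sum length E"
  have K: "length P \<le> K" if "P \<in> E" for P
    unfolding K_def using E that by (intro member_le_sum) auto
  define M where "M = H + K + (\<Sum>k\<in>A. length (L k))"
  have LM: "length (L k) \<le> M" if "k \<in> A" for k
    using member_le_sum[of k A "\<lambda>k. length (L k)"] that finite_A by (simp add: M_def)
  define Q where "Q = (\<lambda>(P, n). twt d (z @ take n P)) ` (E \<times> {..K})"
  have Q: "finite Q" using E by (simp add: Q_def)
  have Q_pos: "0 < hgt d u p" if p: "p \<in> Q" for p
  proof -
    obtain P n where P: "P \<in> E" "p = twt d (z @ take n P)" using p by (auto simp: Q_def)
    then obtain k l where "k \<in> A" "(P, l) \<in> set (L k)" by (auto simp: E_def)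
    then have "abv d u c 0 (take n P @ drop n P)" using L(2) by (auto simp: entries_ok_def)
    then have "c \<le> hgt d u (0 + twt d (take n P))" unfolding abv_append using abv_end by blast
    then show ?thesis using H by (simp add: P(2) hgt_add hz)
  qed
  have ev1: "eventually (\<lambda>n. \<forall>p\<in>Q. nrm d p + 4 * int d * (int K)\<^sup>2 < 2 * ip d (q n) p) sequentially"
  proof (rule eventually_ball_finite[OF Q], rule ballI)
    fix p assume "p \<in> Q"
    have "eventually (\<lambda>n. \<bar>nrm d p + 4 * int d * (int K)\<^sup>2\<bar> < ip d (q n) p) sequentially"
      by (rule ip_tendsto_at_top[OF lim s Q_pos[OF \<open>p \<in> Q\<close>]])
    then show "eventually (\<lambda>n. nrm d p + 4 * int d * (int K)\<^sup>2 < 2 * ip d (q n) p) sequentially"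
      by eventually_elim linarith
  qed
  define p0 where "p0 = lval (tvec d) (i0, b)"
  have "hgt d u p0 = \<bar>u i0\<bar>" using i0 hgt_tvec[of i0 d u b] by (simp add: p0_def b_def del: lval_Pair)
  then have "eventually (\<lambda>n. int H < ip d (q n) p0) sequentially"
    using i0 by (intro ip_tendsto_at_top[OF lim s]) simp_all
  moreover have "ip d (q n) p0 = (if b then q n i0 else - q n i0)" for n
  proof -
    have "ip d (q n) p0 = (\<Sum>j<d. if j = i0 then (if b then q n i0 else - q n i0) else 0)"
      unfolding ip_def using i0(1) by (intro sum.cong) (auto simp: p0_def lval_def tvec_def)
    then show ?thesis using i0(1) by simp
  qed
  ultimately have "eventually (\<lambda>n. int H < (if b then q n i0 else - q n i0)) sequentially" by simp
  with ev1 have "eventually (\<lambda>n. contracts M (q n)) sequentially"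
  proof eventually_elim
    case (elim n)
    have "nrm d (twt d (z @ P1)) + 4 * int d * (int K)\<^sup>2 < 2 * ip d (q n) (twt d (z @ P1))"
      if "k \<in> A" "(P1 @ P2, l) \<in> set (L k)" for k P1 P2 l
    proof -
      have "P1 @ P2 \<in> E" using that by (force simp: E_def)
      moreover from K[OF this] have "length P1 \<le> K" by simp
      ultimately have "twt d (z @ take (length P1) (P1 @ P2)) \<in> Q" unfolding Q_def by force
      then show ?thesis using elim(1) by simp
    qed
    moreover have "tword d P \<and> fst l \<in> A \<and> length P \<le> K" if "k \<in> A" "(P, l) \<in> set (L k)" for k P l
      using L(2)[OF that(1)] that K[of P] by (force simp: entries_ok_def E_def)
    ultimately show ?case unfolding contracts_def using i0(1) elim(2) L(1) LM
      by (intro exI[of _ i0] conjI exI[of _ b] exI[of _ H] exI[of _ K] exI[of _ L])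
        (auto simp: M_def z_def[symmetric])
  qed
  then show ?thesis by blast
qed

theorem uniform_contraction:
  assumes nofree: "\<And>x y. x \<in> S \<Longrightarrow> y \<in> S \<Longrightarrow> \<not> free_pair x y"
  shows "\<exists>M. \<forall>q. int M \<le> nrm d q \<longrightarrow> contracts M q \<or> contracts M (- q)"
proof (rule ccontr)
  assume "\<not> ?thesis"
  \<comment> \<open>The counterexample for \<open>M\<close> has norm at least \<open>M\<close>; so
    the lengths diverge, and only the directions need a convergent subsequence.\<close>
  then obtain q where q: "int M \<le> nrm d (q M)" "\<not> contracts M (q M)" "\<not> contracts M (- q M)" for M
    by metis
  define s where "s n = sqrt (real_of_int (nrm d (q n)))" for n
  have s_ge: "sqrt (real n) \<le> s n" for n
    unfolding s_def using q(1)[of n] by (simp add: of_int_le_iff[symmetric] del: of_int_le_iff)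
  have s_lim: "filterlim s at_top sequentially"
    by (rule filterlim_at_top_mono[OF filterlim_compose[OF sqrt_at_top filterlim_real_sequentially]])
      (auto simp: s_ge)
  define x where "x n i = real_of_int (q n i) / s n" for n i
  have s2: "(s n)\<^sup>2 = (\<Sum>i<d. (real_of_int (q n i))\<^sup>2)" for n
    by (simp add: s_def nrm_def sum_nonneg)
  have x_bd: "\<bar>x n i\<bar> \<le> 1" if "i < d" for n i
  proof -
    have "(real_of_int (q n i))\<^sup>2 \<le> (s n)\<^sup>2"
      unfolding s2 using that by (intro member_le_sum) auto
    moreover have "0 \<le> s n" by (simp add: s_def nrm_def sum_nonneg)
    ultimately have "\<bar>real_of_int (q n i)\<bar> \<le> s n" by (simp add: abs_le_square_iff[symmetric])
    then show ?thesis using \<open>0 \<le> s n\<close> by (cases "s n = 0") (simp_all add: x_def abs_divide)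
  qed
  have bd: "bounded ((\<lambda>f. f i) ` range x)" if "i \<in> {..<d}" for i
    using x_bd that by (auto simp: bounded_iff intro!: exI[of _ 1])
  have "\<exists>l r. strict_mono r \<and> (\<forall>\<epsilon>>0. eventually (\<lambda>n. \<forall>i\<in>{..<d}. dist (x (r n) i) (l i) < \<epsilon>) sequentially)"
    using compact_lemma_general[of "{..<d}" "\<lambda>f i. f i" x "\<lambda>f. f", OF _ bd] by auto
  then obtain u r where r: "strict_mono (r :: nat \<Rightarrow> nat)"
    and u: "\<And>\<epsilon>. \<epsilon> > 0 \<Longrightarrow> eventually (\<lambda>n. \<forall>i\<in>{..<d}. dist (x (r n) i) (u i) < \<epsilon>) sequentially"
    by blast
  have lim: "(\<lambda>n. x (r n) i) \<longlonglongrightarrow> u i" if "i < d" for i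
  proof (rule tendstoI)
    fix \<epsilon> :: real assume "\<epsilon> > 0"
    from u[OF this] show "eventually (\<lambda>n. dist (x (r n) i) (u i) < \<epsilon>) sequentially"
      by eventually_elim (use that in auto)
  qed
  have s_r: "filterlim (\<lambda>n. s (r n)) at_top sequentially"
    by (rule filterlim_compose[OF s_lim filterlim_subseq[OF r]])
  have "(\<lambda>n. \<Sum>i<d. (x (r n) i)\<^sup>2) \<longlonglongrightarrow> (\<Sum>i<d. (u i)\<^sup>2)"
    using lim by (intro tendsto_sum tendsto_power) auto
  moreover have "eventually (\<lambda>n. (\<Sum>i<d. (x (r n) i)\<^sup>2) = 1) sequentially"
  proof -
    have "eventually (\<lambda>n. 0 < s (r n)) sequentially" using s_r by (simp add: filterlim_at_top_dense)
    then show ?thesis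
    proof eventually_elim
      case (elim n)
      have "(\<Sum>i<d. (x (r n) i)\<^sup>2) = (s (r n))\<^sup>2 / (s (r n))\<^sup>2"
        unfolding s2[of "r n"] sum_divide_distrib by (simp add: x_def power_divide s2)
      then show ?case using elim by simp
    qed
  qed
  ultimately have "(\<Sum>i<d. (u i)\<^sup>2) = 1"
    using LIMSEQ_unique[OF _ tendsto_eventually] by blast
  then have "\<exists>i<d. u i \<noteq> 0" by (intro ccontr[of "\<exists>i<d. u i \<noteq> 0"]) simp
  then obtain i0 where i0: "i0 < d" "u i0 \<noteq> 0" by blast
  \<comment> \<open>A fixed \<open>M\<close> that works along the subsequence contradicts the choice
    of \<open>q\<close>: \<open>contracts\<close> is monotone in its bound, and the indices exceed
    \<open>M\<close>.\<close>
  have contra: False if "eventually (\<lambda>n. contracts M (v (r n))) sequentially" "\<And>n. \<not> contracts n (v n)" for M v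
  proof -
    have "eventually (\<lambda>n. M \<le> n \<and> contracts M (v (r n))) sequentially"
      using that(1) eventually_ge_at_top[of M] by eventually_elim simp
    then obtain n where "M \<le> n" "contracts M (v (r n))" by (auto simp: eventually_sequentially)
    moreover have "n \<le> r n" using r by (rule seq_suble)
    ultimately show False using contracts_mono[of M "v (r n)" "r n"] that(2) by auto
  qed
  from half_space_dichotomy[OF nofree, of u] show False
  proof
    assume "\<exists>c\<le>0. Nker \<subseteq> Nge u c"
    then obtain c where "Nker \<subseteq> Nge u c" by blast
    from eventually_contracts[OF this i0 lim[unfolded x_def] s_r]
    obtain M where "eventually (\<lambda>n. contracts M (q (r n))) sequentially" by blast
    then show False using q(2) by (rule contra)
  next
    assume "\<exists>c\<le>0. Nker \<subseteq> Nge (\<lambda>i. - u i) c"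
    then obtain c where c: "Nker \<subseteq> Nge (\<lambda>i. - u i) c" by blast
    have "(\<lambda>n. real_of_int ((- q (r n)) i) / s (r n)) \<longlonglongrightarrow> - u i" if "i < d" for i
      using tendsto_minus[OF lim[OF that]] by (simp add: x_def)
    moreover have "- u i0 \<noteq> 0" using i0(2) by simp
    ultimately obtain M where "eventually (\<lambda>n. contracts M (- q (r n))) sequentially"
      using eventually_contracts[where u = "\<lambda>i. - u i" and q = "\<lambda>n. - q (r n)", OF c i0(1) _ _ s_r] by blast
    then show False using q(3) by (rule contra[of M "\<lambda>n. - q n"])
  qed
qed

end

section \<open>Commuting conjugates\<close>

definition cmt :: "'h::group_add \<Rightarrow> 'h \<Rightarrow> bool" where
  "cmt x y \<longleftrightarrow> x + y = y + x"

lemma cmt_sym: "cmt x y \<longleftrightarrow> cmt y x"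
  by (auto simp: cmt_def)

lemma cmt_0 [simp]: "cmt x 0" "cmt 0 x"
  by (simp_all add: cmt_def)

lemma cmt_add: "cmt x y \<Longrightarrow> cmt x z \<Longrightarrow> cmt x (y + z)"
  unfolding cmt_def by (metis add.assoc)

lemma cmt_uminus [simp]: "cmt x (- y) \<longleftrightarrow> cmt x y"
proof -
  have *: "cmt x (- y)" if "cmt x y" for y
  proof -
    have "- y + (x + y) + - y = - y + (y + x) + - y" using that by (simp add: cmt_def)
    then show ?thesis unfolding cmt_def by (simp only: add.assoc right_minus add_0_right minus_add_cancel)
  qed
  from *[of y] *[of "- y"] show ?thesis by auto
qed

lemma cmt_uminus_left [simp]: "cmt (- x) y \<longleftrightarrow> cmt x y"
  using cmt_uminus[of y x] by (simp only: cmt_sym[of _ y])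

lemma cmt_add_left: "cmt x z \<Longrightarrow> cmt y z \<Longrightarrow> cmt (x + y) z"
  using cmt_add[of z x y] by (simp only: cmt_sym[of _ z])

lemma cmt_conj: "cmt x y \<Longrightarrow> cmt x z \<Longrightarrow> cmt x (y + z - y)"
  unfolding diff_conv_add_uminus by (intro cmt_add) simp_all

lemma cmt_eq: "cmt x y \<Longrightarrow> x + y - x = y"
  by (simp add: cmt_def)

lemma cmt_conj_conj: "cmt (g + x - g) (g + y - g) \<longleftrightarrow> cmt x y"
proof -
  have "g + x - g + (g + y - g) = g + (x + y) - g" for x y
    by (simp add: diff_conv_add_uminus add.assoc del: add_uminus_conv_diff)
  then show ?thesis unfolding cmt_def by (metis add_left_cancel diff_add_cancel)
qed

lemma cmt_conj_left: "cmt x (g + y - g) \<longleftrightarrow> cmt (- g + x + g) y"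
proof -
  have "g + (- g + x + g) - g = x" by (simp add: diff_conv_add_uminus add.assoc del: add_uminus_conv_diff)
  then show ?thesis using cmt_conj_conj[of g "- g + x + g" y] by simp
qed

definition comm_at :: "(nat \<Rightarrow> 'h::group_add) \<Rightarrow> ('k \<Rightarrow> 'h) \<Rightarrow> ('k \<Rightarrow> 'h) \<Rightarrow> 'k set \<Rightarrow> nat word \<Rightarrow> bool" where
  "comm_at T a1 a2 A h \<longleftrightarrow> (\<forall>k\<in>A. \<forall>k'\<in>A. cmt (a1 k) (ev T h + a2 k' - ev T h))"

lemma comm_at_swap: "comm_at T a1 a2 A h \<longleftrightarrow> comm_at T a2 a1 A (winv h)"
  unfolding comm_at_def by (subst cmt_conj_left) (auto simp: cmt_sym)

lemma comm_at_cong: "ev T h = ev T h' \<Longrightarrow> comm_at T a1 a2 A h \<longleftrightarrow> comm_at T a1 a2 A h'"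
  by (simp add: comm_at_def)

text \<open>Swaps are required only for words with the given letters, since in the application a
  swap is justified by facts about words made of some of these letters.\<close>

lemma permute_by_swaps:
  assumes "\<And>h1 x y h2. mset (h1 @ x # y # h2) = \<mu> \<Longrightarrow> Q (h1 @ y # x # h2) \<Longrightarrow> Q (h1 @ x # y # h2)"
    and "mset h = \<mu>" "mset h' = \<mu>" "Q h"
  shows "Q h'"
  using assms
proof (induction h' arbitrary: h Q \<mu>)
  case Nil
  then show ?case by simp
next
  case (Cons x h'')
  note swap = Cons.prems(1)
  have "x \<in> set h" using Cons.prems(2,3) by (metis list.set_intros(1) set_mset_mset)
  then obtain u v where h: "h = u @ x # v" by (meson split_list)
  have "mset (u @ x # v) = \<mu> \<Longrightarrow> Q (u @ x # v) \<Longrightarrow> Q (x # u @ v)" for v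
  proof (induction u arbitrary: v rule: rev_induct)
    case (snoc y u)
    then have "Q (u @ x # y # v)" by (intro swap[of u x y v]) auto
    then show ?case using snoc.IH[of "y # v"] snoc.prems by (simp add: add_mset_commute)
  qed simp
  then have "Q (x # u @ v)" using Cons.prems(2,4) h by simp
  moreover have "mset (u @ v) = mset h''" using Cons.prems(2,3) h by auto
  ultimately show ?case
    using Cons.IH[of "mset h''" "\<lambda>k. Q (x # k)" "u @ v"] swap[of "x # _"] Cons.prems(3) by auto
qed

section \<open>Monotone words as geodesics of the lattice\<close>

definition mono_word :: "nat word \<Rightarrow> bool" where
  "mono_word h \<longleftrightarrow> (\<forall>x\<in>set h. inv_letter x \<notin> set h)"

lemma mono_word_subset: "mono_word h \<Longrightarrow> set h' \<subseteq> set h \<Longrightarrow> mono_word h'"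
  by (auto simp: mono_word_def)

lemma mono_word_winv: "mono_word h \<Longrightarrow> mono_word (winv h)"
  by (auto simp: mono_word_def)

lemma twt_count: "i < d \<Longrightarrow> twt d h i = int (count (mset h) (i, True)) - int (count (mset h) (i, False))"
proof (induction h)
  case (Cons x h)
  then show ?case
    by (cases x; cases "snd x") (auto simp: plus_fun_apply zero_fun_apply lval_def tvec_def)
qed (simp add: zero_fun_apply)

lemma mono_word_count: "mono_word h \<Longrightarrow> count (mset h) (i, True) = 0 \<or> count (mset h) (i, False) = 0"
  by (auto simp: mono_word_def inv_letter_def count_eq_zero_iff)

definition between :: "int \<Rightarrow> int \<Rightarrow> bool" where
  "between a b \<longleftrightarrow> 0 \<le> a \<and> a \<le> b \<or> b \<le> a \<and> a \<le> 0"

lemma between_sub: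
  assumes "mono_word h" "mset h1 \<subseteq># mset h" "i < d"
  shows "between (twt d h1 i) (twt d h i)"
  using mono_word_count[OF assms(1), of i] mset_subset_eq_count[OF assms(2), of "(i, True)"]
    mset_subset_eq_count[OF assms(2), of "(i, False)"] assms(3)
  by (auto simp: between_def twt_count simp del: count_mset_0_iff)

lemma between_square: "between a b \<Longrightarrow> a\<^sup>2 \<le> b\<^sup>2"
  by (auto simp: between_def abs_le_square_iff[symmetric])

text \<open>Dropping letters from a monotone word moves each coordinate towards 0; this is the
  descent for the induction on the norm.\<close>

lemma nrm_sub_less:
  assumes h: "mono_word h" "tword d h" and sub: "mset h1 \<subset># mset h"
  shows "nrm d (twt d h1) < nrm d (twt d h)"
proof -
  have le: "mset h1 \<subseteq># mset h" using sub by (rule subset_mset.less_imp_le)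
  obtain x where x: "count (mset h1) x < count (mset h) x"
    using sub by (metis le mset_subset_eq_count multiset_eqI nat_less_le subset_mset.less_irrefl)
  then have "x \<in> set h" by (metis count_eq_zero_iff less_nat_zero_code set_mset_mset)
  obtain i b where ib: "x = (i, b)" by (cases x)
  have i: "i < d" using h(2) \<open>x \<in> set h\<close> ib by (auto simp: tword_def)
  have "(twt d h1 i)\<^sup>2 < (twt d h i)\<^sup>2"
    unfolding not_le[symmetric] abs_le_square_iff[symmetric]
    using mono_word_count[OF h(1), of i] mset_subset_eq_count[OF le, of "(i, True)"]
      mset_subset_eq_count[OF le, of "(i, False)"] x
    by (cases b) (auto simp: twt_count[OF i] ib simp del: count_mset_0_iff)
  then show ?thesis
    unfolding nrm_def using between_sub[OF h(1) le] i
    by (intro sum_strict_mono_ex1) (auto intro: between_square)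
qed

text \<open>The absolute value of an integer is at most its square. Hence points of bounded norm
  have only short monotone words, to which the imposed relations apply.\<close>

lemma length_le_nrm:
  assumes "mono_word h" "tword d h"
  shows "int (length h) \<le> nrm d (twt d h)"
proof -
  have "int (length h) = (\<Sum>i<d. int (count (mset h) (i, True)) + int (count (mset h) (i, False)))"
    using assms(2)
  proof (induction h)
    case (Cons x h)
    obtain j b where x: "x = (j, b)" by (cases x)
    have "(\<Sum>i<d. int (count (mset (x # h)) (i, True)) + int (count (mset (x # h)) (i, False)))
        = (\<Sum>i<d. (int (count (mset h) (i, True)) + int (count (mset h) (i, False))) + (if i = j then 1 else 0))"
      by (intro sum.cong) (auto simp: x)
    then show ?case using Cons by (simp add: sum.distrib x)
  qed simp
  also have "\<dots> \<le> nrm d (twt d h)"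
    unfolding nrm_def
  proof (intro sum_mono)
    fix i assume "i \<in> {..<d}"
    then have "int (count (mset h) (i, True)) + int (count (mset h) (i, False)) = \<bar>twt d h i\<bar>"
      using mono_word_count[OF assms(1), of i] by (auto simp: twt_count simp del: count_mset_0_iff)
    also have "\<dots> \<le> (twt d h i)\<^sup>2"
      using mult_left_mono[of 1 "\<bar>twt d h i\<bar>" "\<bar>twt d h i\<bar>"]
      by (cases "twt d h i = 0") (simp_all add: power2_eq_square)
    finally show "int (count (mset h) (i, True)) + int (count (mset h) (i, False)) \<le> (twt d h i)\<^sup>2" .
  qed
  finally show ?thesis .
qed

text \<open>\<open>m\<close> is an error allowance: one more letter raises it by one
  (\<open>near_push\<close>), while dropping letters costs nothing
  (\<open>near_between\<close>).\<close>

definition near :: "nat \<Rightarrow> int \<Rightarrow> int \<Rightarrow> bool" where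
  "near m a b \<longleftrightarrow> \<bar>a\<bar> \<le> int m \<or> between a b"

lemma near_between: "near m a b \<Longrightarrow> between a' a \<Longrightarrow> near m a' b"
  by (auto simp: near_def between_def)

lemma near_push: "near m a b \<Longrightarrow> \<bar>e\<bar> \<le> 1 \<Longrightarrow> near (Suc m) (a + e) (b + e)"
  by (auto simp: near_def between_def)

text \<open>If \<open>\<bar>y + a\<bar>\<close> exceeds \<open>\<bar>y + b\<bar>\<close>, then it is
  at most \<open>2 * int K\<close>. Over all coordinates this exception is paid for by the term
  \<open>4 * int d * (int K)\<^sup>2\<close> in \<open>contracts\<close>.\<close>

lemma near_square:
  assumes "near m a b" "\<bar>y\<bar> \<le> int K" "m \<le> K"
  shows "(y + a)\<^sup>2 \<le> (y + b)\<^sup>2 + 4 * (int K)\<^sup>2"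
proof (cases "\<bar>y + a\<bar> \<le> \<bar>y + b\<bar>")
  case True
  then have "(y + a)\<^sup>2 \<le> (y + b)\<^sup>2" by (simp add: abs_le_square_iff)
  then show ?thesis by (simp add: add_increasing2)
next
  case False
  then have "\<bar>y + a\<bar> \<le> 2 * int K" using assms by (auto simp: near_def between_def)
  then have "\<bar>y + a\<bar> \<le> \<bar>2 * int K\<bar>" by simp
  then have "(y + a)\<^sup>2 \<le> (2 * int K)\<^sup>2" unfolding abs_le_square_iff .
  then show ?thesis by (simp add: power_mult_distrib add_increasing)
qed

locale two_copies =
  fixes d :: nat and A :: "'k set" and c :: "nat \<times> bool \<Rightarrow> nat \<times> bool \<Rightarrow> 'k"
    and T :: "nat \<Rightarrow> 'h::group_add" and a1 a2 :: "'k \<Rightarrow> 'h"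
  assumes c_A: "\<And>x y. fst x < d \<Longrightarrow> fst y < d \<Longrightarrow> c x y \<in> A"
    and T_comm: "\<And>x y. fst x < d \<Longrightarrow> fst y < d \<Longrightarrow>
      lval T x + lval T y - lval T x - lval T y = a1 (c x y) + a2 (c x y)"
    and comm_Nil: "comm_at T a1 a2 A []"
begin

abbreviation S :: "nat word \<Rightarrow> bool" where "S \<equiv> comm_at T a1 a2 A"

lemma two_copies_swap: "two_copies d A c T a2 a1"
proof
  show "comm_at T a2 a1 A []" using comm_Nil comm_at_swap[of T a1 a2 A "[]"] by simp
  fix x y :: "nat \<times> bool" assume xy: "fst x < d" "fst y < d"
  then have "cmt (a1 (c x y)) (a2 (c x y))" using comm_Nil c_A by (auto simp: comm_at_def)
  then show "lval T x + lval T y - lval T x - lval T y = a2 (c x y) + a1 (c x y)"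
    using T_comm[OF xy] by (simp add: cmt_def)
qed (rule c_A)

lemma T_swap:
  assumes "fst x < d" "fst y < d"
  shows "lval T x + lval T y = a1 (c x y) + a2 (c x y) + lval T y + lval T x"
  using T_comm[OF assms] by (simp add: algebra_simps)

text \<open>The swap inserts \<open>a1 (c x y) + a2 (c x y)\<close> after \<open>h1\<close>. The
  first summand drops out since it commutes with the conjugate \<open>v\<close> of
  \<open>a2 k'\<close>, by \<open>S (y # x # h2)\<close>, and with the second summand, by
  \<open>comm_Nil\<close>. The second does no harm since it commutes with the conjugate
  \<open>z\<close> of \<open>a1 k\<close>, by \<open>S h1\<close>.\<close>

lemma S_swap:
  assumes xy: "fst x < d" "fst y < d" and S: "S h1" "S (y # x # h2)" "S (h1 @ y # x # h2)"
  shows "S (h1 @ x # y # h2)"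
  unfolding comm_at_def
proof (intro ballI)
  fix k k' assume k: "k \<in> A" "k' \<in> A"
  define g where "g = ev T (y # x # h2)"
  define v where "v = g + a2 k' - g"
  define z where "z = - ev T h1 + a1 k + ev T h1"
  let ?c1 = "a1 (c x y)" and ?c2 = "a2 (c x y)"
  have cA: "c x y \<in> A" using xy by (rule c_A)
  have 1: "cmt ?c1 v" using S(2) cA k by (auto simp: comm_at_def v_def g_def)
  have 2: "cmt ?c1 ?c2" using comm_Nil cA by (auto simp: comm_at_def)
  have "cmt (a1 k) (ev T h1 + ?c2 - ev T h1)" using S(1) cA k by (auto simp: comm_at_def)
  then have 3: "cmt z ?c2" by (simp add: cmt_conj_left z_def)
  have "cmt (a1 k) (ev T h1 + v - ev T h1)"
    using S(3) k by (auto simp: comm_at_def v_def g_def diff_conv_add_uminus add.assoc minus_add simp del: add_uminus_conv_diff)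
  then have 4: "cmt z v" by (simp add: cmt_conj_left z_def)
  have "?c1 + (?c2 + v - ?c2) - ?c1 = ?c2 + v - ?c2" by (intro cmt_eq cmt_conj 1 2)
  moreover have "ev T (h1 @ x # y # h2) + a2 k' - ev T (h1 @ x # y # h2)
      = ev T h1 + (?c1 + (?c2 + v - ?c2) - ?c1) - ev T h1"
  proof -
    have e: "ev T (h1 @ x # y # h2) = ev T h1 + ?c1 + ?c2 + g"
      using T_swap[OF xy] by (simp add: g_def add.assoc) (simp flip: add.assoc)
    show ?thesis unfolding e v_def by (simp add: diff_conv_add_uminus add.assoc minus_add del: add_uminus_conv_diff)
  qed
  ultimately show "cmt (a1 k) (ev T (h1 @ x # y # h2) + a2 k' - ev T (h1 @ x # y # h2))"
    using cmt_conj[OF 3 4] by (simp add: cmt_conj_left z_def)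
qed

text \<open>A swap needs the statement for the part before it and for the part from it on. Both are
  made of letters of \<open>h\<close>, properly fewer of them unless the swap is at the front; there
  \<open>H3\<close> steps in, or the statement itself if \<open>g\<close> is empty.\<close>

lemma S_permute:
  assumes tw: "tword d h" and perm: "mset h' = mset h" and Sh: "S (g @ h)"
    and H1: "\<And>h1. mset h1 \<subset># mset h \<Longrightarrow> S (g @ h1)"
    and H2: "\<And>h2. mset h2 \<subset># mset h \<Longrightarrow> S h2"
    and H3: "\<And>h2. g \<noteq> [] \<Longrightarrow> mset h2 = mset h \<Longrightarrow> S h2"
  shows "S (g @ h')"
proof (rule permute_by_swaps[of "mset h" "\<lambda>h. S (g @ h)", OF _ HOL.refl perm Sh])
  fix h1 x y h2 assume m: "mset (h1 @ x # y # h2) = mset h" and S: "S (g @ h1 @ y # x # h2)"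
  have "set (h1 @ x # y # h2) = set h" using m by (metis set_mset_mset)
  then have xy: "fst x < d" "fst y < d" using tw by (auto simp: tword_def)
  have "mset h1 \<subset># mset h" by (simp flip: m)
  then have "S (g @ h1)" by (rule H1)
  moreover have "S (y # x # h2)"
  proof (cases "h1 = []")
    case True
    have "mset (y # x # h2) = mset h" using True by (simp flip: m)
    then show ?thesis using H3[of "y # x # h2"] S True by (cases "g = []") auto
  next
    case False
    then have "mset (y # x # h2) \<subset># mset h"
      by (auto simp flip: m simp: subset_mset.less_le)
    then show ?thesis by (rule H2)
  qed
  ultimately show "S (g @ h1 @ x # y # h2)" using S_swap[OF xy, of "g @ h1" h2] S by simp
qed

definition Smono :: "int \<Rightarrow> bool" where
  "Smono r \<longleftrightarrow> (\<forall>h. tword d h \<longrightarrow> mono_word h \<longrightarrow> nrm d (twt d h) < r \<longrightarrow> S h)"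

lemma mono_eqD: "mono_word w \<Longrightarrow> tword d w \<Longrightarrow> mset w1 \<subseteq># mset w \<Longrightarrow> mono_word w1 \<and> tword d w1"
  using mono_word_subset[of w w1] set_mset_mono[of "mset w1" "mset w"] by (auto simp: tword_def)

text \<open>\<open>x\<close> is a detour before a monotone word. Its last letter \<open>t\<close> is
  absorbed by \<open>w\<close>: either \<open>t # w\<close> is monotone, or the inverse of
  \<open>t\<close> occurs in \<open>w\<close>, is moved to the front and cancels. Moving it requires
  the statement for words with fewer letters of \<open>w\<close>, which end elsewhere. Hence the
  inner induction on the length, and hence the point \<open>P\<close>, to which the end of
  \<open>w\<close> only has to be \<open>near\<close>.\<close>

lemma S_near_geodesic:
  assumes mono: "Smono r"
  shows "tword d x \<Longrightarrow> tword d w \<Longrightarrow> mono_word w \<Longrightarrow> m + length x \<le> K \<Longrightarrow>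
    (\<And>i. i < d \<Longrightarrow> near m (twt d w i) (P i)) \<Longrightarrow>
    (\<And>x1 x2. x = x1 @ x2 \<Longrightarrow> nrm d (twt d x2 + P) + 4 * int d * (int K)\<^sup>2 < r) \<Longrightarrow> S (x @ w)"
proof (induction x arbitrary: w m P rule: rev_induct)
  case Nil
  have "nrm d (twt d w) \<le> nrm d (twt d [] + P) + 4 * int d * (int K)\<^sup>2"
  proof -
    have "(twt d w i)\<^sup>2 \<le> (P i)\<^sup>2 + 4 * (int K)\<^sup>2" if "i < d" for i
      using near_square[OF Nil.prems(5)[OF that], of 0 K] Nil.prems(4) by simp
    then have "nrm d (twt d w) \<le> (\<Sum>i<d. (P i)\<^sup>2 + 4 * (int K)\<^sup>2)"
      unfolding nrm_def by (intro sum_mono) auto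
    then show ?thesis by (simp add: nrm_def sum.distrib)
  qed
  then have "nrm d (twt d w) < r" using Nil.prems(6)[of "[]" "[]"] by simp
  then show ?case using mono Nil.prems by (simp add: Smono_def)
next
  case (snoc t x)
  note outer = snoc.IH
  have t: "fst t < d" and tx: "tword d x" using snoc.prems(1) by simp_all
  have push: "S (x @ w')" if w': "tword d w'" "mono_word w'" "twt d w' = lval (tvec d) t + twt d w"
    "\<And>i. i < d \<Longrightarrow> near m (twt d w i) (P i)" for w' w
  proof (rule outer[OF tx w'(1,2), of "Suc m" "lval (tvec d) t + P"])
    show "Suc m + length x \<le> K" using snoc.prems(4) by simp
    show "near (Suc m) (twt d w' i) ((lval (tvec d) t + P) i)" if "i < d" for i
    proof -
      have "\<bar>lval (tvec d) t i\<bar> \<le> 1" by (auto simp: lval_def tvec_def zero_fun_apply)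
      from near_push[OF w'(4)[OF that] this] show ?thesis by (simp add: w'(3) plus_fun_apply ac_simps)
    qed
    show "nrm d (twt d x2 + (lval (tvec d) t + P)) + 4 * int d * (int K)\<^sup>2 < r" if "x = x1 @ x2" for x1 x2
      using snoc.prems(6)[of x1 "x2 @ [t]"] that by (simp add: add.assoc)
  qed
  show ?case
    using snoc.prems(2,3,5)
  proof (induction w rule: length_induct)
    case (1 w)
    have w: "tword d w" "mono_word w" and nr: "\<And>i. i < d \<Longrightarrow> near m (twt d w i) (P i)" using "1.prems" by auto
    have small: "nrm d (twt d h) < r" if "mset h \<subseteq># mset w" for h
    proof -
      have "(twt d h i)\<^sup>2 \<le> (P i)\<^sup>2 + 4 * (int K)\<^sup>2" if "i < d" for i
        using near_square[OF near_between[OF nr[OF that] between_sub[OF w(2) \<open>mset h \<subseteq># mset w\<close> that]], of 0 K]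
          snoc.prems(4) by simp
      then have "nrm d (twt d h) \<le> (\<Sum>i<d. (P i)\<^sup>2 + 4 * (int K)\<^sup>2)"
        unfolding nrm_def by (intro sum_mono) auto
      also have "\<dots> < r" using snoc.prems(6)[of "x @ [t]" "[]"] by (simp add: nrm_def sum.distrib)
      finally show ?thesis .
    qed
    show ?case
    proof (cases "inv_letter t \<in> set w")
      case False
      then have "mono_word (t # w)" using w(2) by (auto simp: mono_word_def)
      then show ?thesis using push[of "t # w" w] w nr t by simp
    next
      case True
      then obtain w1 w2 where w12: "w = w1 @ inv_letter t # w2" by (meson split_list)
      define h where "h = inv_letter t # w1 @ w2"
      have hw: "mset w = mset h" by (simp add: h_def w12)
      have "S (x @ (w1 @ w2))"
        using w mono_word_subset[OF w(2), of "w1 @ w2"] nr by (intro push[of "w1 @ w2" w]) (auto simp: w12 ac_simps)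
      then have "S ((x @ [t]) @ h)"
        by (subst comm_at_cong[of T _ "x @ w1 @ w2"]) (simp_all add: h_def)
      then have "S ((x @ [t]) @ w)"
      proof (rule S_permute[rotated 2])
        show "tword d h" using w(1) by (simp add: h_def w12)
        show "S ((x @ [t]) @ h1)" if "mset h1 \<subset># mset h" for h1
        proof -
          have sub: "mset h1 \<subset># mset w" using that hw by simp
          then have "length h1 < length w" by (metis mset_subset_size size_mset)
          moreover have "near m (twt d h1 i) (P i)" if "i < d" for i
            using near_between[OF nr[OF that] between_sub[OF w(2) _ that]] sub by (simp add: subset_mset.less_imp_le)
          ultimately show ?thesis
            using "1.IH" mono_eqD[OF w(2,1), of h1] sub by (simp add: subset_mset.less_imp_le)
        qed
        have S2: "S h2" if "mset h2 \<subseteq># mset w" for h2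
          using mono small[OF that] mono_eqD[OF w(2,1) that] by (simp add: Smono_def)
        show "S h2" if "mset h2 \<subset># mset h" for h2 using that hw S2 by (simp add: subset_mset.less_imp_le)
        show "S h2" if "mset h2 = mset h" for h2 using that hw S2 by simp
      qed (simp add: hw)
      then show ?thesis by simp
    qed
  qed
qed

text \<open>Up to order, \<open>h\<close> is \<open>z @ w\<close>. Conjugating back by
  \<open>z\<close> turns the letter \<open>k\<close> into conjugates along the words
  \<open>P\<close>, so the statement for \<open>z @ w\<close> follows from those for
  \<open>winv P @ w\<close>. The latter lead over points \<open>q - y\<close> with \<open>y\<close>
  on a contracted path, and these are closer to 0 than \<open>q\<close> by the margin that
  \<open>S_near_geodesic\<close> needs.\<close>

lemma S_contract:
  assumes mono: "Smono (nrm d q)" and h: "tword d h" "mono_word h" "twt d h = q"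
    and i: "i < d" "int H \<le> (if b then q i else - q i)"
    and L: "\<And>k. k \<in> A \<Longrightarrow> - ev T (replicate H (i, b)) + a1 k + ev T (replicate H (i, b)) = lv T a1 (L k)"
    and entries: "\<And>k P l. k \<in> A \<Longrightarrow> (P, l) \<in> set (L k) \<Longrightarrow> tword d P \<and> fst l \<in> A \<and> length P \<le> K"
    and close: "\<And>k P l P1 P2. k \<in> A \<Longrightarrow> (P, l) \<in> set (L k) \<Longrightarrow> P = P1 @ P2 \<Longrightarrow>
      nrm d (twt d (replicate H (i, b) @ P1)) + 4 * int d * (int K)\<^sup>2 < 2 * ip d q (twt d (replicate H (i, b) @ P1))"
  shows "S h"
proof -
  define z where "z = replicate H (i, b)"
  \<comment> \<open>A monotone word contains the letters of coordinate \<open>i\<close> with one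
    sign only, so their number is the absolute value of \<open>q i\<close>.\<close>
  have "H \<le> count (mset h) (i, b)"
    using i mono_word_count[OF h(2), of i] twt_count[OF i(1), of h] h(3) by (cases b) auto
  then have "mset z \<subseteq># mset h" unfolding z_def by (simp add: count_le_replicate_mset_subset_eq)
  then obtain \<mu> where \<mu>: "mset h = mset z + \<mu>" by (auto simp: subset_mset.le_iff_add)
  obtain w where w: "mset w = \<mu>" using ex_mset by blast
  have hz: "mset h = mset (z @ w)" using \<mu> w by simp
  have tww: "tword d (z @ w)" "mono_word (z @ w)"
    using mono_eqD[OF h(2,1), of "z @ w"] hz by simp_all
  have q: "q = twt d z + twt d w"
  proof
    fix j show "q j = (twt d z + twt d w) j"
    proof (cases "j < d")
      case True
      then have "twt d h j = twt d (z @ w) j" using hz by (simp only: twt_count)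
      then show ?thesis by (simp add: h(3))
    next
      case False
      then show ?thesis using supp_tvec(2)[of d h] supp_tvec(2)[of d "z @ w"] by (simp add: supp_def flip: h(3))
    qed
  qed
  have "S (z @ w)"
    unfolding comm_at_def
  proof (intro ballI)
    fix k k' assume k: "k \<in> A" "k' \<in> A"
    have "cmt (lv T a1 (L k)) (ev T w + a2 k' - ev T w)"
    proof -
      have one: "cmt (ev T P + lval a1 l - ev T P) (ev T w + a2 k' - ev T w)" if Pl: "(P, l) \<in> set (L k)" for P l
      proof -
        have P: "tword d P" "fst l \<in> A" "length P \<le> K" using entries[OF k(1) Pl] by auto
        have "S (winv P @ w)"
        proof (rule S_near_geodesic[OF mono, where m = 0 and K = K and P = "twt d w"])
          show "tword d (winv P)" "tword d w" "mono_word w" "0 + length (winv P) \<le> K"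
            using P tww mono_word_subset[OF tww(2), of w] by auto
          show "near 0 (twt d w i) (twt d w i)" for i by (auto simp: near_def between_def)
          fix x1 x2 assume x: "winv P = x1 @ x2"
          then have "P = winv x2 @ winv x1" by (metis winv_simps(3,5))
          from close[OF k(1) Pl this] have *: "nrm d (twt d z - twt d x2) + 4 * int d * (int K)\<^sup>2
              < 2 * ip d q (twt d z - twt d x2)" by (simp add: z_def)
          define y where "y = twt d z - twt d x2"
          have "twt d x2 + twt d w = q - y" by (simp add: y_def q)
          then have e: "nrm d (twt d x2 + twt d w) = nrm d (q - y)" by simp
          have "nrm d (q - y) = nrm d q - 2 * ip d q y + nrm d y"
            by (simp add: nrm_def ip_def power2_diff sum.distrib sum_subtractf sum_distrib_left algebra_simps)
          then show "nrm d (twt d x2 + twt d w) + 4 * int d * (int K)\<^sup>2 < nrm d q"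
            using *[folded y_def] e by linarith
        qed
        then have "cmt (a1 (fst l)) (ev T (winv P @ w) + a2 k' - ev T (winv P @ w))"
          using P k by (simp add: comm_at_def)
        then have "cmt (a1 (fst l)) (- ev T P + (ev T w + a2 k' - ev T w) - - ev T P)"
          by (simp add: diff_conv_add_uminus add.assoc minus_add del: add_uminus_conv_diff)
        then have "cmt (ev T P + a1 (fst l) + - ev T P) (ev T w + a2 k' - ev T w)"
          unfolding cmt_conj_left by simp
        moreover have "cmt (ev T P + lval a1 l - ev T P) y \<longleftrightarrow> cmt (ev T P + a1 (fst l) - ev T P) y" for y
        proof -
          have "ev T P + - a1 (fst l) - ev T P = - (ev T P + a1 (fst l) - ev T P)"
            by (simp add: diff_conv_add_uminus add.assoc minus_add del: add_uminus_conv_diff)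
          then show ?thesis by (cases "snd l") (simp_all only: lval_def if_True if_False cmt_uminus_left)
        qed
        ultimately show ?thesis by simp
      qed
      have "set L' \<subseteq> set (L k) \<longrightarrow> cmt (ev T w + a2 k' - ev T w) (lv T a1 L')" for L'
      proof (induction L')
        case (Cons x L')
        obtain P l where x: "x = (P, l)" by (cases x)
        show ?case
        proof
          assume "set (x # L') \<subseteq> set (L k)"
          then have "cmt (ev T w + a2 k' - ev T w) (ev T P + lval a1 l - ev T P)"
            using one[of P l] x by (subst cmt_sym) simp
          then show "cmt (ev T w + a2 k' - ev T w) (lv T a1 (x # L'))"
            using Cons \<open>set (x # L') \<subseteq> set (L k)\<close> unfolding x lv_simps by (intro cmt_add) auto
        qed
      qed simp
      then show ?thesis by (subst cmt_sym) simp
    qed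
    then have "cmt (- ev T z + a1 k + ev T z) (ev T w + a2 k' - ev T w)" using L[OF k(1)] by (simp add: z_def)
    then have "cmt (a1 k) (ev T z + (ev T w + a2 k' - ev T w) - ev T z)" by (simp only: cmt_conj_left)
    then show "cmt (a1 k) (ev T (z @ w) + a2 k' - ev T (z @ w))"
      by (simp add: diff_conv_add_uminus add.assoc minus_add del: add_uminus_conv_diff)
  qed
  \<comment> \<open>Returning from \<open>z @ w\<close> to \<open>h\<close> is a rearrangement, and
    proper parts of a monotone word end at points of smaller norm.\<close>
  have less: "S h'" if "mset h' \<subset># mset (z @ w)" for h'
  proof -
    have "nrm d (twt d h') < nrm d q" using nrm_sub_less[OF h(2,1), of h'] that hz h(3) by simp
    then show ?thesis using mono mono_eqD[OF tww(2,1), of h'] that by (simp add: Smono_def subset_mset.less_imp_le)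
  qed
  show ?thesis
    using S_permute[of "z @ w" h "[]"] tww(1) hz \<open>S (z @ w)\<close> less by simp
qed

text \<open>A word that is not monotone contains a letter and its inverse. Moved to the front they
  cancel, and the rearrangement costs only shorter words.\<close>

lemma S_all_of_mono:
  assumes "\<And>h. tword d h \<Longrightarrow> mono_word h \<Longrightarrow> S h"
  shows "tword d h \<Longrightarrow> S h"
proof (induction h rule: length_induct)
  case (1 h)
  show ?case
  proof (cases "mono_word h")
    case True
    then show ?thesis using assms 1 by blast
  next
    case False
    then obtain x where x: "x \<in> set h" "inv_letter x \<in> set h" by (auto simp: mono_word_def)
    then obtain u v where uv: "h = u @ x # v" by (meson split_list)
    have "inv_letter x \<in> set (u @ v)" using x uv inv_letter_simps(3)[of x] by auto
    then obtain u' v' where uv': "u @ v = u' @ inv_letter x # v'" by (meson split_list)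
    define h' where "h' = x # inv_letter x # u' @ v'"
    have "mset (u @ v) = mset (u' @ inv_letter x # v')" by (simp only: uv')
    then have hh': "mset h = mset h'" by (simp add: uv h'_def)
    have tw: "tword d h1" if "mset h1 \<subseteq># mset h" for h1
      using that 1 set_mset_mono[OF that] by (auto simp: tword_def)
    have less: "S h1" if "mset h1 \<subset># mset h'" for h1
    proof -
      have "length h1 < length h"
        using mset_subset_size[of "mset h1" "mset h"] that hh'[symmetric] unfolding size_mset by simp
      then show ?thesis using 1 tw[of h1] that hh' by (simp add: subset_mset.less_imp_le)
    qed
    have "mset (u' @ v') \<subset># mset h'" by (simp add: h'_def subset_mset.less_le)
    then have "S (u' @ v')" by (rule less)
    then have "S ([] @ h')" by (subst comm_at_cong[of T _ "u' @ v'"]) (simp_all add: h'_def)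
    then have "S ([] @ h)"
      by (rule S_permute[rotated 2]) (use tw[of h'] less hh' in auto)
    then show ?thesis by simp
  qed
qed

end

section \<open>The group generated by two commuting copies of the kernel\<close>

definition small :: "nat \<Rightarrow> 'k set \<Rightarrow> nat \<Rightarrow> (nat word \<times> 'k \<times> bool) list \<Rightarrow> bool" where
  "small d A M L \<longleftrightarrow> length L \<le> M \<and> (\<forall>(P, k)\<in>set L. tword d P \<and> length P \<le> M \<and> fst k \<in> A)"

definition tpow :: "nat \<Rightarrow> int \<Rightarrow> nat word" where
  "tpow i n = replicate (nat \<bar>n\<bar>) (i, 0 < n)"

lemma tpow_step:
  assumes "s = (if b then 1 else - 1)"
  shows "tpow i (a + s) = (i, b) # tpow i a \<or> tpow i a = inv_letter (i, b) # tpow i (a + s)"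
proof (cases "b \<longleftrightarrow> 0 \<le> a \<and> (a = 0 \<longrightarrow> b)")
  case True
  then have "nat \<bar>a + s\<bar> = Suc (nat \<bar>a\<bar>)" "0 < a + s \<longleftrightarrow> b" "a \<noteq> 0 \<Longrightarrow> 0 < a \<longleftrightarrow> b"
    using assms by auto
  then show ?thesis by (cases "a = 0") (auto simp: tpow_def)
next
  case False
  then show ?thesis
  proof (cases "a = 0")
    case True
    then show ?thesis using assms by (auto simp: tpow_def)
  next
    case ne: False
    have "nat \<bar>a\<bar> = Suc (nat \<bar>a + s\<bar>)" "0 < a \<longleftrightarrow> \<not> b" "a + s \<noteq> 0 \<Longrightarrow> 0 < a + s \<longleftrightarrow> \<not> b"
      using False ne assms by (auto split: if_splits)
    then show ?thesis by (cases "a + s = 0") (auto simp: tpow_def inv_letter_def)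
  qed
qed

text \<open>The normal word of \<open>p\<close>, cut off before coordinate \<open>i\<close>. A
  letter \<open>x\<close> multiplied from the left has to pass exactly \<open>wpre (fst x) p\<close>
  to reach its place.\<close>

definition wpre :: "nat \<Rightarrow> (nat \<Rightarrow> int) \<Rightarrow> nat word" where
  "wpre i p = concat (map (\<lambda>j. tpow j (p j)) [0..<i])"

lemma tword_wpre: "i \<le> d \<Longrightarrow> tword d (wpre i p)"
  by (auto simp: wpre_def tword_def tpow_def)

lemma wpre_cong: "(\<And>j. j < i \<Longrightarrow> p j = q j) \<Longrightarrow> wpre i p = wpre i q"
  unfolding wpre_def by (intro arg_cong[of _ _ concat] map_cong) auto

lemma wpre_split:
  assumes "i < j"
  shows "wpre j p = wpre i p @ tpow i (p i) @ concat (map (\<lambda>j. tpow j (p j)) [Suc i..<j])"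
proof -
  have "[0..<j] = [0..<i] @ [i..<j]" using assms by (metis add_0 le_add_diff_inverse less_imp_le_nat upt_add_eq_append zero_le)
  also have "[i..<j] = i # [Suc i..<j]" using assms by (rule upt_conv_Cons)
  finally show ?thesis by (simp add: wpre_def)
qed

text \<open>What finitely many relators can guarantee about the group generated by the lifts and the
  two copies. \<open>M0 + 1\<close> leaves room for the extra entry in
  \<open>contract_lifts\<close>, and 6 is the number of entries in the Hall-Witt identity.\<close>

locale zd_double = zd_extension d t A R S
  for d and t :: "nat \<Rightarrow> 'g::group_add" and A R S +
  fixes T :: "nat \<Rightarrow> 'h::group_add" and a1 a2 :: "'g \<Rightarrow> 'h" and M0 M :: nat
  assumes contr: "\<And>q. int M0 \<le> nrm d q \<Longrightarrow> contracts M0 q \<or> contracts M0 (- q)"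
    and M: "M0 + 1 \<le> M" "6 \<le> M"
    and T_comm: "\<And>x y. fst x < d \<Longrightarrow> fst y < d \<Longrightarrow>
      lval T x + lval T y - lval T x - lval T y = a1 (cm x y) + a2 (cm x y)"
    and short_comm: "\<And>h. tword d h \<Longrightarrow> length h \<le> M \<Longrightarrow> comm_at T a1 a2 A h"
    and small_rel: "\<And>L. small d A M L \<Longrightarrow> lvG L = 0 \<Longrightarrow> lv T a1 L = 0 \<and> lv T a2 L = 0"
    and R_small: "\<And>r. r \<in> R \<Longrightarrow> \<exists>L. eqv (alph d A) (comm_relators d cm) r (lword L) \<and> small d A M L"
begin

lemma T_two_copies: "two_copies d A cm T a1 a2"
  by unfold_locales (use cm_A T_comm short_comm[of "[]"] in auto)

text \<open>The contraction of a generator is itself a small relation of the given group, hence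
  valid in both copies.\<close>

lemma contract_lifts:
  assumes i: "i < d" and HK: "H \<le> M0" "K \<le> M0" and k: "k \<in> A"
    and L: "lvG (L k) = - ev tG (replicate H (i, b)) + k + ev tG (replicate H (i, b))" "length (L k) \<le> M0"
      "\<forall>(P, l)\<in>set (L k). tword d P \<and> fst l \<in> A \<and> length P \<le> K"
  shows "- ev T (replicate H (i, b)) + a1 k + ev T (replicate H (i, b)) = lv T a1 (L k)"
    and "- ev T (replicate H (i, b)) + a2 k + ev T (replicate H (i, b)) = lv T a2 (L k)"
proof -
  define z where "z = replicate H (i, b)"
  define L' where "L' = (winv z, (k, False)) # L k"
  have "tword d z" using i by (auto simp: z_def tword_def)
  then have "small d A M L'" using M L HK k by (fastforce simp: small_def L'_def z_def)
  moreover have "lvG L' = 0" using L(1) k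
    by (simp add: L'_def flip: z_def) (simp add: diff_conv_add_uminus add.assoc minus_add del: add_uminus_conv_diff)
  ultimately have "lv T a1 L' = 0" "lv T a2 L' = 0" using small_rel by blast+
  then show "- ev T (replicate H (i, b)) + a1 k + ev T (replicate H (i, b)) = lv T a1 (L k)"
    and "- ev T (replicate H (i, b)) + a2 k + ev T (replicate H (i, b)) = lv T a2 (L k)"
    unfolding z_def[symmetric]
    by (simp_all add: L'_def add_eq_0_iff) (simp_all add: diff_conv_add_uminus add.assoc minus_add del: add_uminus_conv_diff)
qed

lemma comm_mono: "tword d h \<Longrightarrow> mono_word h \<Longrightarrow> comm_at T a1 a2 A h"
proof (induction "nat (nrm d (twt d h))" arbitrary: h rule: less_induct)
  case (less h)
  interpret I: two_copies d A cm T a1 a2 by (rule T_two_copies)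
  interpret J: two_copies d A cm T a2 a1 by (rule I.two_copies_swap)
  define q where "q = twt d h"
  have nn: "0 \<le> nrm d p" for p by (simp add: nrm_def sum_nonneg)
  have I: "I.Smono (nrm d q)"
    unfolding I.Smono_def
  proof (intro allI impI)
    fix h' assume h': "tword d h'" "mono_word h'" "nrm d (twt d h') < nrm d q"
    then have "nat (nrm d (twt d h')) < nat (nrm d (twt d h))"
      using nn[of "twt d h'"] by (simp add: q_def)
    then show "comm_at T a1 a2 A h'" using h'(1,2) by (rule less.hyps)
  qed
  show ?case
  proof (cases "int M0 \<le> nrm d q")
    case False
    then have "length h \<le> M" using length_le_nrm[OF less.prems(2,1)] M by (simp add: q_def)
    then show ?thesis using less.prems by (intro short_comm)
  next
    case True
    from contr[OF True] show ?thesis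
    proof
      assume "contracts M0 q"
      then obtain i b H K L where i: "i < d" "int H \<le> (if b then q i else - q i)" "H \<le> M0" "K \<le> M0"
        and L: "\<forall>k\<in>A. lvG (L k) = - ev tG (replicate H (i, b)) + k + ev tG (replicate H (i, b)) \<and> length (L k) \<le> M0 \<and>
        (\<forall>(P, l)\<in>set (L k). tword d P \<and> fst l \<in> A \<and> length P \<le> K \<and>
          (\<forall>P1 P2. P = P1 @ P2 \<longrightarrow>
             nrm d (twt d (replicate H (i, b) @ P1)) + 4 * int d * (int K)\<^sup>2
               < 2 * ip d q (twt d (replicate H (i, b) @ P1))))"
        unfolding contracts_def by blast
      show ?thesis
      proof (rule I.S_contract[OF I less.prems _ i(1,2), of L K])
        show "twt d h = q" by (simp add: q_def)
        show "- ev T (replicate H (i, b)) + a1 k + ev T (replicate H (i, b)) = lv T a1 (L k)" if "k \<in> A" for k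
        proof -
          have "\<forall>(P, l)\<in>set (L k). tword d P \<and> fst l \<in> A \<and> length P \<le> K" using L that by blast
          with contract_lifts(1)[of i H K k L b] show ?thesis using i L that by simp
        qed
        show "tword d P \<and> fst l \<in> A \<and> length P \<le> K" if "k \<in> A" "(P, l) \<in> set (L k)" for k P l
          using L that by blast
        show "nrm d (twt d (replicate H (i, b) @ P1)) + 4 * int d * (int K)\<^sup>2
            < 2 * ip d q (twt d (replicate H (i, b) @ P1))" if "k \<in> A" "(P, l) \<in> set (L k)" "P = P1 @ P2" for k P l P1 P2
          using L that by blast
      qed
    next
      assume "contracts M0 (- q)"
      then obtain i b H K L where i: "i < d" "int H \<le> (if b then (- q) i else - (- q) i)" "H \<le> M0" "K \<le> M0"
        and L: "\<forall>k\<in>A. lvG (L k) = - ev tG (replicate H (i, b)) + k + ev tG (replicate H (i, b)) \<and> length (L k) \<le> M0 \<and>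
        (\<forall>(P, l)\<in>set (L k). tword d P \<and> fst l \<in> A \<and> length P \<le> K \<and>
          (\<forall>P1 P2. P = P1 @ P2 \<longrightarrow>
             nrm d (twt d (replicate H (i, b) @ P1)) + 4 * int d * (int K)\<^sup>2
               < 2 * ip d (- q) (twt d (replicate H (i, b) @ P1))))"
        unfolding contracts_def by blast
      have nq: "nrm d (- q) = nrm d q" by (simp add: nrm_def)
      have J: "J.Smono (nrm d (- q))"
        unfolding J.Smono_def nq
      proof (intro allI impI)
        fix h' assume "tword d h'" "mono_word h'" "nrm d (twt d h') < nrm d q"
        then have "comm_at T a1 a2 A (winv h')"
          using I mono_word_winv[of h'] unfolding I.Smono_def by (simp add: nrm_def)
        then show "comm_at T a2 a1 A h'" using comm_at_swap[of T a2 a1 A h'] by simp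
      qed
      have "comm_at T a2 a1 A (winv h)"
      proof (rule J.S_contract[OF J _ _ _ i(1,2), of _ L K])
        show "tword d (winv h)" "mono_word (winv h)" "twt d (winv h) = - q"
          using less.prems mono_word_winv[of h] by (simp_all add: q_def)
        show "- ev T (replicate H (i, b)) + a2 k + ev T (replicate H (i, b)) = lv T a2 (L k)" if "k \<in> A" for k
        proof -
          have "\<forall>(P, l)\<in>set (L k). tword d P \<and> fst l \<in> A \<and> length P \<le> K" using L that by blast
          with contract_lifts(2)[of i H K k L b] show ?thesis using i L that by simp
        qed
        show "tword d P \<and> fst l \<in> A \<and> length P \<le> K" if "k \<in> A" "(P, l) \<in> set (L k)" for k P l
          using L that by blast
        show "nrm d (twt d (replicate H (i, b) @ P1)) + 4 * int d * (int K)\<^sup>2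
            < 2 * ip d (- q) (twt d (replicate H (i, b) @ P1))" if "k \<in> A" "(P, l) \<in> set (L k)" "P = P1 @ P2" for k P l P1 P2
          using L that by blast
      qed
      then show ?thesis using comm_at_swap[of T a1 a2 A h] by simp
    qed
  qed
qed

lemma comm_all: "tword d h \<Longrightarrow> comm_at T a1 a2 A h"
proof -
  interpret I: two_copies d A cm T a1 a2 by (rule T_two_copies)
  show "tword d h \<Longrightarrow> comm_at T a1 a2 A h" using I.S_all_of_mono comm_mono by blast
qed

section \<open>The cocycle on the first copy\<close>

abbreviation cj :: "nat \<times> bool \<Rightarrow> 'h \<Rightarrow> 'h" where
  "cj x n \<equiv> lval T x + n - lval T x"

abbreviation c1 :: "nat \<times> bool \<Rightarrow> nat \<times> bool \<Rightarrow> 'h" where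
  "c1 x y \<equiv> a1 (cm x y)"

text \<open>The centraliser of all conjugates of the second copy by lifts. It contains the first
  copy and is stable under conjugation by lifts.\<close>

definition Z :: "'h set" where
  "Z = {n. \<forall>h k. tword d h \<longrightarrow> k \<in> A \<longrightarrow> cmt n (ev T h + a2 k - ev T h)}"

lemma Z_simps:
  "0 \<in> Z" "m \<in> Z \<Longrightarrow> n \<in> Z \<Longrightarrow> m + n \<in> Z" "m \<in> Z \<Longrightarrow> - m \<in> Z" "m \<in> Z \<Longrightarrow> n \<in> Z \<Longrightarrow> m - n \<in> Z"
  unfolding diff_conv_add_uminus[of m n] by (auto simp: Z_def cmt_add_left simp del: add_uminus_conv_diff)

lemma a1_Z: "k \<in> A \<Longrightarrow> a1 k \<in> Z"
  using comm_all by (auto simp: Z_def comm_at_def)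

lemma c1_Z: "fst x < d \<Longrightarrow> fst y < d \<Longrightarrow> c1 x y \<in> Z"
  by (intro a1_Z cm_A)

lemma cj_word_Z: "tword d u \<Longrightarrow> n \<in> Z \<Longrightarrow> ev T u + n - ev T u \<in> Z"
  unfolding Z_def
proof (intro CollectI allI impI)
  fix h k assume *: "tword d u" "n \<in> {n. \<forall>h k. tword d h \<longrightarrow> k \<in> A \<longrightarrow> cmt n (ev T h + a2 k - ev T h)}" "tword d h" "k \<in> A"
  then have "tword d (winv u @ h)" by simp
  then have "cmt n (ev T (winv u @ h) + a2 k - ev T (winv u @ h))" using *(2,4) by blast
  then have "cmt (ev T u + n - ev T u) (ev T u + (ev T (winv u @ h) + a2 k - ev T (winv u @ h)) - ev T u)"
    by (simp only: cmt_conj_conj)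
  moreover have "ev T u + (ev T (winv u @ h) + a2 k - ev T (winv u @ h)) - ev T u = ev T h + a2 k - ev T h"
    by (simp add: diff_conv_add_uminus add.assoc minus_add del: add_uminus_conv_diff)
  ultimately show "cmt (ev T u + n - ev T u) (ev T h + a2 k - ev T h)" by simp
qed

lemma cj_add: "cj x (m + n) = cj x m + cj x n"
  by (simp add: diff_conv_add_uminus add.assoc minus_add del: add_uminus_conv_diff)

lemma cj_Z: "fst x < d \<Longrightarrow> n \<in> Z \<Longrightarrow> cj x n \<in> Z"
  using cj_word_Z[of "[x]" n] by simp

text \<open>Of the two factors of the commutator of lifts, the second one centralises
  \<open>Z\<close> and disappears.\<close>

lemma cj_swap:
  assumes "fst x < d" "fst y < d" "n \<in> Z"
  shows "cj x (cj y n) = c1 x y + cj y (cj x n) - c1 x y"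
proof -
  define v where "v = cj y (cj x n)"
  have "v \<in> Z" using assms by (simp add: v_def cj_Z)
  then have "cmt v (a2 (cm x y))" using cm_A[OF assms(1,2)] by (force simp: Z_def dest: spec[of _ "[]"])
  then have "a2 (cm x y) + v - a2 (cm x y) = v" by (metis cmt_eq cmt_sym)
  moreover have "lval T x + lval T y = c1 x y + a2 (cm x y) + (lval T y + lval T x)"
    using T_comm[OF assms(1,2)] by (simp add: algebra_simps)
  then have "cj x (cj y n) = c1 x y + (a2 (cm x y) + v - a2 (cm x y)) - c1 x y"
  proof -
    assume e: "lval T x + lval T y = c1 x y + a2 (cm x y) + (lval T y + lval T x)"
    have "cj x (cj y n) = (lval T x + lval T y) + n - (lval T x + lval T y)"
      by (simp add: diff_conv_add_uminus add.assoc minus_add del: add_uminus_conv_diff)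
    also have "\<dots> = c1 x y + (a2 (cm x y) + v - a2 (cm x y)) - c1 x y"
      unfolding e v_def by (simp add: diff_conv_add_uminus add.assoc minus_add del: add_uminus_conv_diff)
    finally show ?thesis .
  qed
  ultimately show ?thesis by (simp add: v_def)
qed

text \<open>The first factor of the commutator of \<open>x\<close> with the word
  \<open>h\<close>.\<close>

definition Dv :: "nat \<times> bool \<Rightarrow> nat word \<Rightarrow> 'h" where
  "Dv x h = lv T a1 (comm_list cm x h)"

lemma Dv_simps [simp]: "Dv x [] = 0" "Dv x (y # h) = c1 x y + cj y (Dv x h)"
  by (simp_all add: Dv_def lv_shift)

lemma Dv_append: "Dv x (u @ v) = Dv x u + (ev T u + Dv x v - ev T u)"
  by (induction u) (simp_all add: diff_conv_add_uminus add.assoc minus_add del: add_uminus_conv_diff)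

lemma Dv_Z: "fst x < d \<Longrightarrow> tword d u \<Longrightarrow> Dv x u \<in> Z"
  by (induction u) (auto intro!: Z_simps(2) cj_Z c1_Z simp: Z_simps(1))

text \<open>Identities among commutators of at most three letters of length one, valid in the first
  copy because they hold in the group.\<close>

lemma small_identity:
  assumes "small d A 6 L" "lvG L = 0"
  shows "lv T a1 L = 0"
proof -
  have "small d A M L" using assms(1) M(2) by (fastforce simp: small_def)
  then show ?thesis using small_rel assms(2) by blast
qed

context
  fixes x y z :: "nat \<times> bool"
  assumes xyz: "fst x < d" "fst y < d" "fst z < d"
begin

lemma cm_simps: "lval tG x = lval t x" "lval tG y = lval t y" "lval tG z = lval t z"
  "aG (cm x y) = cm x y" "aG (cm y x) = cm y x" "aG (cm x (inv_letter y)) = cm x (inv_letter y)"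
  "aG (cm (inv_letter x) y) = cm (inv_letter x) y"
  "aG (cm x z) = cm x z" "aG (cm y z) = cm y z"
  using xyz by (simp_all add: lval_tG cm_A)

lemma c1_inv_right: "c1 x y + cj y (c1 x (inv_letter y)) = 0"
proof -
  have "lv T a1 [([], (cm x y, True)), ([y], (cm x (inv_letter y), True))] = 0"
    by (intro small_identity)
      (simp_all add: small_def cm_A xyz cm_simps, simp add: cm_def diff_conv_add_uminus add.assoc minus_add
        del: add_uminus_conv_diff)
  then show ?thesis by simp
qed

lemma c1_inv_left: "cj (inv_letter x) (c1 x y) + c1 (inv_letter x) y = 0"
proof -
  have "lv T a1 [([inv_letter x], (cm x y, True)), ([], (cm (inv_letter x) y, True))] = 0"
    by (intro small_identity)
      (simp_all add: small_def cm_A xyz cm_simps, simp add: cm_def diff_conv_add_uminus add.assoc minus_add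
        del: add_uminus_conv_diff)
  then show ?thesis by simp
qed

lemma c1_flip: "c1 x y = - c1 y x"
proof -
  have "lv T a1 [([], (cm x y, True)), ([], (cm y x, True))] = 0"
    by (intro small_identity)
      (simp_all add: small_def cm_A xyz cm_simps, simp add: cm_def diff_conv_add_uminus add.assoc minus_add
        del: add_uminus_conv_diff)
  then show ?thesis by (simp add: eq_neg_iff_add_eq_0)
qed

lemma c1_same: "fst x = fst y \<Longrightarrow> c1 x y = 0"
proof -
  assume "fst x = fst y"
  then have "cm x y = 0" by (auto simp: cm_def lval_def)
  then have "lv T a1 [([], (cm x y, True))] = 0"
    using cm_A[OF xyz(1,2)] cm_simps(4) by (intro small_identity) (auto simp: small_def)
  then show ?thesis by simp
qed

text \<open>The sides are the corrections that arise when y x z is reordered to z x y in the two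
  possible ways. They agree in the given group, and as a list of six entries the identity passes to
  the first copy.\<close>

lemma c1_hall_witt:
  "c1 y x + cj x (c1 y z) + c1 x z = cj y (c1 x z) + c1 y z + cj z (c1 y x)"
proof -
  have "lv T a1 [([], (cm y x, True)), ([x], (cm y z, True)), ([], (cm x z, True)),
      ([z], (cm y x, False)), ([], (cm y z, False)), ([y], (cm x z, False))] = 0"
    by (intro small_identity)
      (simp_all add: small_def cm_A xyz cm_simps, simp add: cm_def diff_conv_add_uminus add.assoc minus_add
        del: add_uminus_conv_diff)
  then have "(c1 y x + cj x (c1 y z) + c1 x z) - (cj y (c1 x z) + c1 y z + cj z (c1 y x)) = 0"
    by (simp add: diff_conv_add_uminus add.assoc minus_add del: add_uminus_conv_diff)
  then show ?thesis by simp
qed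

end

lemma Dv_cancel:
  assumes "fst x < d" "fst y < d"
  shows "Dv x (u @ y # inv_letter y # v) = Dv x (u @ v)"
proof -
  have "Dv x (y # inv_letter y # v) = (c1 x y + cj y (c1 x (inv_letter y))) + Dv x v"
    by (simp add: diff_conv_add_uminus add.assoc minus_add del: add_uminus_conv_diff)
  then show ?thesis using c1_inv_right[OF assms assms(2)] by (simp only: Dv_append) simp
qed

lemma Dv_inv:
  assumes "fst x < d" "tword d u"
  shows "cj (inv_letter x) (Dv x u) + Dv (inv_letter x) u = 0"
  using assms(2)
proof (induction u)
  case (Cons y u)
  define x' where "x' = inv_letter x"
  have x': "fst x' < d" using assms(1) by (simp add: x'_def)
  have y: "fst y < d" and u: "tword d u" using Cons.prems by simp_all
  have "cj x' (Dv x (y # u)) = cj x' (c1 x y) + cj x' (cj y (Dv x u))"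
    by (simp add: diff_conv_add_uminus add.assoc minus_add del: add_uminus_conv_diff)
  also have "cj x' (c1 x y) = - c1 x' y"
    using c1_inv_left[OF assms(1) y y] by (simp add: x'_def eq_neg_iff_add_eq_0)
  also have "cj x' (cj y (Dv x u)) = c1 x' y + cj y (cj x' (Dv x u)) - c1 x' y"
    using x' y u assms(1) by (intro cj_swap Dv_Z)
  finally have "cj x' (Dv x (y # u)) + Dv x' (y # u) = cj y (cj x' (Dv x u) + Dv x' u)"
    by (simp add: diff_conv_add_uminus add.assoc minus_add del: add_uminus_conv_diff)
  then show ?case using Cons.IH[OF u] by (simp add: x'_def)
qed simp

lemma cj_swap_word:
  assumes "fst x < d" "tword d u" "n \<in> Z"
  shows "cj x (ev T u + n - ev T u) = Dv x u + (ev T u + cj x n - ev T u) - Dv x u"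
  using assms(2)
proof (induction u)
  case (Cons y u)
  have y: "fst y < d" and u: "tword d u" using Cons.prems by simp_all
  define m where "m = ev T u + n - ev T u"
  have "cj x (ev T (y # u) + n - ev T (y # u)) = cj x (cj y m)"
    by (simp add: m_def diff_conv_add_uminus add.assoc minus_add del: add_uminus_conv_diff)
  also have "\<dots> = c1 x y + cj y (cj x m) - c1 x y"
    using cj_word_Z[OF u assms(3)] by (intro cj_swap assms(1) y) (simp add: m_def)
  also have "cj x m = Dv x u + (ev T u + cj x n - ev T u) - Dv x u" using Cons.IH[OF u] by (simp add: m_def)
  finally show ?case by (simp add: diff_conv_add_uminus add.assoc minus_add del: add_uminus_conv_diff)
qed simp

text \<open>The Hall-Witt identity with the letter \<open>z\<close> replaced by a word: the two ways
  of reordering \<open>y # x # u\<close> to \<open>u @ [x, y]\<close>.\<close>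

lemma Dv_swap:
  assumes xy: "fst x < d" "fst y < d" and "tword d u"
  shows "Dv y (x # u) + Dv x u = cj y (Dv x u) + Dv y (u @ [x])"
  using assms(3)
proof (induction u)
  case (Cons z u)
  have z: "fst z < d" and u: "tword d u" using Cons.prems by simp_all
  define p q w where "p = Dv x u" and "q = Dv y u" and "w = ev T u + c1 y x - ev T u"
  have pq: "p \<in> Z" "q \<in> Z" using u xy by (simp_all add: p_def q_def Dv_Z)
  have Dapp: "Dv y (u @ [x]) = q + w" by (simp add: Dv_append q_def w_def)
  have IH: "c1 y x + cj x q + p = cj y p + (q + w)"
    using Cons.IH[OF u] by (simp add: Dapp flip: p_def q_def)
  have "Dv y (x # z # u) + Dv x (z # u) = c1 y x + cj x (c1 y z) + (cj x (cj z q) + (c1 x z + cj z p))"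
    by (simp add: p_def q_def diff_conv_add_uminus add.assoc minus_add del: add_uminus_conv_diff)
  also have "cj x (cj z q) = c1 x z + cj z (cj x q) - c1 x z" using xy z pq by (intro cj_swap)
  also have "c1 y x + cj x (c1 y z) + (c1 x z + cj z (cj x q) - c1 x z + (c1 x z + cj z p))
      = (c1 y x + cj x (c1 y z) + c1 x z) + cj z (cj x q + p)"
    by (simp add: diff_conv_add_uminus add.assoc minus_add del: add_uminus_conv_diff)
  also have "c1 y x + cj x (c1 y z) + c1 x z = cj y (c1 x z) + c1 y z + cj z (c1 y x)"
    by (rule c1_hall_witt[OF xy z])
  also have "cj y (c1 x z) + c1 y z + cj z (c1 y x) + cj z (cj x q + p)
      = cj y (c1 x z) + c1 y z + cj z (c1 y x + cj x q + p)"
    by (simp add: diff_conv_add_uminus add.assoc minus_add del: add_uminus_conv_diff)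
  also have "\<dots> = cj y (c1 x z) + (c1 y z + cj z (cj y p) - c1 y z) + (c1 y z + cj z (q + w))"
    unfolding IH by (simp add: diff_conv_add_uminus add.assoc minus_add del: add_uminus_conv_diff)
  also have "c1 y z + cj z (cj y p) - c1 y z = cj y (cj z p)"
    using xy z pq by (intro cj_swap[symmetric])
  also have "cj y (c1 x z) + cj y (cj z p) + (c1 y z + cj z (q + w)) = cj y (Dv x (z # u)) + Dv y ((z # u) @ [x])"
    by (simp add: Dapp p_def diff_conv_add_uminus add.assoc minus_add del: add_uminus_conv_diff)
  finally show ?case .
qed simp

text \<open>The group acts on \<open>Z \<times> \<int>\<^sup>d\<close> as if \<open>Z\<close> were the kernel of an extension by \<open>\<int>\<^sup>d\<close>; the word \<open>wpre d p\<close>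
  represents \<open>p\<close> there.\<close>

definition act :: "nat \<times> bool \<Rightarrow> 'h \<times> (nat \<Rightarrow> int) \<Rightarrow> 'h \<times> (nat \<Rightarrow> int)" where
  "act x = (\<lambda>(n, p). (cj x n + Dv x (wpre (fst x) p), p + lval (tvec d) x))"

lemma wpre_act: "i \<le> fst x \<Longrightarrow> wpre i (p + lval (tvec d) x) = wpre i p"
  by (rule wpre_cong) (auto simp: plus_fun_apply lval_def tvec_def zero_fun_apply)

lemma act_Z: "fst x < d \<Longrightarrow> fst \<omega> \<in> Z \<Longrightarrow> fst (act x \<omega>) \<in> Z"
  by (auto simp: act_def split: prod.splits intro!: Z_simps(2) cj_Z Dv_Z tword_wpre)

lemma act_inv:
  assumes x: "fst x < d"
  shows "act (inv_letter x) (act x \<omega>) = \<omega>"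
proof -
  obtain n p where \<omega>: "\<omega> = (n, p)" by (cases \<omega>)
  define u where "u = wpre (fst x) p"
  have "cj (inv_letter x) (cj x n + Dv x u) + Dv (inv_letter x) u
      = n + (cj (inv_letter x) (Dv x u) + Dv (inv_letter x) u)"
    by (simp add: diff_conv_add_uminus add.assoc minus_add del: add_uminus_conv_diff)
  also have "\<dots> = n" using Dv_inv[OF x, of u] x by (simp add: u_def tword_wpre)
  finally show ?thesis
    by (simp add: act_def \<omega> u_def[symmetric] wpre_act add.assoc)
qed

lemma act_translate: "act x (m + n, p) = (cj x m + fst (act x (n, p)), snd (act x (n, p)))"
  by (simp add: act_def diff_conv_add_uminus add.assoc minus_add del: add_uminus_conv_diff)

text \<open>A step in coordinate \<open>fst x\<close> inserts \<open>x\<close> behind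
  \<open>wpre (fst x) p\<close> or cancels a letter there. \<open>Dv\<close> does not see cancelling
  pairs, so both cases look like an insertion.\<close>

lemma Dv_wpre_step:
  assumes xy: "fst x < d" "fst y < d" "fst x < fst y"
  obtains w where "tword d w" "Dv y (wpre (fst y) p) = Dv y (wpre (fst x) p @ w)"
    "Dv y (wpre (fst y) (p + lval (tvec d) x)) = Dv y (wpre (fst x) p @ [x] @ w)"
proof -
  obtain i b where x: "x = (i, b)" by (cases x)
  define rest where "rest = concat (map (\<lambda>j. tpow j (p j)) [Suc i..<fst y])"
  define s :: int where "s = (if b then 1 else - 1)"
  have step: "(p + lval (tvec d) x) j = p j + (if j = i then s else 0)" for j
    using xy by (auto simp: x s_def plus_fun_apply lval_def tvec_def)
  have e1: "wpre (fst y) p = wpre i p @ tpow i (p i) @ rest"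
    using wpre_split[of i "fst y" p] xy by (simp add: x rest_def)
  have "concat (map (\<lambda>j. tpow j ((p + lval (tvec d) x) j)) [Suc i..<fst y]) = rest"
    unfolding rest_def by (intro arg_cong[of _ _ concat] map_cong) (auto simp: step)
  then have e2: "wpre (fst y) (p + lval (tvec d) x) = wpre i p @ tpow i (p i + s) @ rest"
    using wpre_split[of i "fst y" "p + lval (tvec d) x"] xy wpre_act[of i x p] by (simp add: x step[unfolded x])
  have tw: "tword d (tpow i (p i) @ rest)"
    using tword_wpre[of "fst y" d p] xy by (simp add: e1)
  show ?thesis
  proof (rule that[of "tpow i (p i) @ rest"])
    show "Dv y (wpre (fst y) (p + lval (tvec d) x)) = Dv y (wpre (fst x) p @ [x] @ tpow i (p i) @ rest)"
      using tpow_step[OF s_def, of i "p i"]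
    proof
      assume "tpow i (p i + s) = (i, b) # tpow i (p i)"
      then show ?thesis by (simp add: e2[unfolded x] x)
    next
      assume "tpow i (p i) = inv_letter (i, b) # tpow i (p i + s)"
      then show ?thesis
        using Dv_cancel[of y x "wpre i p" "tpow i (p i + s) @ rest"] xy by (simp add: e2[unfolded x] x)
    qed
  qed (use tw e1 x in simp_all)
qed

text \<open>The commutator relation for the action. The part \<open>u\<close> of the normal word
  passed by both letters is handled by \<open>Dv_swap\<close>; the rest \<open>w\<close>, passed by
  \<open>y\<close> only, contributes the same \<open>v\<close> in both orders.\<close>

lemma act_comm_less:
  assumes xy: "fst x < d" "fst y < d" "fst x < fst y" and n: "n \<in> Z"
  shows "act x (act y (n, p)) = (c1 x y + fst (act y (act x (n, p))), snd (act y (act x (n, p))))"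
proof -
  define u where "u = wpre (fst x) p"
  obtain w where w: "tword d w" "Dv y (wpre (fst y) p) = Dv y (u @ w)"
    "Dv y (wpre (fst y) (p + lval (tvec d) x)) = Dv y (u @ [x] @ w)"
    using Dv_wpre_step[OF xy, of p] unfolding u_def by blast
  have u: "tword d u" using xy by (simp add: u_def tword_wpre)
  define v where "v = ev T u + cj x (Dv y w) - ev T u"
  have "cj x (ev T u + Dv y w - ev T u) = Dv x u + v - Dv x u"
    unfolding v_def using w(1) xy u by (intro cj_swap_word Dv_Z)
  then have 1: "cj x (Dv y (u @ w)) = cj x (Dv y u) + (Dv x u + v - Dv x u)"
    by (simp only: Dv_append cj_add)
  have 2: "Dv y (u @ [x] @ w) = Dv y (u @ [x]) + v"
    by (simp add: Dv_append v_def diff_conv_add_uminus add.assoc minus_add del: add_uminus_conv_diff)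
  have 3: "c1 y x + cj x (Dv y u) + Dv x u = cj y (Dv x u) + Dv y (u @ [x])"
    using Dv_swap[OF xy(1,2) u] by simp
  have flip: "c1 x y = - c1 y x" using xy by (intro c1_flip)
  have "cj x (cj y n + Dv y (u @ w)) + Dv x u = cj x (cj y n) + (cj x (Dv y u) + Dv x u + v)"
    using 1 by (simp add: diff_conv_add_uminus add.assoc minus_add del: add_uminus_conv_diff)
  also have "cj x (cj y n) = c1 x y + cj y (cj x n) - c1 x y" using xy n by (intro cj_swap)
  also have "c1 x y + cj y (cj x n) - c1 x y + (cj x (Dv y u) + Dv x u + v)
      = c1 x y + cj y (cj x n) + (c1 y x + cj x (Dv y u) + Dv x u) + v"
    unfolding flip by (simp add: diff_conv_add_uminus add.assoc minus_add del: add_uminus_conv_diff)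
  also have "\<dots> = c1 x y + (cj y (cj x n + Dv x u) + Dv y (u @ [x] @ w))"
    unfolding 2 3 by (simp add: diff_conv_add_uminus add.assoc minus_add del: add_uminus_conv_diff)
  finally have main: "cj x (cj y n + Dv y (u @ w)) + Dv x u = c1 x y + (cj y (cj x n + Dv x u) + Dv y (u @ [x] @ w))" .
  have "act y (n, p) = (cj y n + Dv y (u @ w), p + lval (tvec d) y)"
    by (simp only: act_def prod.case w(2))
  moreover have "wpre (fst x) (p + lval (tvec d) y) = u" using xy by (simp add: u_def wpre_act)
  moreover have "act x (n, p) = (cj x n + Dv x u, p + lval (tvec d) x)"
    by (simp add: act_def u_def)
  ultimately show ?thesis
    using main by (simp only: act_def prod.case fst_conv snd_conv w(3) add.assoc)
      (simp add: add.commute)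
qed

end

section \<open>The permutation action and the injectivity of both copies\<close>

definition entries :: "nat \<Rightarrow> 'k set \<Rightarrow> (nat word \<times> 'k \<times> bool) list \<Rightarrow> bool" where
  "entries d A L \<longleftrightarrow> (\<forall>(P, k)\<in>set L. tword d P \<and> fst k \<in> A)"

lemma entries_simps [simp]:
  "entries d A []" "entries d A ((P, k) # L) \<longleftrightarrow> tword d P \<and> fst k \<in> A \<and> entries d A L"
  "entries d A (L @ L') \<longleftrightarrow> entries d A L \<and> entries d A L'"
  by (auto simp: entries_def)

lemma entries_shift: "tword d h \<Longrightarrow> entries d A L \<Longrightarrow> entries d A (shift h L)"
  by (induction L) auto

context zd_double
begin

definition Dom :: "('h \<times> (nat \<Rightarrow> int)) set" where
  "Dom = Z \<times> UNIV"

definition actT :: "nat \<Rightarrow> ('h \<times> (nat \<Rightarrow> int)) sym" where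
  "actT i = (if i < d then perm_on Dom (act (i, True)) else 0)"

definition actA :: "'g \<Rightarrow> ('h \<times> (nat \<Rightarrow> int)) sym" where
  "actA k = (if k \<in> A then perm_on Dom (\<lambda>(n, p). (a1 k + n, p)) else 0)"

lemma act_Dom: "fst x < d \<Longrightarrow> \<omega> \<in> Dom \<Longrightarrow> act x \<omega> \<in> Dom"
  using act_Z[of x \<omega>] by (auto simp: Dom_def mem_Times_iff)

lemma act_bij: "fst x < d \<Longrightarrow> bij_betw (act x) Dom Dom"
  using act_inv[of x] act_inv[of "inv_letter x"] act_Dom[of x] act_Dom[of "inv_letter x"]
  by (intro bij_betw_byWitness[of _ "act (inv_letter x)"]) (simp_all add: image_subset_iff)

lemma apply_actT:
  assumes "fst x < d"
  shows "apply_sym (lval actT x) \<omega> = (if \<omega> \<in> Dom then act x \<omega> else \<omega>)"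
proof (cases "snd x")
  case True
  then have "lval actT x = perm_on Dom (act x)" using assms by (cases x) (simp add: actT_def)
  then show ?thesis by (simp add: apply_perm_on[OF act_bij[OF assms]])
next
  case False
  then have x: "lval actT x = - perm_on Dom (act (inv_letter x))"
    using assms by (cases x) (simp add: actT_def inv_letter_def)
  have "act (inv_letter x) (act x \<omega>) = \<omega>" by (rule act_inv[OF assms])
  then show ?thesis
    using act_bij[of "inv_letter x"] assms act_Dom[OF assms, of \<omega>]
    by (auto simp: x apply_sym_uminus_eq_iff apply_perm_on)
qed

lemma apply_actA:
  assumes "fst k \<in> A"
  shows "apply_sym (lval actA k) (n, p) = (if n \<in> Z then (lval a1 k + n, p) else (n, p))"
proof -
  have bij: "bij_betw (\<lambda>(n, p). (a1 (fst k) + n, p)) Dom Dom"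
    using a1_Z[OF assms] Z_simps
    by (intro bij_betw_byWitness[of _ "\<lambda>(n, p). (- a1 (fst k) + n, p)"]) (auto simp: Dom_def)
  have *: "apply_sym (actA (fst k)) (n, p) = (if n \<in> Z then (a1 (fst k) + n, p) else (n, p))" for n p
    using assms by (simp add: actA_def apply_perm_on[OF bij]) (simp add: Dom_def)
  show ?thesis
  proof (cases "snd k")
    case False
    have "n \<in> Z \<Longrightarrow> - a1 (fst k) + n \<in> Z" using a1_Z[OF assms] Z_simps by blast
    then show ?thesis using False by (auto simp: lval_def apply_sym_uminus_eq_iff *)
  qed (simp add: lval_def *)
qed

lemma lval_actT_comm:
  assumes xy: "fst x < d" "fst y < d"
  shows "lval actT x + lval actT y = actA (cm x y) + lval actT y + lval actT x"
proof -
  have less: "lval actT x + lval actT y = actA (cm x y) + lval actT y + lval actT x"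
    if xy: "fst x < d" "fst y < d" "fst x < fst y" for x y
  proof (rule sym_eqI)
    fix \<omega> :: "'h \<times> (nat \<Rightarrow> int)"
    obtain n p where \<omega>: "\<omega> = (n, p)" by (cases \<omega>)
    have cA: "cm x y \<in> A" using xy by (intro cm_A)
    have k: "apply_sym (actA (cm x y)) (m, q) = (if m \<in> Z then (c1 x y + m, q) else (m, q))" for m q
      using apply_actA[of "(cm x y, True)"] cA by simp
    show "apply_sym (lval actT x + lval actT y) \<omega> = apply_sym (actA (cm x y) + lval actT y + lval actT x) \<omega>"
    proof (cases "n \<in> Z")
      case True
      have "(n, p) \<in> Dom" using True by (simp add: Dom_def)
      then have D: "act x (n, p) \<in> Dom" "act y (n, p) \<in> Dom" "(n, p) \<in> Dom"
        using xy by (simp_all only: act_Dom)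
      have "act y (act x (n, p)) \<in> Dom" using D xy by (intro act_Dom)
      then have "fst (act y (act x (n, p))) \<in> Z" by (simp add: Dom_def mem_Times_iff)
      then have "apply_sym (actA (cm x y)) (act y (act x (n, p))) = act x (act y (n, p))"
        using act_comm_less[OF xy True, of p] k[of "fst (act y (act x (n, p)))" "snd (act y (act x (n, p)))"] by simp
      then show ?thesis using xy D by (simp add: \<omega> apply_actT)
    next
      case False
      then have "(n, p) \<notin> Dom" by (simp add: Dom_def)
      then show ?thesis using xy False by (simp add: \<omega> apply_actT k)
    qed
  qed
  have k0: "actA (cm x y) + actA (cm y x) = 0"
  proof (rule sym_eqI)
    fix \<omega> :: "'h \<times> (nat \<Rightarrow> int)"
    obtain n p where \<omega>: "\<omega> = (n, p)" by (cases \<omega>)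
    have flip: "c1 x y = - c1 y x" using xy by (intro c1_flip)
    have "n \<in> Z \<Longrightarrow> c1 y x + n \<in> Z" using Z_simps(2) c1_Z xy by blast
    then show "apply_sym (actA (cm x y) + actA (cm y x)) \<omega> = apply_sym 0 \<omega>"
      using apply_actA[of "(cm x y, True)"] apply_actA[of "(cm y x, True)"] cm_A xy
      by (simp add: \<omega> flip)
  qed
  consider "fst x < fst y" | "fst y < fst x" | "fst x = fst y" by linarith
  then show ?thesis
  proof cases
    case 1
    then show ?thesis by (intro less xy)
  next
    case 2
    have "actA (cm x y) + (lval actT y + lval actT x) = (actA (cm x y) + actA (cm y x)) + (lval actT x + lval actT y)"
      using less[OF xy(2,1) 2] by (simp add: add.assoc)
    then show ?thesis by (simp add: k0 add.assoc)
  next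
    case 3
    have "cm x y = cm y x" using 3 by (auto simp: cm_def lval_def)
    then have c0: "c1 x y = 0" using c1_same xy 3 by blast
    have "actA (cm x y) = 0"
    proof (rule sym_eqI)
      fix \<omega> :: "'h \<times> (nat \<Rightarrow> int)"
      show "apply_sym (actA (cm x y)) \<omega> = apply_sym 0 \<omega>"
        using apply_actA[of "(cm x y, True)"] cm_A xy c0 by (cases \<omega>) simp
    qed
    moreover have "lval actT x + lval actT y = lval actT y + lval actT x" using 3 by (auto simp: lval_def)
    ultimately show ?thesis by simp
  qed
qed

definition actE :: "nat + 'g \<Rightarrow> ('h \<times> (nat \<Rightarrow> int)) sym" where
  "actE = case_sum actT actA"

sublocale E: commuting_lifts d A cm actE
proof
  fix x y :: "nat \<times> bool" assume xy: "fst x < d" "fst y < d"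
  have "lval actT x + lval actT y - lval actT x - lval actT y = actA (cm x y)"
    unfolding lval_actT_comm[OF xy] by simp
  then show "lval (\<lambda>i. actE (Inl i)) x + lval (\<lambda>i. actE (Inl i)) y - lval (\<lambda>i. actE (Inl i)) x
      - lval (\<lambda>i. actE (Inl i)) y = actE (Inr (cm x y))"
    by (simp add: actE_def)
next
  fix y assume "y \<notin> alph d A"
  then show "actE y = 0" by (auto simp: actE_def alph_def actT_def actA_def split: sum.splits)
qed (rule cm_A)

lemma actT_word_translate:
  assumes "tword d h" "m \<in> Z" "n \<in> Z"
  shows "apply_sym (ev actT h) (n, p) \<in> Dom \<and> apply_sym (ev actT h) (m + n, p) =
    (ev T h + m - ev T h + fst (apply_sym (ev actT h) (n, p)), snd (apply_sym (ev actT h) (n, p)))"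
  using assms(1)
proof (induction h)
  case Nil
  then show ?case using assms by (simp add: Dom_def)
next
  case (Cons x h)
  define \<omega> where "\<omega> = apply_sym (ev actT h) (n, p)"
  have \<omega>: "\<omega> \<in> Dom" using Cons by (simp add: \<omega>_def)
  then have fz: "fst \<omega> \<in> Z" by (simp add: Dom_def mem_Times_iff)
  have x: "fst x < d" "tword d h" using Cons.prems by simp_all
  have "ev T h + m - ev T h \<in> Z" using cj_word_Z x assms by blast
  then have D: "(ev T h + m - ev T h + fst \<omega>, snd \<omega>) \<in> Dom" using fz Z_simps(2) by (simp add: Dom_def)
  have "apply_sym (ev actT (x # h)) (m + n, p) = act x (ev T h + m - ev T h + fst \<omega>, snd \<omega>)"
    using Cons x D by (simp add: apply_actT \<omega>_def)
  also have "\<dots> = (cj x (ev T h + m - ev T h) + fst (act x \<omega>), snd (act x \<omega>))"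
    by (simp add: act_translate)
  finally show ?case
    using x \<omega> act_Dom[OF x(1) \<omega>]
    by (simp add: apply_actT flip: \<omega>_def) (simp add: diff_conv_add_uminus add.assoc minus_add del: add_uminus_conv_diff)
qed

text \<open>A translation of the first component, conjugated by a word in the lifts, is the
  translation by the conjugated element (\<open>actT_word_translate\<close>). So the value of a list
  in the first copy can be read off from its action.\<close>

lemma lv_act:
  assumes "entries d A L" "n \<in> Z"
  shows "lv T a1 L \<in> Z \<and> apply_sym (lv actT actA L) (n, p) = (lv T a1 L + n, p)"
  using assms(1)
proof (induction L)
  case Nil
  then show ?case using Z_simps(1) by simp
next
  case (Cons e L)
  obtain P k where e: "e = (P, k)" by (cases e)
  have P: "tword d P" "fst k \<in> A" and IH: "lv T a1 L \<in> Z" "apply_sym (lv actT actA L) (n, p) = (lv T a1 L + n, p)"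
    using Cons by (auto simp: e)
  define m where "m = lv T a1 L + n"
  have m: "m \<in> Z" using IH assms Z_simps(2) by (simp add: m_def)
  define \<omega> where "\<omega> = apply_sym (- ev actT P) (m, p)"
  have \<omega>: "fst \<omega> \<in> Z"
    using actT_word_translate[of "winv P" 0 m p] P m Z_simps(1)
    by (simp add: \<omega>_def Dom_def mem_Times_iff)
  have kZ: "lval a1 k \<in> Z" using a1_Z P Z_simps by (simp add: lval_def)
  have ret: "apply_sym (ev actT P) (fst \<omega>, snd \<omega>) = (m, p)"
    using apply_sym_uminus_eq_iff[of "ev actT P" "(m, p)" \<omega>] by (simp add: \<omega>_def)
  have "apply_sym (ev actT P + lval actA k - ev actT P) (m, p) = apply_sym (ev actT P) (lval a1 k + fst \<omega>, snd \<omega>)"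
    using apply_actA[OF P(2), of "fst \<omega>" "snd \<omega>"] \<omega>
    by (simp add: diff_conv_add_uminus del: add_uminus_conv_diff flip: \<omega>_def)
  also have "\<dots> = (ev T P + lval a1 k - ev T P + m, p)"
    using actT_word_translate[OF P(1) kZ \<omega>, of "snd \<omega>"] ret by simp
  finally have "apply_sym (ev actT P + lval actA k - ev actT P) (m, p) = \<dots>" .
  then show ?case
    using IH cj_word_Z[OF P(1) kZ] Z_simps(2) by (simp add: e m_def add.assoc)
qed

lemma lv_act_outside:
  assumes "n \<notin> Z"
  shows "apply_sym (ev actE w) (n, p) = (n, p)"
proof (induction w)
  case (Cons l w)
  have "apply_sym (actE y) (n, p) = (n, p)" for y
    using assms apply_actT[of "(_, True)" "(n, p)"] apply_actA[of "(_, True)" n p]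
    by (cases y) (auto simp: actE_def actT_def actA_def Dom_def)
  then show ?case using Cons by (auto simp: lval_def apply_sym_uminus_eq_iff)
qed simp

lemma comm_relators_sound:
  fixes f :: "nat + 'g \<Rightarrow> 'u::group_add"
  assumes "commuting_lifts d A cm f" "eqv (alph d A) (comm_relators d cm) v w"
  shows "ev f v = ev f w"
proof (rule eqv_sound[OF _ _ assms(2)])
  interpret f: commuting_lifts d A cm f by (rule assms(1))
  show "f y = 0" if "y \<notin> alph d A" for y using that by (rule f.e_out)
  fix r assume "r \<in> comm_relators d cm"
  then obtain x y where r: "r = inl [x, y, inv_letter x, inv_letter y] @ [(Inr (cm x y), False)]" "fst x < d" "fst y < d"
    by (auto simp: comm_relators_def)
  have "ev f (inl [x, y, inv_letter x, inv_letter y]) = f (Inr (cm x y))"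
    unfolding ev_inl f.e_comm[OF r(2,3), symmetric]
    by (simp add: diff_conv_add_uminus add.assoc del: add_uminus_conv_diff)
  then show "ev f r = 0" by (simp add: r(1))
qed

text \<open>Modulo the commutator relators, a relator is a small list that is trivial in the given
  group. By \<open>small_rel\<close> it is trivial in the first copy, so it translates by 0.\<close>

lemma actE_eqv: "eqv (alph d A) R v w \<Longrightarrow> ev actE v = ev actE w"
proof (rule eqv_sound)
  show "actE y = 0" if "y \<notin> alph d A" for y using that by (rule E.e_out)
  fix r assume r: "r \<in> R"
  obtain L where L: "eqv (alph d A) (comm_relators d cm) r (lword L)" "small d A M L" using R_small[OF r] by blast
  have "evG (lword L) = 0"
    using comm_relators_sound[OF G.commuting_lifts_axioms L(1)] presentsD(5)[OF pres r] by simp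
  then have "lv T a1 L = 0" using small_rel[OF L(2)] by (simp add: evG_lword)
  have ent: "entries d A L" using L(2) by (auto simp: small_def entries_def)
  show "ev actE r = 0"
  proof (rule sym_eqI)
    fix \<omega> :: "'h \<times> (nat \<Rightarrow> int)"
    obtain n p where \<omega>: "\<omega> = (n, p)" by (cases \<omega>)
    show "apply_sym (ev actE r) \<omega> = apply_sym 0 \<omega>"
    proof (cases "n \<in> Z")
      case True
      have "ev actE r = lv actT actA L"
        using comm_relators_sound[OF E.commuting_lifts_axioms L(1)] by (simp add: ev_lword) (simp add: actE_def)
      then show ?thesis using lv_act[OF ent True, of p] \<open>lv T a1 L = 0\<close> by (simp add: \<omega>)
    qed (simp add: \<omega> lv_act_outside)
  qed
qed

text \<open>The given group acts, so a list that is trivial there acts trivially; but it moves 0 to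
  its value in the first copy.\<close>

lemma first_copy_injective:
  assumes "entries d A L" "lvG L = 0"
  shows "lv T a1 L = 0"
proof -
  have "eqv (alph d A) R (lword L) []"
    using assms(2) presentsD(4)[OF pres, of "lword L"] by (simp add: evG_lword)
  then have "ev actE (lword L) = 0" using actE_eqv by fastforce
  then have "lv actT actA L = 0" by (simp add: ev_lword) (simp add: actE_def)
  then show ?thesis using lv_act[OF assms(1) Z_simps(1), of 0] by simp
qed

lemma zd_double_swap: "zd_double d t A R S T a2 a1 M0 M"
proof (unfold_locales, fact contr, fact M(1), fact M(2))
  show "\<exists>L. eqv (alph d A) (comm_relators d cm) r (lword L) \<and> small d A M L" if "r \<in> R" for r
    using that by (rule R_small)
  show "lv T a2 L = 0 \<and> lv T a1 L = 0" if "small d A M L" "lvG L = 0" for L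
    using small_rel[OF that] by blast
  show "comm_at T a2 a1 A h" if "tword d h" "length h \<le> M" for h
    using short_comm[of "winv h"] that comm_at_swap[of T a1 a2 A "winv h"] by simp
  fix x y :: "nat \<times> bool" assume xy: "fst x < d" "fst y < d"
  have "cmt (a1 (cm x y)) (a2 (cm x y))"
    using short_comm[of "[]"] cm_A[OF xy] by (auto simp: comm_at_def)
  then show "lval T x + lval T y - lval T x - lval T y = a2 (cm x y) + a1 (cm x y)"
    using T_comm[OF xy] by (simp add: cmt_def)
qed

lemma second_copy_injective:
  assumes "entries d A L" "lvG L = 0"
  shows "lv T a2 L = 0"
proof -
  interpret sw: zd_double d t A R S T a2 a1 M0 M by (rule zd_double_swap)
  show ?thesis by (rule sw.first_copy_injective[OF assms])
qed

lemma copies_commute: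
  assumes "entries d A L" "entries d A L'"
  shows "cmt (lv T a1 L) (lv T a2 L')"
  using assms(2)
proof (induction L')
  case (Cons e L')
  obtain P k where e: "e = (P, k)" by (cases e)
  have "lv T a1 L \<in> Z" using lv_act[OF assms(1) Z_simps(1)] by blast
  then have *: "cmt (lv T a1 L) (ev T P + a2 (fst k) - ev T P)" using Cons.prems by (auto simp: Z_def e)
  have "cmt (lv T a1 L) (ev T P + lval a2 k - ev T P)"
  proof (cases "snd k")
    case False
    have "ev T P + - a2 (fst k) - ev T P = - (ev T P + a2 (fst k) - ev T P)"
      by (simp add: diff_conv_add_uminus add.assoc minus_add del: add_uminus_conv_diff)
    then show ?thesis using * False by (simp only: lval_def if_False cmt_uminus)
  qed (use * in \<open>simp add: lval_def\<close>)
  then show ?case using Cons unfolding e lv_simps by (intro cmt_add) auto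
qed simp

text \<open>A closed word in the lifts lies on the diagonal: one list, evaluated in both
  copies.\<close>

lemma T_closed_word:
  assumes "tword d h" "twt d h = 0"
  shows "\<exists>L. entries d A L \<and> ev tG h = lvG L \<and> ev T h = lv T a1 L + lv T a2 L"
proof -
  \<comment> \<open>With the zero functional every word lies in a half space; only the list is
    wanted.\<close>
  obtain c0 where c0: "above d (\<lambda>_. 0) c0 0 (inl h :: (nat + 'g) word)" using above_exists by blast
  obtain L where L: "eqv (alph d A) (comm_relators d cm) (inl h) (lword L)" "entries_ok d (\<lambda>_. 0) c0 A 0 L"
    using closed_word_eqv_conjugates[where c = cm and A = A, OF cm_A c0] assms(2) by (auto simp: wt_inl)
  have ent: "entries d A L" using L(2) by (auto simp: entries_ok_def entries_def)
  define T' where "T' i = (if i < d then T i else 0)" for i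
  \<comment> \<open>Each kernel letter is interpreted by the product of its two copies, which makes
    \<open>T_comm\<close> the commutator relation of \<open>commuting_lifts\<close>.\<close>
  define f where "f = case_sum T' (\<lambda>k. if k \<in> A then a1 k + a2 k else 0)"
  have T': "lval T' x = lval T x" if "fst x < d" for x using that by (simp add: lval_def T'_def)
  have "commuting_lifts d A cm f"
  proof
    fix x y :: "nat \<times> bool" assume xy: "fst x < d" "fst y < d"
    then show "lval (\<lambda>i. f (Inl i)) x + lval (\<lambda>i. f (Inl i)) y - lval (\<lambda>i. f (Inl i)) x
      - lval (\<lambda>i. f (Inl i)) y = f (Inr (cm x y))"
      using T_comm[OF xy] cm_A[OF xy] by (simp add: f_def T')
  next
    fix y assume "y \<notin> alph d A"
    then show "f y = 0" by (auto simp: f_def alph_def T'_def split: sum.splits)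
  qed (rule cm_A)
  from comm_relators_sound[OF this L(1)] have "ev T' h = lv T' (\<lambda>k. if k \<in> A then a1 k + a2 k else 0) L"
    by (simp add: ev_lword ev_inl) (simp add: f_def)
  moreover have ev_T': "ev T' P = ev T P" if "tword d P" for P
    using that by (intro ev_cong) (auto simp: tword_def T'_def)
  moreover have "lv T' (\<lambda>k. if k \<in> A then a1 k + a2 k else 0) L = lv T a1 L + lv T a2 L"
    using ent
  proof (induction L)
    case (Cons e L)
    obtain P k b where e: "e = (P, k, b)" by (cases e)
    have P: "tword d P" "k \<in> A" "entries d A L" using Cons.prems by (auto simp: e)
    have one: "lval (\<lambda>k. if k \<in> A then a1 k + a2 k else 0) (k, b) = lval a1 (k, b) + lval a2 (k, b)"
    proof (cases b)
      case False
      have "cmt (a1 k) (a2 k)" using short_comm[of "[]"] P by (auto simp: comm_at_def)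
      then have "a1 k + a2 k = a2 k + a1 k" by (simp add: cmt_def)
      then show ?thesis using False P by (simp add: minus_add)
    qed (use P in simp)
    define u v where "u = ev T P + lval a2 (k, b) - ev T P" and "v = lv T a1 L"
    have "cmt v u" using copies_commute[of L "[(P, k, b)]"] P by (simp add: u_def v_def)
    have "lv T' (\<lambda>k. if k \<in> A then a1 k + a2 k else 0) (e # L)
        = (ev T P + (lval a1 (k, b) + lval a2 (k, b)) - ev T P) + (lv T a1 L + lv T a2 L)"
      using Cons.IH P by (simp add: e one ev_T' del: lval_Pair)
    also have "\<dots> = (ev T P + lval a1 (k, b) - ev T P) + (u + v) + lv T a2 L"
      by (simp add: u_def v_def diff_conv_add_uminus add.assoc del: add_uminus_conv_diff)
    also have "u + v = v + u" using \<open>cmt v u\<close> by (simp add: cmt_def)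
    finally show ?case by (simp add: e u_def v_def add.assoc)
  qed simp
  moreover have "ev tG h = lvG L"
    using comm_relators_sound[OF G.commuting_lifts_axioms L(1)] by (simp add: evG_inl evG_lword)
  ultimately show ?thesis using assms(1) ent by auto
qed

end

section \<open>The finite presentation of the fibre product\<close>

definition dgen :: "(nat \<Rightarrow> 'h) \<Rightarrow> ('g \<Rightarrow> 'h) \<Rightarrow> ('g \<Rightarrow> 'h) \<Rightarrow> nat + 'g + 'g \<Rightarrow> 'h" where
  "dgen T a1 a2 = case_sum T (case_sum a1 a2)"

lemma dgen_simps [simp]:
  "dgen T a1 a2 (Inl i) = T i" "dgen T a1 a2 (Inr (Inl k)) = a1 k" "dgen T a1 a2 (Inr (Inr k)) = a2 k"
  by (simp_all add: dgen_def)

lemma lval_dgen: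
  "lval (dgen T a1 a2) (Inl i, b) = lval T (i, b)"
  "lval (dgen T a1 a2) (Inr (Inl k), b) = lval a1 (k, b)"
  "lval (dgen T a1 a2) (Inr (Inr k), b) = lval a2 (k, b)"
  by (simp_all add: lval_def)

lemma ev_Pair: "ev (\<lambda>x. (f x, g x)) w = (ev f w, ev g w)"
  by (induction w) (auto simp: lval_def zero_prod_def)

context zd_double
begin

text \<open>Since the copies commute, a word splits into a list in the first copy, a list in the
  second and a word \<open>h\<close> in the lifts. If both projections vanish, \<open>h\<close> has
  weight 0 and is itself a diagonal list \<open>L3\<close>; then \<open>L1 @ L3\<close> and
  \<open>L2 @ L3\<close> are trivial in the given group, hence in their copies.\<close>

theorem double_injective:
  assumes T_out: "\<And>i. \<not> i < d \<Longrightarrow> T i = 0" and a_out: "\<And>k. k \<notin> A \<Longrightarrow> a1 k = 0 \<and> a2 k = 0"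
    and w: "ev (dgen tG aG (\<lambda>_. 0)) w = 0" "ev (dgen tG (\<lambda>_. 0) aG) w = 0"
  shows "ev (dgen T a1 a2) w = 0"
proof -
  have nf: "\<exists>L1 L2 h. entries d A L1 \<and> entries d A L2 \<and> tword d h \<and>
      ev (dgen T a1 a2) w = lv T a1 L1 + lv T a2 L2 + ev T h \<and>
      ev (dgen tG aG (\<lambda>_. 0)) w = lvG L1 + ev tG h \<and> ev (dgen tG (\<lambda>_. 0) aG) w = lvG L2 + ev tG h" for w
  proof (induction w)
    case Nil
    have "entries d A []" "tword d []" by simp_all
    then show ?case by (metis add.right_neutral ev_Nil lv_simps(1))
  next
    case (Cons l w)
    then obtain L1 L2 h where IH: "entries d A L1" "entries d A L2" "tword d h"
      "ev (dgen T a1 a2) w = lv T a1 L1 + lv T a2 L2 + ev T h"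
      "ev (dgen tG aG (\<lambda>_. 0)) w = lvG L1 + ev tG h" "ev (dgen tG (\<lambda>_. 0) aG) w = lvG L2 + ev tG h" by blast
    consider i b where "l = (Inl i, b)" "i < d" | k b where "l = (Inr (Inl k), b)" "k \<in> A"
      | k b where "l = (Inr (Inr k), b)" "k \<in> A"
      | "lval (dgen T a1 a2) l = 0" "lval (dgen tG aG (\<lambda>_. 0)) l = 0" "lval (dgen tG (\<lambda>_. 0) aG) l = 0"
    proof (cases l)
      case (Pair y b)
      show ?thesis
      proof (cases y)
        case (Inl i)
        then show ?thesis using that(1,4) Pair T_out[of i]
          by (cases "i < d") (auto simp: lval_def tG_def gen_def)
      next
        case (Inr z)
        show ?thesis
        proof (cases z)
          case (Inl k)
          then show ?thesis using that(2,4) Pair Inr a_out[of k]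
            by (cases "k \<in> A") (auto simp: lval_def aG_def gen_def)
        next
          case r: (Inr k)
          then show ?thesis using that(3,4) Pair Inr a_out[of k]
            by (cases "k \<in> A") (auto simp: lval_def aG_def gen_def)
        qed
      qed
    qed
    then show ?case
    proof cases
      case 1
      then show ?thesis using IH
        apply -
        apply (rule exI[of _ "shift [(i, b)] L1"], rule exI[of _ "shift [(i, b)] L2"], rule exI[of _ "(i, b) # h"])
        by (simp add: entries_shift lv_shift lval_dgen diff_conv_add_uminus add.assoc minus_add
            del: add_uminus_conv_diff lval_Pair)
    next
      case 2
      moreover have "lval (\<lambda>_. 0) (k, b) = (0 :: 'g)" by (simp add: lval_def)
      ultimately show ?thesis using IH
        apply -
        apply (rule exI[of _ "([], (k, b)) # L1"], rule exI[of _ L2], rule exI[of _ h])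
        by (simp add: lval_dgen add.assoc del: lval_Pair)
    next
      case 3
      have "cmt (lv T a1 L1) (lv T a2 [([], (k, b))])" using IH 3 by (intro copies_commute) auto
      then have "lval a2 (k, b) + lv T a1 L1 = lv T a1 L1 + lval a2 (k, b)" by (simp add: cmt_def)
      then have "lval a2 (k, b) + (lv T a1 L1 + lv T a2 L2 + ev T h) = lv T a1 L1 + (lval a2 (k, b) + lv T a2 L2) + ev T h"
        by (simp flip: add.assoc)
      moreover have "lval (\<lambda>_. 0) (k, b) = (0 :: 'g)" by (simp add: lval_def)
      ultimately show ?thesis using IH 3
        apply -
        apply (rule exI[of _ L1], rule exI[of _ "([], (k, b)) # L2"], rule exI[of _ h])
        by (simp add: lval_dgen add.assoc del: lval_Pair)
    next
      case 4
      then have "ev (dgen T a1 a2) (l # w) = ev (dgen T a1 a2) w"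
        "ev (dgen tG aG (\<lambda>_. 0)) (l # w) = ev (dgen tG aG (\<lambda>_. 0)) w"
        "ev (dgen tG (\<lambda>_. 0) aG) (l # w) = ev (dgen tG (\<lambda>_. 0) aG) w" by simp_all
      then show ?thesis using IH by metis
    qed
  qed
  obtain L1 L2 h where L: "entries d A L1" "entries d A L2" "tword d h"
      "ev (dgen T a1 a2) w = lv T a1 L1 + lv T a2 L2 + ev T h" "lvG L1 + ev tG h = 0" "lvG L2 + ev tG h = 0"
    using nf[of w] w by auto
  have "evG (lword L1 @ inl h) = 0" using L(5) by (simp add: evG_lword evG_inl)
  then have "wt d (lword L1 @ inl h) = 0" by (rule wt_0)
  moreover have "wt d (lword L) = 0" for L :: "(nat word \<times> 'g \<times> bool) list"
    by (induction L) (auto simp: lword_def uvec_Inr lval_def)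
  ultimately have "twt d h = 0" by (simp add: wt_inl)
  then obtain L3 where L3: "entries d A L3" "ev tG h = lvG L3" "ev T h = lv T a1 L3 + lv T a2 L3"
    using T_closed_word[OF L(3)] by blast
  have "cmt (lv T a1 L3) (lv T a2 L2)" using L L3 by (intro copies_commute)
  then have "lv T a2 L2 + lv T a1 L3 = lv T a1 L3 + lv T a2 L2" by (simp add: cmt_def)
  then have "ev (dgen T a1 a2) w = lv T a1 (L1 @ L3) + lv T a2 (L2 @ L3)"
    unfolding L(4) L3(3) lv_simps by (metis add.assoc)
  moreover have "lv T a1 (L1 @ L3) = 0" using L L3 by (intro first_copy_injective) auto
  moreover have "lv T a2 (L2 @ L3) = 0" using L L3 by (intro second_copy_injective) auto
  ultimately show ?thesis by simp
qed

end

lemma ev_map: "ev f (map (\<lambda>(x, b). (m x, b)) w) = ev (\<lambda>x. f (m x)) w"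
  by (induction w) (auto simp: lval_def)

lemma length_inl [simp]: "length (inl h) = length h"
  by (simp add: inl_def)

lemma set_inl: "tword d h \<Longrightarrow> set (inl h) \<subseteq> alph d A \<times> UNIV"
  by (induction h) (auto simp: alph_def)

lemma set_winv_subset: "set w \<subseteq> X \<times> UNIV \<Longrightarrow> set (winv w) \<subseteq> X \<times> UNIV"
  by (auto simp: inv_letter_def)

lemma set_lword: "entries d A L \<Longrightarrow> set (lword L) \<subseteq> alph d A \<times> UNIV"
proof (induction L)
  case (Cons e L)
  obtain P k b where e: "e = (P, k, b)" by (cases e)
  have P: "tword d P" "k \<in> A" "entries d A L" using Cons.prems by (auto simp: e)
  have "set (inl P) \<subseteq> alph d A \<times> UNIV" by (rule set_inl[OF P(1)])
  moreover from this have "set (winv (inl P)) \<subseteq> alph d A \<times> UNIV" by (rule set_winv_subset)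
  moreover have "Inr k \<in> alph d A" using P by (simp add: alph_def)
  ultimately show ?case using Cons.IH P(3) by (auto simp: lword_def e simp del: set_winv)
qed (simp add: lword_def)

lemma length_lword: "small d A M L \<Longrightarrow> length (lword L) \<le> (2 * M + 1) * M"
proof -
  assume s: "small d A M L"
  have "length (lword L) \<le> (2 * M + 1) * length L"
    using s unfolding small_def by (induction L) (auto simp: lword_def inl_def)
  also have "\<dots> \<le> (2 * M + 1) * M" using s by (intro mult_left_mono) (auto simp: small_def)
  finally show ?thesis .
qed

lemma small_of_entries:
  assumes "entries d A L" "length L + sum_list (map (\<lambda>e. length (fst e)) L) \<le> M"
  shows "small d A M L"
proof -
  have "length P \<le> sum_list (map (\<lambda>e. length (fst e)) L)" if "(P, k) \<in> set L" for P k
  proof -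
    have "length P \<in> set (map (\<lambda>e. length (fst e)) L)" using that by force
    then show ?thesis by (intro member_le_sum_list) auto
  qed
  then show ?thesis using assms unfolding small_def entries_def by fastforce
qed

context zd_extension
begin

theorem fin_pres_fibre_product:
  assumes nofree: "\<And>x y. x \<in> S \<Longrightarrow> y \<in> S \<Longrightarrow> \<not> free_pair x y"
  shows "fin_pres {(g1, g2). g1 \<in> S \<and> g2 \<in> S \<and> - g1 + g2 \<in> Nker}"
proof -
  obtain M0 where M0: "\<And>q. int M0 \<le> nrm d q \<Longrightarrow> contracts M0 q \<or> contracts M0 (- q)"
    using uniform_contraction[OF nofree] by metis
  have "\<exists>L. eqv (alph d A) (comm_relators d cm) r (lword L) \<and> entries d A L" if r: "r \<in> R" for r
  proof -
    obtain c0 where c0: "above d (\<lambda>_. 0) c0 0 r" using above_exists by blast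
    have "wt d r = 0" by (rule wt_0[OF presentsD(5)[OF pres r]])
    obtain L where "eqv (alph d A) (comm_relators d cm) r (lword L)" "entries_ok d (\<lambda>_. 0) c0 A 0 L"
      using closed_word_eqv_conjugates[where c = cm and A = A, OF cm_A c0 \<open>wt d r = 0\<close>] by blast
    then show ?thesis by (auto simp: entries_ok_def entries_def)
  qed
  then obtain Lr where Lr: "eqv (alph d A) (comm_relators d cm) r (lword (Lr r))" "entries d A (Lr r)" if "r \<in> R" for r
    by metis
  define sz where "sz L = length L + sum_list (map (\<lambda>e. length (fst e)) L)" for L :: "(nat word \<times> 'g \<times> bool) list"
  \<comment> \<open>Large enough for the contractions, the Hall-Witt identity and the lists of all
    relators.\<close>
  define M where "M = M0 + 6 + (\<Sum>r\<in>R. sz (Lr r))"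
  have small_Lr: "small d A M (Lr r)" if "r \<in> R" for r
  proof (rule small_of_entries[OF Lr(2)[OF that]])
    have "sz (Lr r) \<le> (\<Sum>r\<in>R. sz (Lr r))"
      using that presentsD(2)[OF pres] by (intro member_le_sum) auto
    then show "length (Lr r) + sum_list (map (\<lambda>e. length (fst e)) (Lr r)) \<le> M" by (simp add: M_def sz_def)
  qed
  define XE where "XE = Inl ` {..<d} \<union> Inr ` (Inl ` A \<union> Inr ` A)"
  define p1 p2 where "p1 = dgen tG aG (\<lambda>_. 0)" and "p2 = dgen tG (\<lambda>_. 0) aG"
  define p where "p y = (p1 y, p2 y)" for y
  have ev_p: "ev p w = (ev p1 w, ev p2 w)" for w unfolding p_def[abs_def] by (rule ev_Pair)
  have p_out: "p y = 0" if "y \<notin> XE" for y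
    using that by (auto simp: p_def p1_def p2_def XE_def dgen_def tG_def aG_def gen_def zero_prod_def split: sum.splits)
  define N where "N = (2 * M + 1) * M + 4 * M + 10"
  \<comment> \<open>All short words that are trivial in the fibre product: a finite set, sound by
    definition, which contains every relator wanted. \<open>(2 * M + 1) * M\<close> bounds the
    length of small lists as words, and the commuting relations have length at most
    \<open>4 * M + 4\<close>.\<close>
  define RE where "RE = {w. set w \<subseteq> XE \<times> UNIV \<and> length w \<le> N \<and> ev p w = 0}"
  have XE: "finite XE" using finite_A by (simp add: XE_def)
  have RE: "finite RE"
    by (rule finite_subset[OF _ finite_lists_length_le[of "XE \<times> UNIV" N]]) (use XE in \<open>auto simp: RE_def\<close>)
  obtain e :: "nat + 'g + 'g \<Rightarrow> (nat + 'g + 'g) word sym" where e: "\<And>w. ev e w = 0 \<longleftrightarrow> eqv XE RE w []"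
    using universal_group by blast
  have e_out: "e y = 0" if "y \<notin> XE" for y
    using e[of "[(y, True)]"] eqv.outside[of "(y, True)" XE RE "[]" "[]"] that by simp
  have e_rel: "ev e w = 0" if "set w \<subseteq> XE \<times> UNIV" "length w \<le> N" "ev p1 w = 0" "ev p2 w = 0" for w
  proof -
    have "w \<in> RE" using that by (simp add: RE_def ev_p zero_prod_def)
    then show ?thesis using eqv.relator[of w RE XE "[]" "[]"] by (simp add: e)
  qed
  define T where "T i = e (Inl i)" for i
  define a1 where "a1 k = e (Inr (Inl k))" for k
  define a2 where "a2 k = e (Inr (Inr k))" for k
  have e_dgen: "e = dgen T a1 a2"
    by (rule ext) (auto simp: dgen_def T_def a1_def a2_def split: sum.splits)
  define m1 where "m1 = case_sum Inl (\<lambda>k. Inr (Inl k :: 'g + 'g) :: nat + 'g + 'g)"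
  define m2 where "m2 = case_sum Inl (\<lambda>k. Inr (Inr k :: 'g + 'g) :: nat + 'g + 'g)"
  define lift where "lift m w = map (\<lambda>(x, b :: bool). (m x :: nat + 'g + 'g, b)) w" for m and w :: "(nat + 'g) word"
  have lift_XE: "set (lift m w) \<subseteq> XE \<times> UNIV" if "set w \<subseteq> alph d A \<times> UNIV" "m = m1 \<or> m = m2" for m w
    using that by (auto simp: lift_def XE_def alph_def m1_def m2_def)
  have lift_len: "length (lift m w) = length w" for m w by (simp add: lift_def)
  have ev_lift_e: "ev e (lift m1 w) = ev (case_sum T a1) w" "ev e (lift m2 w) = ev (case_sum T a2) w" for w
    unfolding lift_def ev_map by (auto simp: m1_def m2_def T_def a1_def a2_def intro!: ev_cong split: sum.splits)
  have gen_split: "(\<lambda>x. p1 (m1 x)) = gen d t A" "(\<lambda>x. p2 (m2 x)) = gen d t A"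
    "(\<lambda>x. p2 (m1 x)) = case_sum tG (\<lambda>_. 0)" "(\<lambda>x. p1 (m2 x)) = case_sum tG (\<lambda>_. 0)"
    by (auto simp: fun_eq_iff p1_def p2_def m1_def m2_def tG_def aG_def split: sum.splits)
  have ev_lift_p: "ev p1 (lift m1 w) = evG w" "ev p2 (lift m2 w) = evG w"
    "ev p2 (lift m1 w) = ev (case_sum tG (\<lambda>_. 0)) w" "ev p1 (lift m2 w) = ev (case_sum tG (\<lambda>_. 0)) w" for w
    unfolding lift_def ev_map gen_split by (rule HOL.refl)+
  have kill: "ev (case_sum tG (\<lambda>_. 0)) (lword L) = 0" for L :: "(nat word \<times> 'g \<times> bool) list"
    unfolding ev_lword by (induction L) (auto simp: lval_def)
  have "zd_double d t A R S T a1 a2 M0 M"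
  proof (unfold_locales, fact M0)
    show "M0 + 1 \<le> M" "6 \<le> M" by (simp_all add: M_def)
    show "\<exists>L. eqv (alph d A) (comm_relators d cm) r (lword L) \<and> small d A M L" if "r \<in> R" for r
      using Lr(1)[OF that] small_Lr[OF that] by blast
  next
    fix x y :: "nat \<times> bool" assume xy: "fst x < d" "fst y < d"
    define W where "W = [x, y, inv_letter x, inv_letter y]"
    define tl where "tl = [(Inr (Inr (cm x y)) :: nat + 'g + 'g, False), (Inr (Inl (cm x y)), False)]"
    define w where "w = lift m1 (inl W) @ tl"
    have "set (inl W :: (nat + 'g) word) \<subseteq> alph d A \<times> UNIV"
      by (rule set_inl) (use xy in \<open>simp add: W_def\<close>)
    then have "set (lift m1 (inl W)) \<subseteq> XE \<times> UNIV"
      by (rule lift_XE) simp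
    then have 1: "set w \<subseteq> XE \<times> UNIV" using cm_A[OF xy] by (auto simp: w_def tl_def XE_def)
    have 2: "length w \<le> N" by (simp add: w_def tl_def lift_len N_def W_def)
    have c: "lval tG x + lval tG y - lval tG x - lval tG y = cm x y"
      using xy by (simp add: lval_tG cm_def)
    then have W: "ev tG W = cm x y"
      by (simp add: W_def diff_conv_add_uminus add.assoc del: add_uminus_conv_diff)
    have "ev p1 tl = - cm x y" "ev p2 tl = - cm x y"
      using cm_A[OF xy] by (simp_all add: tl_def p1_def p2_def)
    moreover have "ev p1 (lift m1 (inl W)) = cm x y" "ev p2 (lift m1 (inl W)) = cm x y"
      unfolding ev_lift_p using W by (simp_all add: evG_inl) (simp add: ev_inl)
    ultimately have "ev p1 w = 0" "ev p2 w = 0" by (simp_all add: w_def)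
    from e_rel[OF 1 2 this] have "ev T W - a2 (cm x y) - a1 (cm x y) = 0"
      unfolding w_def ev_append ev_lift_e ev_inl
      by (simp add: tl_def a1_def a2_def diff_conv_add_uminus add.assoc del: add_uminus_conv_diff)
    then have "ev T [x, y, inv_letter x, inv_letter y] = a1 (cm x y) + a2 (cm x y)"
      by (simp add: algebra_simps flip: W_def)
    then show "lval T x + lval T y - lval T x - lval T y = a1 (cm x y) + a2 (cm x y)"
      by (simp add: diff_conv_add_uminus add.assoc del: add_uminus_conv_diff)
  next
    fix h assume h: "tword d h" "length h \<le> M"
    show "comm_at T a1 a2 A h"
      unfolding comm_at_def
    proof (intro ballI)
      fix k k' assume k: "k \<in> A" "k' \<in> A"
      define H where "H = lift m1 (inl h)"
      define v where "v = H @ [(Inr (Inr k'), True)] @ winv H"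
      define w where "w = [(Inr (Inl k), True)] @ v @ [(Inr (Inl k), False)] @ winv v"
      have H: "set H \<subseteq> XE \<times> UNIV" unfolding H_def by (intro lift_XE set_inl h) simp
      then have "set v \<subseteq> XE \<times> UNIV" using set_winv_subset[OF H] k by (auto simp: v_def XE_def simp del: set_winv)
      then have 1: "set w \<subseteq> XE \<times> UNIV"
        using set_winv_subset[of v XE] k by (auto simp: w_def XE_def simp del: set_winv)
      have "length H = length h" by (simp add: H_def lift_len inl_def)
      then have 2: "length w \<le> N" using h(2) by (simp add: w_def v_def N_def)
      have "ev p1 w = 0" "ev p2 w = 0" 
        by (simp_all add: w_def v_def p1_def p2_def diff_conv_add_uminus add.assoc minus_add del: add_uminus_conv_diff)
      from e_rel[OF 1 2 this] have "a1 k + ev e v - a1 k - ev e v = 0"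
        by (simp add: w_def a1_def diff_conv_add_uminus add.assoc del: add_uminus_conv_diff)
      then have "a1 k + ev e v = ev e v + a1 k" by (simp add: algebra_simps)
      moreover have "ev e v = ev T h + a2 k' - ev T h"
        by (simp add: v_def H_def ev_lift_e ev_inl a2_def diff_conv_add_uminus add.assoc del: add_uminus_conv_diff)
      ultimately show "cmt (a1 k) (ev T h + a2 k' - ev T h)" by (simp add: cmt_def)
    qed
  next
    fix L assume L: "small d A M L" "lvG L = 0"
    have ent: "entries d A L" using L(1) by (auto simp: small_def entries_def)
    have 1: "set (lift m (lword L)) \<subseteq> XE \<times> UNIV" if "m = m1 \<or> m = m2" for m
      using that by (intro lift_XE set_lword ent)
    have 2: "length (lift m (lword L)) \<le> N" for m
      using length_lword[OF L(1)] by (simp add: lift_len N_def)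
    have "ev e (lift m1 (lword L)) = 0" "ev e (lift m2 (lword L)) = 0"
      by (rule e_rel[OF 1 2]; simp add: ev_lift_p kill evG_lword L(2))+
    then show "lv T a1 L = 0 \<and> lv T a2 L = 0" by (simp add: ev_lift_e ev_lword)
  qed
  then interpret zd_double d t A R S T a1 a2 M0 M .
  have "presents XE RE p (range (ev p))"
  proof (rule presentsI[OF XE RE HOL.refl _ p_out])
    show "ev p r = 0" if "r \<in> RE" for r using that by (simp add: RE_def)
    show "eqv XE RE w []" if "ev p w = 0" for w
    proof -
      have "T i = 0" if "\<not> i < d" for i using that by (auto simp: T_def XE_def intro!: e_out)
      moreover have "a1 k = 0 \<and> a2 k = 0" if "k \<notin> A" for k using that by (auto simp: a1_def a2_def XE_def intro!: e_out)
      moreover have "ev p1 w = 0" "ev p2 w = 0" using that by (simp_all add: ev_p zero_prod_def)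
      ultimately have "ev (dgen T a1 a2) w = 0" unfolding p1_def p2_def by (intro double_injective)
      then show ?thesis by (simp only: e_dgen[symmetric] e)
    qed
  qed
  then have "fin_pres (range (ev p))" by (rule fin_presI)
  moreover have "range (ev p) = {(g1, g2). g1 \<in> S \<and> g2 \<in> S \<and> - g1 + g2 \<in> Nker}"
  proof (intro equalityI subsetI)
    fix g assume "g \<in> range (ev p)"
    then obtain w where g: "g = (ev p1 w, ev p2 w)" by (auto simp: ev_p)
    define \<phi>1 where "\<phi>1 y = (case y of Inl i \<Rightarrow> [(Inl i :: nat + 'g, True)] | Inr (Inl k) \<Rightarrow> [(Inr k, True)] | Inr (Inr k) \<Rightarrow> [])"
      for y :: "nat + 'g + 'g"
    define \<phi>2 where "\<phi>2 y = (case y of Inl i \<Rightarrow> [(Inl i :: nat + 'g, True)] | Inr (Inl k) \<Rightarrow> [] | Inr (Inr k) \<Rightarrow> [(Inr k, True)])"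
      for y :: "nat + 'g + 'g"
    have "(\<lambda>y. evG (\<phi>1 y)) = p1" "(\<lambda>y. evG (\<phi>2 y)) = p2"
      by (auto simp: fun_eq_iff \<phi>1_def \<phi>2_def p1_def p2_def dgen_def tG_def aG_def split: sum.splits)
    then have ev12: "evG (subst_word \<phi>1 w) = ev p1 w" "evG (subst_word \<phi>2 w) = ev p2 w"
      by (simp_all add: ev_subst_word)
    have "(\<lambda>y. wt d (\<phi>1 y)) = (\<lambda>y. wt d (\<phi>2 y))"
      by (auto simp: fun_eq_iff \<phi>1_def \<phi>2_def uvec_Inr split: sum.splits)
    then have "wt d (winv (subst_word \<phi>1 w) @ subst_word \<phi>2 w) = 0" by (simp add: ev_subst_word)
    moreover have "- ev p1 w + ev p2 w = evG (winv (subst_word \<phi>1 w) @ subst_word \<phi>2 w)" by (simp add: ev12)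
    ultimately have "- ev p1 w + ev p2 w \<in> Nker" unfolding Nker_def by blast
    moreover have "ev p1 w \<in> S" "ev p2 w \<in> S" using ev12 presentsD(3)[OF pres] by (metis rangeI)+
    ultimately show "g \<in> {(g1, g2). g1 \<in> S \<and> g2 \<in> S \<and> - g1 + g2 \<in> Nker}" by (simp add: g)
  next
    fix g assume "g \<in> {(g1, g2). g1 \<in> S \<and> g2 \<in> S \<and> - g1 + g2 \<in> Nker}"
    then obtain g1 g2 where g: "g = (g1, g2)" "g1 \<in> S" "- g1 + g2 \<in> Nker" by auto
    then obtain w where w: "g1 = evG w" using presentsD(3)[OF pres] by auto
    obtain v where v: "- g1 + g2 = evG v" "wt d v = 0" using g(3) by (auto simp: Nker_def)
    define \<phi> where "\<phi> y = (case y of Inl i \<Rightarrow> [(Inl i :: nat + 'g + 'g, True)] | Inr k \<Rightarrow> [(Inr (Inl k), True), (Inr (Inr k), True)])"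
      for y :: "nat + 'g"
    have "(\<lambda>y. ev p1 (\<phi> y)) = gen d t A" "(\<lambda>y. ev p2 (\<phi> y)) = gen d t A"
      by (auto simp: fun_eq_iff \<phi>_def p1_def p2_def tG_def aG_def split: sum.splits)
    \<comment> \<open>The pair splits as \<open>(g1, g1) + (0, - g1 + g2)\<close>: the diagonal part
      uses doubled kernel letters, the other one the second copy alone.\<close>
    then have diag: "ev p (subst_word \<phi> w) = (g1, g1)" unfolding ev_p unfolding ev_subst_word by (simp add: w)
    obtain c0 where "above d (\<lambda>_. 0) c0 0 v" using above_exists by blast
    from G.closed_word_as_conjugates[OF this v(2)] obtain L where "evG v = lvG L"
      by (auto simp: tG_def[abs_def] aG_def[abs_def])
    then have "ev p (lift m2 (lword L)) = (0, - g1 + g2)"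
      by (simp add: ev_p ev_lift_p kill evG_lword v(1))
    then have "ev p (subst_word \<phi> w @ lift m2 (lword L)) = g"
      by (simp add: diag g(1) add.assoc[symmetric])
    then show "g \<in> range (ev p)" by (metis rangeI)
  qed
  ultimately show ?thesis by simp
qed

end

section \<open>Reduction to a free abelian quotient\<close>

lemma subgrp_ev_replicate: "subgrp H \<Longrightarrow> ev f (replicate m (x, True)) \<in> H \<Longrightarrow> ev f (replicate (m * k) (x, True)) \<in> H"
  by (induction k) (simp_all add: subgrpD replicate_add)

lemma twt_tpow: "i < d \<Longrightarrow> twt d (tpow i n) j = (if j = i then n else 0)"
  by (auto simp: tpow_def twt_replicate)

lemma ev_replicate_neg: "ev f (replicate n (x, False)) = - ev f (replicate n (x, True))"
proof (induction n)
  case (Suc n)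
  have "ev f (replicate (Suc n) (x, True)) = ev f (replicate n (x, True)) + f x"
    using arg_cong[OF replicate_append_same[of n "(x, True)"], of "ev f"] by simp
  then show ?case using Suc by (simp add: minus_add del: replicate_Suc) (simp add: diff_conv_add_uminus Suc del: add_uminus_conv_diff)
qed simp

lemma twt_wpre: "k \<le> d \<Longrightarrow> twt d (wpre k p) j = (if j < k then p j else 0)"
proof (induction k)
  case (Suc k)
  have "wpre (Suc k) p = wpre k p @ tpow k (p k)" by (simp add: wpre_def)
  then show ?case using Suc by (auto simp: plus_fun_apply twt_tpow)
qed (simp add: wpre_def zero_fun_apply)

locale abelian_quotient =
  fixes S N :: "'g::group_add set"
  assumes S: "subgrp S" and N: "subgrp N" "N \<subseteq> S"
    and normal: "\<And>s n. s \<in> S \<Longrightarrow> n \<in> N \<Longrightarrow> s + n - s \<in> N"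
    and abel: "\<And>x y. x \<in> S \<Longrightarrow> y \<in> S \<Longrightarrow> x + y - x - y \<in> N"
begin

lemmas sD = subgrpD[OF S] and nD = subgrpD[OF N(1)]

lemma diff_swap: "x \<in> S \<Longrightarrow> y \<in> S \<Longrightarrow> x - y \<in> N \<longleftrightarrow> - x + y \<in> N"
proof -
  have *: "x - y \<in> N \<Longrightarrow> - x + y \<in> N" if "x \<in> S" "y \<in> S" for x y
  proof -
    assume "x - y \<in> N"
    then have "- x + - (x - y) - - x \<in> N" using normal[OF sD(3)[OF that(1)] nD(3)] by blast
    then show ?thesis by (simp add: diff_conv_add_uminus minus_add add.assoc del: add_uminus_conv_diff)
  qed
  assume xy: "x \<in> S" "y \<in> S"
  have "- x + y \<in> N \<Longrightarrow> x - y \<in> N" using *[of "- x" "- y"] nD(7)[of "x - y"] nD(7)[of "- x + y"] xy sD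
    by (simp add: diff_conv_add_uminus minus_add del: add_uminus_conv_diff)
  then show ?thesis using *[OF xy] by blast
qed

lemma ev_S: "(\<And>y. g y \<in> S) \<Longrightarrow> ev g w \<in> S"
  by (rule ev_in_subgrp[OF S])

lemma ev_diff_N:
  assumes "\<And>y. g1 y - g2 y \<in> N" "\<And>y. g1 y \<in> S" "\<And>y. g2 y \<in> S"
  shows "ev g1 w - ev g2 w \<in> N"
proof (induction w)
  case (Cons l w)
  have l: "lval g1 l \<in> S" "lval g2 l \<in> S" using assms sD by (auto simp: lval_def)
  have "lval g1 l - lval g2 l \<in> N"
  proof (cases "snd l")
    case False
    then show ?thesis using assms diff_swap[of "g1 (fst l)" "g2 (fst l)"] by (simp add: lval_def)
  qed (use assms in \<open>simp add: lval_def\<close>)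
  then have "(lval g1 l + (ev g1 w - ev g2 w) - lval g1 l) + (lval g1 l - lval g2 l) \<in> N"
    by (intro nD(2) normal l(1) Cons)
  then show ?case by (simp add: diff_conv_add_uminus minus_add add.assoc del: add_uminus_conv_diff)
qed (simp add: nD)

text \<open>With exponent sums 0, the first letter has its inverse further on; cancelling the two
  costs a commutator, which lies in \<open>N\<close>.\<close>

lemma ev_balanced_N:
  assumes f: "\<And>x. f x \<in> S"
  shows "tword D w \<Longrightarrow> twt D w = 0 \<Longrightarrow> ev f w \<in> N"
proof (induction w rule: length_induct)
  case (1 w)
  show ?case
  proof (cases w)
    case (Cons l v)
    obtain i b where l: "l = (i, b)" by (cases l)
    have i: "i < D" using 1 by (simp add: Cons l)
    have "count (mset w) (i, True) = count (mset w) (i, False)"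
      using twt_count[OF i, of w] 1 by (simp add: zero_fun_apply)
    moreover have "0 < count (mset w) (i, b)" by (simp add: Cons l)
    ultimately have "0 < count (mset w) (inv_letter l)" by (cases b) (simp_all add: l inv_letter_def)
    then have "inv_letter l \<in> set w" by (metis count_greater_zero_iff set_mset_mset)
    then have "inv_letter l \<in> set v" using inv_letter_simps(3)[of l] by (simp add: Cons)
    then obtain a c where v: "v = a @ inv_letter l # c" by (meson split_list)
    have "tword D (a @ c)" "twt D (a @ c) = 0" "length (a @ c) < length w"
      using 1 by (simp_all add: Cons v ac_simps)
    then have "ev f (a @ c) \<in> N" using 1(1) by blast
    moreover have "lval f l \<in> S" using f sD by (simp add: lval_def)
    moreover have "ev f a \<in> S" using f by (rule ev_S)
    ultimately have "(lval f l + ev f a - lval f l - ev f a) + ev f (a @ c) \<in> N"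
      by (intro nD(2) abel)
    then show ?thesis
      by (simp add: Cons v diff_conv_add_uminus minus_add add.assoc del: add_uminus_conv_diff)
  qed (simp add: nD)
qed

lemma ev_twt_eq_N:
  assumes f: "\<And>x. f x \<in> S" and "tword D v" "tword D w" "twt D v = twt D w"
  shows "ev f v - ev f w \<in> N"
  using ev_balanced_N[OF f, of D "v @ winv w"] assms by simp

text \<open>Modulo \<open>N\<close> only the exponent vector of a word matters, and modulo
  \<open>H\<close> its entries can be reduced modulo \<open>m\<close>; so the words with entries
  below \<open>m\<close> represent all cosets.\<close>

lemma finite_cosets:
  fixes H :: "'g set"
  assumes H: "subgrp H" "N \<subseteq> H" "H \<subseteq> S" and f: "\<And>x :: nat. f x \<in> S" "S = range (ev f)" "\<And>x. x \<notin> X \<Longrightarrow> f x = 0"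
    and X: "X \<subseteq> {..<D}" and m: "0 < m" "\<And>x. x \<in> X \<Longrightarrow> ev f (replicate m (x, True)) \<in> H"
  shows "finite ((\<lambda>s. {y \<in> S. s - y \<in> H}) ` S)"
proof -
  note hD = subgrpD[OF H(1)]
  define \<kappa> where "\<kappa> s = {y \<in> S. s - y \<in> H}" for s
  have \<kappa>_eq: "\<kappa> s = \<kappa> s'" if "s - s' \<in> H" for s s'
  proof -
    have "s - y \<in> H \<longleftrightarrow> s' - y \<in> H" for y
      using hD(5)[OF that, of "s' - y"] by (simp add: algebra_simps)
    then show ?thesis by (simp add: \<kappa>_def)
  qed
  define Rep where "Rep = (\<lambda>c. ev f (wpre D c)) ` (PiE {..<D} (\<lambda>_. {0..<int m}))"
  have "finite Rep" unfolding Rep_def by (intro finite_imageI finite_PiE) auto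
  moreover have "\<kappa> s \<in> \<kappa> ` Rep" if s: "s \<in> S" for s
  proof -
    obtain w0 where w0: "s = ev f w0" using s f(2) by auto
    define w where "w = filter (\<lambda>l. fst l < D) w0"
    have "lval f l = 0" if "\<not> fst l < D" for l using f(3)[of "fst l"] X that by (auto simp: lval_def)
    then have w: "s = ev f w" unfolding w0 w_def by (induction w0) auto
    have tw: "tword D w" by (simp add: w_def tword_def)
    define p where "p = twt D w"
    define c where "c = restrict (\<lambda>i. p i mod int m) {..<D}"
    define q where "q i = p i div int m" for i
    have "c \<in> PiE {..<D} (\<lambda>_. {0..<int m})" using m(1) by (auto simp: c_def)
    then have 1: "ev f (wpre D c) \<in> Rep" by (auto simp: Rep_def)
    have "twt D w = twt D (wpre D (\<lambda>i. int m * q i) @ wpre D c)"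
    proof
      fix j show "twt D w j = twt D (wpre D (\<lambda>i. int m * q i) @ wpre D c) j"
        using supp_tvec(2)[of D w] by (auto simp: plus_fun_apply twt_wpre c_def q_def p_def supp_def)
    qed
    then have "ev f w - ev f (wpre D (\<lambda>i. int m * q i) @ wpre D c) \<in> N"
      using tw by (intro ev_twt_eq_N[where D = D] f) (simp_all add: tword_wpre)
    then have d: "ev f w - (ev f (wpre D (\<lambda>i. int m * q i)) + ev f (wpre D c)) \<in> H" using H(2) by auto
    have tp: "ev f (tpow i (int m * n)) \<in> H" for i n
    proof (cases "i \<in> X")
      case True
      have n: "nat \<bar>int m * n\<bar> = m * nat \<bar>n\<bar>" by (simp add: abs_mult nat_mult_distrib)
      have "ev f (replicate (m * nat \<bar>n\<bar>) (i, True)) \<in> H" by (rule subgrp_ev_replicate[OF H(1) m(2)[OF True]])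
      then show ?thesis unfolding tpow_def n using ev_replicate_neg[of f "m * nat \<bar>n\<bar>" i] hD(3)
        by (cases "0 < int m * n") auto
    next
      case False
      have "ev f (replicate k (i, b)) = 0" for k b using f(3)[OF False] by (induction k) (auto simp: lval_def)
      then show ?thesis using hD(1) by (simp add: tpow_def)
    qed
    have "ev f (wpre k (\<lambda>i. int m * q i)) \<in> H" for k
      by (induction k) (simp_all add: wpre_def hD tp)
    with d have "ev f w - (ev f (wpre D (\<lambda>i. int m * q i)) + ev f (wpre D c)) + ev f (wpre D (\<lambda>i. int m * q i)) \<in> H"
      by (rule hD(2))
    then have "ev f w - ev f (wpre D c) \<in> H"
      by (simp add: diff_conv_add_uminus minus_add add.assoc del: add_uminus_conv_diff)
    then have "\<kappa> (ev f w) = \<kappa> (ev f (wpre D c))" by (rule \<kappa>_eq)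
    then show ?thesis unfolding w using 1 by (rule image_eqI)
  qed
  ultimately show ?thesis
    unfolding \<kappa>_def[abs_def] by (intro finite_subset[OF image_subsetI finite_imageI])
qed

lemma subgrp_fibre_product: "subgrp {(g1, g2). g1 \<in> S \<and> g2 \<in> S \<and> - g1 + g2 \<in> N}" (is "subgrp ?P")
  unfolding subgrp_def
proof (intro conjI ballI)
  show "0 \<in> ?P" using sD(1) nD(1) by (simp add: zero_prod_def)
  fix x assume x: "x \<in> ?P"
  then obtain x1 x2 where x12: "x = (x1, x2)" "x1 \<in> S" "x2 \<in> S" "- x1 + x2 \<in> N" by auto
  have "x1 - x2 \<in> N" using x12 diff_swap by blast
  then show "- x \<in> ?P" using x12 sD by simp
  fix y assume y: "y \<in> ?P"
  then obtain y1 y2 where y12: "y = (y1, y2)" "y1 \<in> S" "y2 \<in> S" "- y1 + y2 \<in> N" by auto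
  have "(- y1 + (- x1 + x2) - - y1) + (- y1 + y2) \<in> N" by (rule nD(2)[OF normal[OF sD(3)[OF y12(2)] x12(4)] y12(4)])
  then have "- (x1 + y1) + (x2 + y2) \<in> N"
    by (simp add: diff_conv_add_uminus minus_add add.assoc del: add_uminus_conv_diff)
  then show "x + y \<in> ?P" using x12 y12 sD by simp
qed

theorem fin_pres_fibre_product:
  assumes fp: "fin_pres S" and nofree: "\<And>x y. x \<in> S \<Longrightarrow> y \<in> S \<Longrightarrow> \<not> free_pair x y"
  shows "fin_pres {(g1, g2). g1 \<in> S \<and> g2 \<in> S \<and> - g1 + g2 \<in> N}"
proof -
  obtain X :: "nat set" and R f where P: "presents X R f S" using fp by (auto simp: fin_pres_def)
  have SR: "S = range (ev f)" by (rule presentsD(3)[OF P])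
  have f_S: "f x \<in> S" for x using lval_in_range[of f "(x, True)"] SR by simp
  obtain D where D: "X \<subseteq> {..<D}" using presentsD(1)[OF P] finite_nat_bounded by blast
  \<comment> \<open>\<open>U\<close> is independent if its letters have linearly independent images
    in the abelian quotient. A maximal such \<open>U\<close> replaces the structure theorem for
    finitely generated abelian groups.\<close>
  define indep where "indep U \<longleftrightarrow> (\<forall>w. fst ` set w \<subseteq> U \<longrightarrow> ev f w \<in> N \<longrightarrow> twt D w = 0)" for U
  have "indep {}" by (auto simp: indep_def)
  moreover have "card V < Suc (card X)" if "V \<subseteq> X" for V
    using card_mono[OF presentsD(1)[OF P] that] by simp
  ultimately obtain U where U: "U \<subseteq> X" "indep U" and U_max: "\<And>V. V \<subseteq> X \<Longrightarrow> indep V \<Longrightarrow> card V \<le> card U"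
    using ex_has_greatest_nat[of "\<lambda>U. U \<subseteq> X \<and> indep U" "{}" card "Suc (card X)"] by (metis empty_subsetI)
  have finU: "finite U" using U(1) presentsD(1)[OF P] by (rule finite_subset)
  have UD: "U \<subseteq> {..<D}" using U(1) D by blast
  have over: "tword D w" if "fst ` set w \<subseteq> U" for w using that UD by (auto simp: tword_def)
  \<comment> \<open>The preimage of the free abelian subgroup of the quotient that \<open>U\<close>
    generates.\<close>
  define H where "H = {s \<in> S. \<exists>w. fst ` set w \<subseteq> U \<and> s - ev f w \<in> N}"
  have NH: "N \<subseteq> H" using N(2) by (auto simp: H_def intro!: exI[of _ "[]"])
  have HI: "ev f w \<in> H" if "fst ` set w \<subseteq> U" for w
    using that ev_S[of f w, OF f_S] nD(1) by (auto simp: H_def intro!: exI[of _ w])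
  have H: "subgrp H"
    unfolding subgrp_def
  proof (intro conjI ballI)
    show "0 \<in> H" using NH nD(1) by blast
    fix x assume "x \<in> H"
    then obtain v where v: "x \<in> S" "fst ` set v \<subseteq> U" "x - ev f v \<in> N" by (auto simp: H_def)
    have evv: "ev f v \<in> S" using f_S by (rule ev_S)
    have "- x - ev f (winv v) \<in> N" using diff_swap[OF v(1) evv] v(3) by simp
    moreover have "fst ` set (winv v) \<subseteq> U" using v(2) by (simp add: image_image)
    ultimately show "- x \<in> H" using v(1) sD(3) unfolding H_def by blast
    fix y assume "y \<in> H"
    then obtain w where w: "y \<in> S" "fst ` set w \<subseteq> U" "y - ev f w \<in> N" by (auto simp: H_def)
    have "(x + (y - ev f w) - x) + (x - ev f v) \<in> N" using v w by (intro nD(2) normal)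
    moreover have "(x + (y - ev f w) - x) + (x - ev f v) = x + y - ev f (v @ w)"
      by (simp add: diff_conv_add_uminus minus_add add.assoc del: add_uminus_conv_diff)
    ultimately have "x + y - ev f (v @ w) \<in> N" by simp
    moreover have "fst ` set (v @ w) \<subseteq> U" using v(2) w(2) by (simp add: image_Un)
    moreover have "x + y \<in> S" using v(1) w(1) by (rule sD(2))
    ultimately show "x + y \<in> H" unfolding H_def by blast
  qed
  have HS: "H \<subseteq> S" by (auto simp: H_def)
  \<comment> \<open>By maximality, adjoining \<open>x\<close> to \<open>U\<close> creates a
    relation; the exponent of \<open>x\<close> in it is not 0, because \<open>U\<close> itself is
    independent.\<close>
  have torsion: "\<exists>n>0. ev f (replicate n (x, True)) \<in> H" if x: "x \<in> X" for x
  proof (cases "x \<in> U")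
    case True
    then show ?thesis using HI[of "[(x, True)]"] by (intro exI[of _ 1]) simp
  next
    case False
    have "\<not> indep (insert x U)"
      using U_max[of "insert x U"] U(1) x finU False by auto
    then obtain w where w: "fst ` set w \<subseteq> insert x U" "ev f w \<in> N" "twt D w \<noteq> 0" by (auto simp: indep_def)
    have xD: "x < D" using x D by auto
    have tw: "tword D w" using w(1) UD xD by (auto simp: tword_def)
    define v where "v = filter (\<lambda>l. fst l \<noteq> x) w"
    have v: "fst ` set v \<subseteq> U" using w(1) by (auto simp: v_def)
    define a where "a = twt D w x"
    have "twt D w = twt D (v @ tpow x a)"
    proof
      fix j
      show "twt D w j = twt D (v @ tpow x a) j"
      proof (cases "j < D")
        case True
        have "count (mset v) (j, b) = (if j = x then 0 else count (mset w) (j, b))" for b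
          by (simp add: v_def)
        then show ?thesis using True xD twt_count[of j D v] twt_count[of j D w]
          by (auto simp: plus_fun_apply twt_tpow a_def)
      next
        case False
        then show ?thesis using supp_tvec(2)[of D w] supp_tvec(2)[of D "v @ tpow x a"] by (simp add: supp_def)
      qed
    qed
    moreover have "tword D (v @ tpow x a)" using over[OF v] xD by (auto simp: tword_def tpow_def)
    ultimately have "ev f (v @ tpow x a) - ev f w \<in> N" using tw by (intro ev_twt_eq_N[OF f_S]) auto
    then have va: "ev f (v @ tpow x a) \<in> N" using nD(2)[OF _ w(2)] by fastforce
    have "a \<noteq> 0"
    proof
      assume "a = 0"
      then have "ev f v \<in> N" "twt D w = twt D v"
        using va \<open>twt D w = twt D (v @ tpow x a)\<close> by (simp_all add: tpow_def)
      then show False using U(2) v w(3) unfolding indep_def by metis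
    qed
    have "ev f (tpow x a) \<in> H"
      using subgrpD(5)[OF H HI[OF v], of "ev f (tpow x a)"] va NH by auto
    then have "ev f (replicate (nat \<bar>a\<bar>) (x, True)) \<in> H"
      using subgrpD(7)[OF H] by (cases "0 < a") (auto simp: tpow_def ev_replicate_neg)
    then show ?thesis using \<open>a \<noteq> 0\<close> by (intro exI[of _ "nat \<bar>a\<bar>"]) simp
  qed
  then obtain e where e: "0 < e x" "ev f (replicate (e x) (x, True)) \<in> H" if "x \<in> X" for x by metis
  \<comment> \<open>A common multiple of the exponents, so that one \<open>m\<close> serves all
    generators.\<close>
  define m where "m = prod e X"
  have m: "0 < m" using e by (simp add: m_def prod_pos)
  have "ev f (replicate m (x, True)) \<in> H" if "x \<in> X" for x
  proof -
    have "m = e x * prod e (X - {x})" unfolding m_def using that presentsD(1)[OF P] by (rule prod.remove[rotated])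
    then show ?thesis using subgrp_ev_replicate[OF H e(2)[OF that]] by simp
  qed
  from finite_cosets[OF H NH HS f_S SR presentsD(6)[OF P] D m this]
  have fin: "finite ((\<lambda>s. {y \<in> S. s - y \<in> H}) ` S)" by blast
  define \<kappa> where "\<kappa> s = {y \<in> S. s - y \<in> H}" for s
  have \<kappa>: "\<kappa> x = \<kappa> y \<longleftrightarrow> x - y \<in> H" if "x \<in> S" "y \<in> S" for x y
  proof
    assume "\<kappa> x = \<kappa> y"
    moreover have "y \<in> \<kappa> y" using that subgrpD(1)[OF H] by (simp add: \<kappa>_def)
    ultimately have "y \<in> \<kappa> x" by simp
    then show "x - y \<in> H" by (simp add: \<kappa>_def)
  next
    assume "x - y \<in> H"
    then have "x - z \<in> H \<longleftrightarrow> y - z \<in> H" for z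
      using subgrpD(5)[OF H, of "x - y" "y - z"] by (simp add: algebra_simps)
    then show "\<kappa> x = \<kappa> y" by (simp add: \<kappa>_def)
  qed
  have fin: "finite (\<kappa> ` S)" using fin by (simp add: \<kappa>_def[abs_def])
  have fpH: "fin_pres H"
    by (rule fin_pres_finite_index_subgroup[OF fp H HS fin \<kappa>])
  obtain X' :: "nat set" and R' f' where P': "presents X' R' f' H" using fpH by (auto simp: fin_pres_def)
  define d where "d = card U"
  obtain h where h: "bij_betw h {..<d} U"
    using ex_bij_betw_nat_finite[OF finU] by (auto simp: d_def atLeast0LessThan)
  have h_U: "h i \<in> U" if "i < d" for i using h that by (auto simp: bij_betw_def)
  have h_inj: "h i = h j \<longleftrightarrow> i = j" if "i < d" "j < d" for i j
    using h that by (auto simp: bij_betw_def inj_on_def)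
  define t where "t i = f (h i)" for i
  have f'_H: "f' x \<in> H" for x using lval_in_range[of f' "(x, True)"] presentsD(3)[OF P'] by simp
  have "\<exists>v. tword d v \<and> f' x - ev t v \<in> N" for x
  proof -
    obtain w where w: "fst ` set w \<subseteq> U" "f' x - ev f w \<in> N" using f'_H[of x] by (auto simp: H_def)
    define k where "k = map (\<lambda>(y, b :: bool). (inv_into {..<d} h y, b)) w"
    have inv: "inv_into {..<d} h y < d" "h (inv_into {..<d} h y) = y" if "y \<in> U" for y
      using h that inv_into_into[of y h "{..<d}"] f_inv_into_f[of y h "{..<d}"] by (auto simp: bij_betw_def)
    have "tword d k" using w(1) inv by (force simp: k_def tword_def)
    moreover have "ev t k = ev f w" unfolding k_def ev_map t_def
      using w(1) inv by (intro ev_cong) auto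
    ultimately show ?thesis using w(2) by auto
  qed
  then obtain tv where tv: "tword d (tv x)" "f' x - ev t (tv x) \<in> N" for x by metis
  define comms where "comms = (\<lambda>(x, y). lval t x + lval t y - lval t x - lval t y) ` (({..<d} \<times> UNIV) \<times> ({..<d} \<times> UNIV))"
  \<comment> \<open>Kernel generators: the deviation of each old generator of \<open>H\<close> from
    a word in the lifts, so that lifts and \<open>A\<close> generate \<open>H\<close>, and the
    commutators that \<open>zd_extension\<close> asks for.\<close>
  define A where "A = (\<lambda>x. f' x - ev t (tv x)) ` X' \<union> comms"
  have t_S: "t i \<in> S" for i by (simp add: t_def f_S)
  have t_lS: "lval t l \<in> S" for l using t_S sD(3) by (simp add: lval_def)
  have t_H: "t i \<in> H" if "i < d" for i using HI[of "[(h i, True)]"] h_U[OF that] by (simp add: t_def)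
  have finA: "finite A" using presentsD(1)[OF P'] by (simp add: A_def comms_def)
  have A_N: "A \<subseteq> N" using tv(2) abel[OF t_lS t_lS] by (auto simp: A_def comms_def)
  have ev_t: "ev t v = ev (gen d t A) (inl v)" if "tword d v" for v
    unfolding ev_inl using that by (intro ev_cong) (auto simp: tword_def gen_def)
  have H_range: "H = range (ev (gen d t A))"
  proof
    have "gen d t A y \<in> H" for y
      using t_H A_N NH subgrpD(1)[OF H] by (auto simp: gen_def split: sum.splits)
    then show "range (ev (gen d t A)) \<subseteq> H" using ev_in_subgrp[OF H] by blast
    have "f' x \<in> range (ev (gen d t A))" for x
    proof (cases "x \<in> X'")
      case True
      have "f' x = ev (gen d t A) ([(Inr (f' x - ev t (tv x)), True)] @ inl (tv x))"
        unfolding ev_append ev_t[OF tv(1), symmetric] using True by (simp add: gen_def A_def)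
      then show ?thesis by (rule range_eqI)
    next
      case False
      then show ?thesis using presentsD(6)[OF P' False] subgrpD(1)[OF subgrp_range_ev[of "gen d t A"]] by simp
    qed
    then show "H \<subseteq> range (ev (gen d t A))"
      using presentsD(3)[OF P'] ev_in_subgrp[OF subgrp_range_ev] by blast
  qed
  have "finite (alph d A)" using finA by (simp add: alph_def)
  moreover have "gen d t A y = 0" if "y \<notin> alph d A" for y
    using that by (auto simp: gen_def alph_def split: sum.splits)
  ultimately obtain R'' where P'': "presents (alph d A) R'' (gen d t A) H"
    using presents_change_generators[OF P' _ _ H_range] by blast
  \<comment> \<open>\<open>\<phi>\<close> translates the new generators back to letters in
    \<open>U\<close>, modulo \<open>N\<close>. Independence of \<open>U\<close> then shows that a
    word has its value in \<open>N\<close> exactly if its weight is 0.\<close>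
  define \<phi> where "\<phi> y = (case y of Inl i \<Rightarrow> if i < d then [(h i, True)] else [] | Inr k \<Rightarrow> [])" for y :: "nat + 'g"
  have \<phi>_U: "fst ` set (subst_word \<phi> w) \<subseteq> U" for w
    using h_U by (induction w) (auto simp: \<phi>_def inv_letter_def split: sum.splits if_splits)
  have \<phi>_N: "ev (gen d t A) w - ev f (subst_word \<phi> w) \<in> N" for w
    unfolding ev_subst_word
  proof (rule ev_diff_N)
    show "gen d t A y - ev f (\<phi> y) \<in> N" for y
      using A_N nD(1) by (auto simp: gen_def \<phi>_def t_def split: sum.splits)
    show "gen d t A y \<in> S" for y using t_S A_N N(2) sD(1) by (auto simp: gen_def split: sum.splits)
    show "ev f (\<phi> y) \<in> S" for y using f_S by (rule ev_S)
  qed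
  have wt_\<phi>: "wt d w i = twt D (subst_word \<phi> w) (h i)" if "i < d" for w :: "(nat + 'g) word" and i
  proof (induction w)
    case (Cons l w)
    have "lwt d l i = twt D (subst_word \<phi> [l]) (h i)"
      using that h_inj h_U UD
      by (cases l; cases "fst l") (auto simp: lval_def uvec_def \<phi>_def tvec_def inv_letter_def zero_fun_apply)
    then show ?case using Cons by (simp add: plus_fun_apply)
  qed (simp add: zero_fun_apply)
  have in_N_iff: "ev (gen d t A) w \<in> N \<longleftrightarrow> wt d w = 0" for w
  proof -
    have "ev (gen d t A) w \<in> N \<longleftrightarrow> ev f (subst_word \<phi> w) \<in> N"
      using nD(5)[OF \<phi>_N[of w], of "ev f (subst_word \<phi> w)"] by simp
    also have "\<dots> \<longleftrightarrow> twt D (subst_word \<phi> w) = 0"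
      by (rule iffI[OF U(2)[unfolded indep_def, rule_format, OF \<phi>_U] ev_balanced_N[OF f_S over[OF \<phi>_U]]])
    also have "\<dots> \<longleftrightarrow> wt d w = 0"
    proof
      assume "twt D (subst_word \<phi> w) = 0"
      then have "wt d w i = 0" for i
        using wt_\<phi>[of i w] supp_wt[of d w] by (cases "i < d") (auto simp: supp_def zero_fun_apply)
      then show "wt d w = 0" by (auto simp: zero_fun_apply)
    next
      assume "wt d w = 0"
      then have on_U: "twt D (subst_word \<phi> w) y = 0" if "y \<in> U" for y
        using that h wt_\<phi>[of _ w] by (auto simp: bij_betw_def zero_fun_apply)
      have "twt D (subst_word \<phi> w) y = 0" for y
      proof (cases "y \<in> U \<or> \<not> y < D")
        case True
        then show ?thesis using on_U supp_tvec(2)[of D "subst_word \<phi> w"] by (auto simp: supp_def)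
      next
        case False
        then have "(y, b) \<notin> set (subst_word \<phi> w)" for b using \<phi>_U[of w] by force
        then have 0: "count (mset (subst_word \<phi> w)) (y, b) = 0" for b by (simp add: count_eq_zero_iff)
        have "y < D" using False by simp
        then show ?thesis unfolding twt_count[OF \<open>y < D\<close>] 0 by simp
      qed
      then show "twt D (subst_word \<phi> w) = 0" by (auto simp: zero_fun_apply)
    qed
    finally show ?thesis .
  qed
  interpret Z: zd_extension d t A R'' H
  proof
    show "presents (alph d A) R'' (gen d t A) H" by (rule P'')
    show "wt d w = 0" if "ev (gen d t A) w = 0" for w using that in_N_iff[of w] nD(1) by simp
    fix x y :: "nat \<times> bool" assume "fst x < d" "fst y < d"
    then have "(x, y) \<in> ({..<d} \<times> UNIV) \<times> ({..<d} \<times> UNIV)" by (auto simp: mem_Times_iff)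
    then have "(\<lambda>(x, y). lval t x + lval t y - lval t x - lval t y) (x, y) \<in> comms" unfolding comms_def by (rule imageI)
    then show "lval t x + lval t y - lval t x - lval t y \<in> A" by (simp add: A_def)
  qed
  have "Z.Nker = N"
  proof
    show "Z.Nker \<subseteq> N" using in_N_iff by (auto simp: Z.Nker_def)
    show "N \<subseteq> Z.Nker" using NH H_range in_N_iff by (fastforce simp: Z.Nker_def)
  qed
  moreover have "fin_pres {(g1, g2). g1 \<in> H \<and> g2 \<in> H \<and> - g1 + g2 \<in> Z.Nker}"
    using nofree HS by (intro Z.fin_pres_fibre_product) blast
  ultimately have fpP: "fin_pres {(g1, g2). g1 \<in> H \<and> g2 \<in> H \<and> - g1 + g2 \<in> N}" by simp
  \<comment> \<open>The first component alone decides the coset: if it lies in \<open>H\<close>, so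
    does the second one, as they differ by an element of \<open>N\<close>, which is contained in
    \<open>H\<close>.\<close>
  show ?thesis
  proof (rule fin_pres_finite_index_overgroup[OF fpP, where \<kappa> = "\<kappa> \<circ> fst"])
    let ?P = "{(g1, g2). g1 \<in> S \<and> g2 \<in> S \<and> - g1 + g2 \<in> N}"
    show P: "subgrp ?P" by (rule subgrp_fibre_product)
    show "{(g1, g2). g1 \<in> H \<and> g2 \<in> H \<and> - g1 + g2 \<in> N} \<subseteq> ?P" using HS by auto
    show "finite ((\<kappa> \<circ> fst) ` ?P)"
      by (rule finite_subset[OF _ fin]) auto
    fix x y assume xy: "x \<in> ?P" "y \<in> ?P"
    then have "x - y \<in> ?P" by (rule subgrpD(4)[OF P])
    then obtain z1 z2 where z: "x - y = (z1, z2)" "z1 \<in> S" "z2 \<in> S" "- z1 + z2 \<in> N" by auto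
    have "z1 \<in> H \<Longrightarrow> z2 \<in> H" using subgrpD(2)[OF H, of z1 "- z1 + z2"] subsetD[OF NH z(4)] by simp
    moreover have "z1 = fst x - fst y" using arg_cong[OF z(1), of fst] by simp
    moreover have "fst x \<in> S" "fst y \<in> S" using xy by auto
    ultimately show "(\<kappa> \<circ> fst) x = (\<kappa> \<circ> fst) y \<longleftrightarrow> x - y \<in> {(g1, g2). g1 \<in> H \<and> g2 \<in> H \<and> - g1 + g2 \<in> N}"
      using \<kappa>[of "fst x" "fst y"] z by simp blast
  qed
qed

end

theorem corollaryB:
  fixes G :: "('a, 'b) monoid_scheme" and N :: "'a set"
  assumes "group G"
    and "finitely_presented G"
    and "N \<lhd> G"
    and "derived G (carrier G) \<subseteq> N"
    and "\<not> (\<exists>H. subgroup H G \<and> is_free_group (G\<lparr>carrier := H\<rparr>) \<and> \<not> comm_group (G\<lparr>carrier := H\<rparr>))"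
  shows "finitely_presented ((G \<times>\<times> G)\<lparr>carrier := fibre_product G N\<rparr>)"
proof -
  interpret G: group G by (rule assms(1))
  interpret N: normal N G by (rule assms(3))
  define S where "S = cay G ` carrier G"
  define K where "K = cay G ` N"
  interpret Q: abelian_quotient S K
  proof
    show "subgrp S" unfolding S_def by (rule G.subgrp_cay[OF G.subgroup_self])
    show "subgrp K" unfolding K_def by (rule G.subgrp_cay[OF N.subgroup_axioms])
    show "K \<subseteq> S" using N.subset by (auto simp: K_def S_def)
    fix s n assume "s \<in> S" "n \<in> K"
    then obtain g k where gk: "s = cay G g" "g \<in> carrier G" "n = cay G k" "k \<in> N" by (auto simp: S_def K_def)
    then have "s + n - s = cay G (g \<otimes>\<^bsub>G\<^esub> k \<otimes>\<^bsub>G\<^esub> inv\<^bsub>G\<^esub> g)"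
      using N.subset by (auto simp: G.cay_mult G.cay_inv)
    then show "s + n - s \<in> K" using N.inv_op_closed2[OF gk(2,4)] by (auto simp: K_def)
  next
    fix x y assume "x \<in> S" "y \<in> S"
    then obtain g h where gh: "x = cay G g" "g \<in> carrier G" "y = cay G h" "h \<in> carrier G" by (auto simp: S_def)
    have "g \<otimes>\<^bsub>G\<^esub> h \<otimes>\<^bsub>G\<^esub> inv\<^bsub>G\<^esub> g \<otimes>\<^bsub>G\<^esub> inv\<^bsub>G\<^esub> h \<in> derived G (carrier G)"
      unfolding derived_def using gh by (intro generate.incl) auto
    moreover have "x + y - x - y = cay G (g \<otimes>\<^bsub>G\<^esub> h \<otimes>\<^bsub>G\<^esub> inv\<^bsub>G\<^esub> g \<otimes>\<^bsub>G\<^esub> inv\<^bsub>G\<^esub> h)"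
      using gh by (simp add: G.cay_mult G.cay_inv)
    ultimately show "x + y - x - y \<in> K" using assms(4) by (auto simp: K_def)
  qed
  have "\<not> free_pair x y" if "x \<in> S" "y \<in> S" for x y
    using that free_pair_imp_free_subgroup[OF assms(1)] assms(5) by (auto simp: S_def)
  with finitely_presented_imp_fin_pres[OF assms(2)]
  have fp: "fin_pres {(g1, g2). g1 \<in> S \<and> g2 \<in> S \<and> - g1 + g2 \<in> K}"
    by (intro Q.fin_pres_fibre_product) (simp_all add: S_def)
  have coset: "g1 <#\<^bsub>G\<^esub> N = g2 <#\<^bsub>G\<^esub> N \<longleftrightarrow> inv\<^bsub>G\<^esub> g1 \<otimes>\<^bsub>G\<^esub> g2 \<in> N"
    if g: "g1 \<in> carrier G" "g2 \<in> carrier G" for g1 g2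
  proof
    assume eq: "g1 <#\<^bsub>G\<^esub> N = g2 <#\<^bsub>G\<^esub> N"
    have "g2 \<in> g2 <#\<^bsub>G\<^esub> N" using g N.one_closed by (force simp: l_coset_def)
    then obtain n where n: "n \<in> N" "g2 = g1 \<otimes>\<^bsub>G\<^esub> n" unfolding eq[symmetric] by (auto simp: l_coset_def)
    then have "inv\<^bsub>G\<^esub> g1 \<otimes>\<^bsub>G\<^esub> g2 = n" using g N.subset by (auto simp: G.m_assoc[symmetric])
    then show "inv\<^bsub>G\<^esub> g1 \<otimes>\<^bsub>G\<^esub> g2 \<in> N" using n by simp
  next
    assume n: "inv\<^bsub>G\<^esub> g1 \<otimes>\<^bsub>G\<^esub> g2 \<in> N"
    define n where "n = inv\<^bsub>G\<^esub> g1 \<otimes>\<^bsub>G\<^esub> g2"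
    have nN: "n \<in> N" "n \<in> carrier G" using n g by (simp_all add: n_def)
    have g2: "g2 = g1 \<otimes>\<^bsub>G\<^esub> n" using g by (simp add: n_def G.m_assoc[symmetric])
    show "g1 <#\<^bsub>G\<^esub> N = g2 <#\<^bsub>G\<^esub> N"
    proof (intro equalityI subsetI)
      fix x assume "x \<in> g1 <#\<^bsub>G\<^esub> N"
      then obtain k where k: "k \<in> N" "x = g1 \<otimes>\<^bsub>G\<^esub> k" by (auto simp: l_coset_def)
      have kc: "k \<in> carrier G" using k N.subset by blast
      have "n \<otimes>\<^bsub>G\<^esub> (inv\<^bsub>G\<^esub> n \<otimes>\<^bsub>G\<^esub> k) = k"
        using nN(2) kc by (simp add: G.m_assoc[symmetric])
      then have "x = g2 \<otimes>\<^bsub>G\<^esub> (inv\<^bsub>G\<^esub> n \<otimes>\<^bsub>G\<^esub> k)"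
        using g nN kc by (simp add: g2 k(2) G.m_assoc)
      moreover have "inv\<^bsub>G\<^esub> n \<otimes>\<^bsub>G\<^esub> k \<in> N" using nN k by simp
      ultimately show "x \<in> g2 <#\<^bsub>G\<^esub> N" by (auto simp: l_coset_def)
    next
      fix x assume "x \<in> g2 <#\<^bsub>G\<^esub> N"
      then obtain k where k: "k \<in> N" "x = g2 \<otimes>\<^bsub>G\<^esub> k" by (auto simp: l_coset_def)
      then have "x = g1 \<otimes>\<^bsub>G\<^esub> (n \<otimes>\<^bsub>G\<^esub> k)" "n \<otimes>\<^bsub>G\<^esub> k \<in> N"
        using g nN N.subset by (auto simp: g2 G.m_assoc)
      then show "x \<in> g1 <#\<^bsub>G\<^esub> N" by (auto simp: l_coset_def)
    qed
  qed
  \<comment> \<open>The Cayley embedding in both components carries the fibre product onto the set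
    of pairs treated for permutation groups.\<close>
  define \<kappa> where "\<kappa> = (\<lambda>(g1, g2). (cay G g1, cay G g2))"
  have in_K: "- cay G g1 + cay G g2 \<in> K \<longleftrightarrow> inv\<^bsub>G\<^esub> g1 \<otimes>\<^bsub>G\<^esub> g2 \<in> N"
    if g: "g1 \<in> carrier G" "g2 \<in> carrier G" for g1 g2
  proof -
    have "- cay G g1 + cay G g2 = cay G (inv\<^bsub>G\<^esub> g1 \<otimes>\<^bsub>G\<^esub> g2)" using g by (simp add: G.cay_mult G.cay_inv)
    then show ?thesis
      using g N.subset inj_on_image_mem_iff[OF G.cay_inj, of "inv\<^bsub>G\<^esub> g1 \<otimes>\<^bsub>G\<^esub> g2" N] by (simp add: K_def)
  qed
  have image: "\<kappa> ` fibre_product G N = {(g1, g2). g1 \<in> S \<and> g2 \<in> S \<and> - g1 + g2 \<in> K}"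
    using in_K coset by (fastforce simp: \<kappa>_def fibre_product_def S_def image_iff)
  interpret GG: group "G \<times>\<times> G" by (rule DirProd_group[OF assms(1) assms(1)])
  have inj: "inj_on \<kappa> (carrier (G \<times>\<times> G))"
    using G.cay_inj by (auto simp: inj_on_def \<kappa>_def)
  have hom: "\<kappa> (x \<otimes>\<^bsub>G \<times>\<times> G\<^esub> y) = \<kappa> x + \<kappa> y" if "x \<in> carrier (G \<times>\<times> G)" "y \<in> carrier (G \<times>\<times> G)" for x y
    using that by (auto simp: \<kappa>_def G.cay_mult)
  have sub: "fibre_product G N \<subseteq> carrier (G \<times>\<times> G)" by (auto simp: fibre_product_def)
  have sg: "subgroup (fibre_product G N) (G \<times>\<times> G)"
  proof (rule GG.subgroupI)
    have P: "subgrp (\<kappa> ` fibre_product G N)" unfolding image by (rule Q.subgrp_fibre_product)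
    have mem: "x \<in> fibre_product G N" if "x \<in> carrier (G \<times>\<times> G)" "\<kappa> x \<in> \<kappa> ` fibre_product G N" for x
      using inj_on_image_mem_iff[OF inj that(1) sub] that(2) by blast
    show "fibre_product G N \<noteq> {}" by (auto simp: fibre_product_def)
    show "fibre_product G N \<subseteq> carrier (G \<times>\<times> G)" by (rule sub)
    show "x \<otimes>\<^bsub>G \<times>\<times> G\<^esub> y \<in> fibre_product G N" if x: "x \<in> fibre_product G N" and y: "y \<in> fibre_product G N" for x y
    proof (rule mem)
      show "x \<otimes>\<^bsub>G \<times>\<times> G\<^esub> y \<in> carrier (G \<times>\<times> G)"
        using subsetD[OF sub x] subsetD[OF sub y] by (rule GG.m_closed)
      show "\<kappa> (x \<otimes>\<^bsub>G \<times>\<times> G\<^esub> y) \<in> \<kappa> ` fibre_product G N"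
        unfolding hom[OF subsetD[OF sub x] subsetD[OF sub y]] using x y by (intro subgrpD(2)[OF P] imageI)
    qed
    show "inv\<^bsub>G \<times>\<times> G\<^esub> x \<in> fibre_product G N" if x: "x \<in> fibre_product G N" for x
    proof (rule mem)
      show "inv\<^bsub>G \<times>\<times> G\<^esub> x \<in> carrier (G \<times>\<times> G)" using subsetD[OF sub x] by (rule GG.inv_closed)
      have "\<kappa> (inv\<^bsub>G \<times>\<times> G\<^esub> x) = - \<kappa> x"
        using subsetD[OF sub x] inv_DirProd[OF assms(1) assms(1)] by (auto simp: \<kappa>_def G.cay_inv)
      then show "\<kappa> (inv\<^bsub>G \<times>\<times> G\<^esub> x) \<in> \<kappa> ` fibre_product G N"
        using subgrpD(3)[OF P imageI[OF x]] by simp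
    qed
  qed
  show ?thesis
  proof (rule fin_pres_imp_finitely_presented[where \<kappa> = \<kappa>])
    show "group ((G \<times>\<times> G)\<lparr>carrier := fibre_product G N\<rparr>)" by (rule GG.subgroup_imp_group[OF sg])
    show "inj_on \<kappa> (carrier ((G \<times>\<times> G)\<lparr>carrier := fibre_product G N\<rparr>))"
      using inj sub by (auto intro: inj_on_subset)
    show "fin_pres (\<kappa> ` carrier ((G \<times>\<times> G)\<lparr>carrier := fibre_product G N\<rparr>))"
      using fp by (simp add: image)
    fix x y
    assume "x \<in> carrier ((G \<times>\<times> G)\<lparr>carrier := fibre_product G N\<rparr>)"
      and "y \<in> carrier ((G \<times>\<times> G)\<lparr>carrier := fibre_product G N\<rparr>)"
    then show "\<kappa> (x \<otimes>\<^bsub>(G \<times>\<times> G)\<lparr>carrier := fibre_product G N\<rparr>\<^esub> y) = \<kappa> x + \<kappa> y"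
      using hom[of x y] sub by simp blast
  qed
qed

end
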